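(* Let $\mathcal{H}$, $T$, $E$, $m$, $\mathfrak{e}_j$, $\sigma_j$ be as in the context. Let $f:\mathcal{H}\to\mathbb{R}$ be an infinitely differentiable function belonging to $L^2(\mathcal{H},\mathcal{B},m)$ such that $\int_{\mathcal{H}}\|D^kf(x)\|\,dm(x)<\infty$ for every nonnegative integer $k$. Then for every positive integer $k$ and all $x^{(1)},\dots,x^{(k)}\in\ell_2(\mathbb{Z}^*,\mathbb{R})$, $$\mathcal{B}_{f_k}(x^{(1)},\dots,x^{(k)})=\frac{1}{k!}\int_{\mathcal{H}}D^kf(x)\big(\vartheta(x^{(1)}),\dots,\vartheta(x^{(k)})\big)\,dm(x).$$ In particular $\mathcal{B}_{f_k}$ is bounded and $\|\mathcal{B}_{f_k}\|=\frac{1}{k!}\big\|\int_{\mathcal{H}}D^kf(x)\,dm(x)\big\|$.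
   Context: $\mathcal{H}$ is a complex separable infinite-dimensional Hilbert space (inner product linear in the second variable), regarded as a real Banach space for differentiation; $D^kf(x)$ is the $k$-th (Fr\'echet) derivative, a bounded real $k$-linear form with norm $\|\phi\|=\sup_{\|x_i\|\le1}|\phi(x_1,\dots,x_k)|$, and $\int D^kf\,dm$ denotes the $k$-linear form $(x_1,\dots,x_k)\mapsto\int D^kf(x)(x_1,\dots,x_k)dm(x)$. $T$ is a bounded operator with a $\mu$-spanning $\mathbb{T}$-eigenvector field $E$ (bounded $E:\mathbb{T}\to\mathcal{H}$, $TE(\lambda)=\lambda E(\lambda)$, $\{E(\lambda):\lambda\in A\}$ spanning a dense subspace whenever $\mu(A)=1$, $\mu$ normalized Lebesgue measure on the unit circle $\mathbb{T}$). $R$: $\langle Rx,y\rangle=\int\langle x,E(\lambda)\rangle\overline{\langle y,E(\lambda)\rangle}d\mu$; $m$ the Gaussian measure with covariance $R$. $(e_j)_{j\ge1}$ orthonormal basis of eigenvectors of $R$, $Re_j=2\sigma_j^2e_j$; $\mathbb{Z}^*=\mathbb{Z}\setminus\{0\}$, $\mathfrak{e}_\ell=e_\ell$, $\mathfrak{e}_{-\ell}=ie_\ell$, $\sigma_{-\ell}=\sigma_\ell$. $\vartheta:\ell_2(\mathbb{Z}^*,\mathbb{R})\to\mathcal{H}$, $\vartheta(x)=\sum_{j\in\mathbb{Z}^*}x_j\mathfrak{e}_j$. $\mathcal{G}$ is the closed span in real $L^2(m)$ of $\mathfrak{Re}\langle\mathfrak{e}_k,\cdot\rangle$; $\mathcal{G}^k$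 the span of $k$-fold products; Wick transform $:h:=h-P_kh$ for $h\in\mathcal{G}^k$, $P_k$ projection onto closed span of $\mathcal{G}^0,\dots,\mathcal{G}^{k-1}$; $:\mathcal{G}^k:$ the closure of Wick transforms; $f_k$ the projection of $f$ on $:\mathcal{G}^k:$. $\alpha^{(k)}_{i_1,\dots,i_k}=\langle f,:\mathfrak{Re}\langle\mathfrak{e}_{i_1},\cdot\rangle\cdots\mathfrak{Re}\langle\mathfrak{e}_{i_k},\cdot\rangle:\rangle_{L^2(m)}/(k!\sigma_{i_1}^2\cdots\sigma_{i_k}^2)$ and $\mathcal{B}_{f_k}(x^{(1)},\dots,x^{(k)})=\sum_{(i_1,\dots,i_k)\in(\mathbb{Z}^* )^k}\alpha^{(k)}_{i_1,\dots,i_k}x^{(1)}_{i_1}\cdots x^{(k)}_{i_k}$. *)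

theory Defs
  imports "HOL-Probability.Probability"
begin

section \<open>Complex Hilbert space encoded as a real Hilbert space with a complex structure J\<close>

definition complex_structure :: "('a::real_inner \<Rightarrow> 'a) \<Rightarrow> bool" where
  "complex_structure J \<longleftrightarrow> bounded_linear J \<and> (\<forall>x. J (J x) = - x) \<and> (\<forall>x y. inner (J x) (J y) = inner x y)"

definition cscale :: "('a::real_vector \<Rightarrow> 'a) \<Rightarrow> complex \<Rightarrow> 'a \<Rightarrow> 'a" where
  "cscale J c x = Re c *\<^sub>R x + Im c *\<^sub>R J x"

text \<open>complex inner product, linear in the second variable\<close>
definition cinner :: "('a::real_inner \<Rightarrow> 'a) \<Rightarrow> 'a \<Rightarrow> 'a \<Rightarrow> complex" where
  "cinner J x y = Complex (inner x y) (- inner x (J y))"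

definition cspan :: "('a::real_vector \<Rightarrow> 'a) \<Rightarrow> 'a set \<Rightarrow> 'a set" where
  "cspan J S = span (S \<union> J ` S)"

definition muT :: "complex measure" where
  "muT = distr (restrict_space lborel {0..1::real}) borel (\<lambda>t. cis (2 * pi * t))"

definition circle :: "complex set" where
  "circle = sphere 0 1"

definition mu_spanning :: "('a::real_inner \<Rightarrow> 'a) \<Rightarrow> (complex \<Rightarrow> 'a) \<Rightarrow> bool" where
  "mu_spanning J E \<longleftrightarrow>
     (\<forall>A \<in> sets muT. measure muT A = 1 \<longrightarrow> closure (cspan J (E ` (A \<inter> circle))) = UNIV)"

definition gaussian_measure :: "('a::real_inner \<Rightarrow> 'a) \<Rightarrow> ('a \<Rightarrow> 'a) \<Rightarrow> 'a measure \<Rightarrow> bool" where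
  "gaussian_measure J R m \<longleftrightarrow> prob_space m \<and> sets m = sets borel \<and>
     (\<forall>x. (\<integral>z. cis (Re (cinner J x z)) \<partial>m) = complex_of_real (exp (- Re (cinner J (R x) x) / 4)))"

definition multilinear_form :: "nat \<Rightarrow> ('a::real_normed_vector list \<Rightarrow> real) \<Rightarrow> bool" where
  "multilinear_form k \<phi> \<longleftrightarrow>
     (\<forall>hs i a b h h'. length hs = k \<longrightarrow> i < k \<longrightarrow>
        \<phi> (hs[i := a *\<^sub>R h + b *\<^sub>R h']) = a * \<phi> (hs[i := h]) + b * \<phi> (hs[i := h']))
   \<and> (\<exists>C. \<forall>hs. length hs = k \<longrightarrow> \<bar>\<phi> hs\<bar> \<le> C * (\<Prod>h\<leftarrow>hs. norm h))"

definition mlnorm :: "nat \<Rightarrow> ('a::real_normed_vector list \<Rightarrow> real) \<Rightarrow> real" where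
  "mlnorm k \<phi> = Sup {\<bar>\<phi> hs\<bar> | hs. length hs = k \<and> (\<forall>h\<in>set hs. norm h \<le> 1)}"

text \<open>D k x is the k-th Frechet derivative of f at x; D (Suc k) x (u # hs) = (D (D^k f)(x) u) hs.\<close>
definition higher_derivs :: "('a::real_normed_vector \<Rightarrow> real) \<Rightarrow> (nat \<Rightarrow> 'a \<Rightarrow> 'a list \<Rightarrow> real) \<Rightarrow> bool" where
  "higher_derivs f D \<longleftrightarrow>
     (\<forall>x. D 0 x [] = f x) \<and>
     (\<forall>k x. multilinear_form k (D k x)) \<and>
     (\<forall>k x. \<forall>\<epsilon>>0. \<exists>\<delta>>0. \<forall>u. norm u < \<delta> \<longrightarrow>
        (\<forall>hs. length hs = k \<longrightarrow> (\<forall>h\<in>set hs. norm h \<le> 1) \<longrightarrow>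
           \<bar>D k (x + u) hs - D k x hs - D (Suc k) x (u # hs)\<bar> \<le> \<epsilon> * norm u))"

definition frak_e :: "('a \<Rightarrow> 'a) \<Rightarrow> (nat \<Rightarrow> 'a) \<Rightarrow> int \<Rightarrow> 'a::real_vector" where
  "frak_e J e l = (if l > 0 then e (nat l) else if l < 0 then J (e (nat (- l))) else 0)"

definition sigz :: "(nat \<Rightarrow> real) \<Rightarrow> int \<Rightarrow> real" where
  "sigz \<sigma> l = \<sigma> (nat \<bar>l\<bar>)"

definition Zstar :: "int set" where
  "Zstar = - {0}"

definition ell2 :: "(int \<Rightarrow> real) set" where
  "ell2 = {x. (\<lambda>j. (x j)\<^sup>2) summable_on Zstar}"

definition ell2norm :: "(int \<Rightarrow> real) \<Rightarrow> real" where
  "ell2norm x = sqrt (infsum (\<lambda>j. (x j)\<^sup>2) Zstar)"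

definition theta :: "('a \<Rightarrow> 'a) \<Rightarrow> (nat \<Rightarrow> 'a) \<Rightarrow> (int \<Rightarrow> real) \<Rightarrow> 'a::{real_normed_vector}" where
  "theta J e x = infsum (\<lambda>j. x j *\<^sub>R frak_e J e j) Zstar"

definition L2 :: "'a measure \<Rightarrow> ('a \<Rightarrow> real) set" where
  "L2 m = {g. g \<in> borel_measurable m \<and> integrable m (\<lambda>x. (g x)\<^sup>2)}"

definition l2dist :: "'a measure \<Rightarrow> ('a \<Rightarrow> real) \<Rightarrow> ('a \<Rightarrow> real) \<Rightarrow> real" where
  "l2dist m g h = sqrt (\<integral>x. (g x - h x)\<^sup>2 \<partial>m)"

definition fin_span :: "('a \<Rightarrow> real) set \<Rightarrow> ('a \<Rightarrow> real) set" where
  "fin_span S = {(\<lambda>x. \<Sum>s\<in>F. c s * s x) | F c. finite F \<and> F \<subseteq> S}"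

definition l2closure :: "'a measure \<Rightarrow> ('a \<Rightarrow> real) set \<Rightarrow> ('a \<Rightarrow> real) set" where
  "l2closure m S = {g \<in> L2 m. \<forall>\<epsilon>>0. \<exists>s\<in>S. l2dist m g s < \<epsilon>}"

definition l2cspan :: "'a measure \<Rightarrow> ('a \<Rightarrow> real) set \<Rightarrow> ('a \<Rightarrow> real) set" where
  "l2cspan m S = l2closure m (fin_span S)"

text \<open>orthogonal projection of h onto a closed subspace V of L^2(m) (a representative)\<close>
definition l2proj :: "'a measure \<Rightarrow> ('a \<Rightarrow> real) set \<Rightarrow> ('a \<Rightarrow> real) \<Rightarrow> ('a \<Rightarrow> real)" where
  "l2proj m V h = (SOME g. g \<in> V \<and> (\<forall>v\<in>V. (\<integral>x. (h x - g x) * v x \<partial>m) = 0))"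

definition gfun :: "('a::real_inner \<Rightarrow> 'a) \<Rightarrow> (nat \<Rightarrow> 'a) \<Rightarrow> int \<Rightarrow> 'a \<Rightarrow> real" where
  "gfun J e j = (\<lambda>z. Re (cinner J (frak_e J e j) z))"

definition Gsp :: "'a measure \<Rightarrow> ('a \<Rightarrow> 'a) \<Rightarrow> (nat \<Rightarrow> 'a) \<Rightarrow> ('a::real_inner \<Rightarrow> real) set" where
  "Gsp m J e = l2cspan m (gfun J e ` Zstar)"

definition Gk :: "'a measure \<Rightarrow> ('a \<Rightarrow> 'a) \<Rightarrow> (nat \<Rightarrow> 'a) \<Rightarrow> nat \<Rightarrow> ('a::real_inner \<Rightarrow> real) set" where
  "Gk m J e k = fin_span {(\<lambda>x. \<Prod>i<k. hs i x) | hs. \<forall>i<k. hs i \<in> Gsp m J e}"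

definition Pk :: "'a measure \<Rightarrow> ('a \<Rightarrow> 'a) \<Rightarrow> (nat \<Rightarrow> 'a) \<Rightarrow> nat \<Rightarrow> ('a::real_inner \<Rightarrow> real) \<Rightarrow> ('a \<Rightarrow> real)" where
  "Pk m J e k h = l2proj m (l2cspan m (\<Union>j<k. Gk m J e j)) h"

definition wick :: "'a measure \<Rightarrow> ('a \<Rightarrow> 'a) \<Rightarrow> (nat \<Rightarrow> 'a) \<Rightarrow> nat \<Rightarrow> ('a::real_inner \<Rightarrow> real) \<Rightarrow> ('a \<Rightarrow> real)" where
  "wick m J e k h = (\<lambda>x. h x - Pk m J e k h x)"

definition wickG :: "'a measure \<Rightarrow> ('a \<Rightarrow> 'a) \<Rightarrow> (nat \<Rightarrow> 'a) \<Rightarrow> nat \<Rightarrow> ('a::real_inner \<Rightarrow> real) set" where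
  "wickG m J e k = l2closure m {wick m J e k h | h. h \<in> Gk m J e k}"

definition chaos_proj :: "'a measure \<Rightarrow> ('a \<Rightarrow> 'a) \<Rightarrow> (nat \<Rightarrow> 'a) \<Rightarrow> nat \<Rightarrow> ('a::real_inner \<Rightarrow> real) \<Rightarrow> ('a \<Rightarrow> real)" where
  "chaos_proj m J e k f = l2proj m (wickG m J e k) f"

definition alpha :: "'a measure \<Rightarrow> ('a \<Rightarrow> 'a) \<Rightarrow> (nat \<Rightarrow> 'a) \<Rightarrow> (nat \<Rightarrow> real) \<Rightarrow> ('a::real_inner \<Rightarrow> real) \<Rightarrow> nat \<Rightarrow> int list \<Rightarrow> real" where
  "alpha m J e \<sigma> f k is =
     (\<integral>x. f x * wick m J e k (\<lambda>z. \<Prod>j<k. gfun J e (is ! j) z) x \<partial>m)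
     / (fact k * (\<Prod>j<k. (sigz \<sigma> (is ! j))\<^sup>2))"

fun iter_has_sum :: "nat \<Rightarrow> (int list \<Rightarrow> real) \<Rightarrow> real \<Rightarrow> bool" where
  "iter_has_sum 0 F s = (s = F [])"
| "iter_has_sum (Suc k) F s =
     (\<exists>g. (\<forall>i\<in>Zstar. iter_has_sum k (\<lambda>is. F (i # is)) (g i)) \<and> (g has_sum s) Zstar)"

definition Bform :: "'a measure \<Rightarrow> ('a \<Rightarrow> 'a) \<Rightarrow> (nat \<Rightarrow> 'a) \<Rightarrow> (nat \<Rightarrow> real) \<Rightarrow> ('a::real_inner \<Rightarrow> real) \<Rightarrow> nat \<Rightarrow> (int \<Rightarrow> real) list \<Rightarrow> real" where
  "Bform m J e \<sigma> f k xs =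
     (THE s. iter_has_sum k (\<lambda>is. alpha m J e \<sigma> f k is * (\<Prod>j<k. (xs ! j) (is ! j))) s)"

end

theory Submission
  imports Defs
begin

text \<open>Write \<open>b\<^sub>i\<close> for the real orthonormal basis \<open>frak_e J e\<close>. The covariance splits along each
  \<open>b\<^sub>i\<close>, so \<open>m\<close> is a normal law in direction \<open>b\<^sub>i\<close> times the law of the orthogonal
  component, and one-dimensional integration by parts on the fibres gives
  \<open>\<integral> \<langle>b\<^sub>i, z\<rangle> g dm = \<sigma>\<^sub>i\<^sup>2 \<integral> \<partial>\<^sub>i g dm\<close> as soon as \<open>g\<close> and \<open>\<partial>\<^sub>i g\<close> are integrable; integrability of
  the left-hand side is part of the conclusion. Trading polynomial factors for derivatives, all
  products of a polynomial with a derivative of \<open>f\<close> are integrable. Let \<open>W\<close> be obtained from \<open>1\<close>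
  by applying the adjoints \<open>\<langle>b\<^sub>i, z\<rangle> - \<sigma>\<^sub>i\<^sup>2 \<partial>\<^sub>i\<close> for \<open>i = i\<^sub>1, \<dots>, i\<^sub>k\<close>. Then \<open>\<integral> p W dm\<close> is
  \<open>\<sigma>\<^sub>i\<^sub>1\<^sup>2 \<dots> \<sigma>\<^sub>i\<^sub>k\<^sup>2\<close> times the integral of a \<open>k\<close>-fold derivative of \<open>p\<close>, so \<open>W\<close> is orthogonal to
  polynomials of degree below \<open>k\<close>, that is, \<open>W\<close> is the Wick transform of
  \<open>\<langle>b\<^sub>i\<^sub>1, z\<rangle> \<dots> \<langle>b\<^sub>i\<^sub>k, z\<rangle>\<close>; with \<open>f\<close> in place of \<open>p\<close> this computes \<open>\<alpha>\<close>. Both sides of the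
  theorem are therefore the bounded form \<open>\<integral> D\<^sup>kf dm / k!\<close> expanded along the basis.\<close>

section \<open>Probability measures on a separable inner product space\<close>

text \<open>The hypotheses give the derivatives of \<open>f\<close> only finite first moments, so
  Hoelder's inequality cannot make a product with an unbounded polynomial integrable: integration by
  parts has to produce integrability before it can produce an identity. Likewise the lower chaoses
  are built from \<open>L2\<close> limits of coordinates, and these need finite moments of every
  order before \<open>W\<close> can be tested against their products. The splitting of
  \<open>m\<close> along a direction is realised by resampling: replacing one coordinate of
  \<open>z\<close> by an independent normal variable leaves the characteristic function unchanged,
  and on a separable space the characteristic function determines the measure. Division by the
  variances in \<open>alpha\<close> is legitimate because a \<mu>-spanning field makes
  \<open>R\<close> injective. The expansion along the basis is an iterated sum: a bounded form is
  continuous in each slot, which allows summation over one index at a time, whereas boundedness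
  alone does not give joint summability over all multi-indices.\<close>

lemma countable_dense_of_span:
  fixes S :: "'a::real_normed_vector set"
  assumes S: "countable S" and dense: "closure (span S) = UNIV"
  obtains Q :: "'a set" where "countable Q" "closure Q = UNIV"
proof
  \<comment> \<open>Rational combinations are coded as finite lists of pairs, so that countability
    is that of \<open>lists\<close>.\<close>
  define F where "F = (\<lambda>l::(rat \<times> 'a) list. \<Sum>(q, v)\<leftarrow>l. real_of_rat q *\<^sub>R v)"
  define Q where "Q = F ` lists (UNIV \<times> S)"
  show "countable Q"
    unfolding Q_def using S by (intro countable_image countable_lists) auto
  have "v \<in> closure Q" if "v \<in> span S" for v
    unfolding closure_approachable
    using that
  proof (induction rule: span_induct_alt)
    case base
    have "F [] \<in> Q" unfolding Q_def by (intro imageI) auto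
    moreover have "F [] = 0" by (simp add: F_def)
    ultimately show ?case by (metis dist_self)
  next
    case (step c x y)
    show ?case
    proof (intro allI impI)
      fix \<epsilon> :: real assume \<epsilon>: "\<epsilon> > 0"
      have "\<exists>q\<in>Q. dist q y < \<epsilon> / 2"
        using step.IH half_gt_zero[OF \<epsilon>] by blast
      then obtain l where l: "l \<in> lists (UNIV \<times> S)" "dist (F l) y < \<epsilon> / 2"
        unfolding Q_def by blast
      have "c < c + \<epsilon> / (2 * (norm x + 1))"
        using \<epsilon> by (intro less_add_same_cancel1[THEN iffD2] divide_pos_pos mult_pos_pos) (auto intro: add_nonneg_pos)
      then obtain r where r: "c < real_of_rat r" "real_of_rat r < c + \<epsilon> / (2 * (norm x + 1))"
        using of_rat_dense by blast
      have "\<bar>real_of_rat r - c\<bar> * norm x \<le> \<epsilon> / (2 * (norm x + 1)) * norm x"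
        using r by (intro mult_right_mono) auto
      also have "\<dots> = \<epsilon> / 2 * (norm x / (norm x + 1))" by simp
      also have "\<dots> \<le> \<epsilon> / 2"
        using \<epsilon> by (intro mult_left_le) (auto simp: divide_le_eq_1 add_nonneg_pos)
      finally have "norm ((real_of_rat r - c) *\<^sub>R x) \<le> \<epsilon> / 2" by simp
      moreover have *: "F ((r, x) # l) - (c *\<^sub>R x + y) = (real_of_rat r - c) *\<^sub>R x + (F l - y)"
        by (simp add: F_def algebra_simps)
      ultimately have "dist (F ((r, x) # l)) (c *\<^sub>R x + y) < \<epsilon>"
        using l(2) norm_triangle_ineq[of "(real_of_rat r - c) *\<^sub>R x" "F l - y"]
        unfolding dist_norm * by linarith
      moreover have "F ((r, x) # l) \<in> Q"
        unfolding Q_def using l(1) step.hyps by (intro imageI) auto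
      ultimately show "\<exists>z\<in>Q. dist z (c *\<^sub>R x + y) < \<epsilon>" by blast
    qed
  qed
  then have "closure (span S) \<subseteq> closure Q"
    by (simp add: closure_minimal subsetI)
  then show "closure Q = UNIV" using dense by auto
qed

text \<open>Testing with \<open>q = z - d\<close> recovers the norm of \<open>z - d\<close>. The
  condition is closed in \<open>q\<close>, so the vectors of a dense set suffice, and a countable
  one turns a ball into a countable intersection of half-spaces.\<close>

lemma cball_eq_Inter_halfspaces:
  fixes d :: "'a::real_inner"
  assumes Q: "closure Q = UNIV" and r: "0 \<le> r"
  shows "cball d r = (\<Inter>q\<in>Q. {z. inner q z \<in> {..r * norm q + inner q d}})"
proof (intro equalityI subsetI)
  fix z assume z: "z \<in> cball d r"
  have "inner q (z - d) \<le> r * norm q" for q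
  proof -
    have "inner q (z - d) \<le> norm q * norm (z - d)" by (rule norm_cauchy_schwarz)
    also have "\<dots> \<le> norm q * r"
      using z by (intro mult_left_mono) (auto simp: dist_norm norm_minus_commute)
    finally show ?thesis by (simp add: mult.commute)
  qed
  then show "z \<in> (\<Inter>q\<in>Q. {z. inner q z \<in> {..r * norm q + inner q d}})"
    by (simp add: inner_diff_right algebra_simps)
next
  fix z assume z: "z \<in> (\<Inter>q\<in>Q. {z. inner q z \<in> {..r * norm q + inner q d}})"
  have "closed {q. inner q (z - d) \<le> r * norm q}"
    by (intro closed_Collect_le continuous_intros)
  moreover have "Q \<subseteq> {q. inner q (z - d) \<le> r * norm q}"
    using z by (auto simp: inner_diff_right algebra_simps)
  ultimately have "closure Q \<subseteq> {q. inner q (z - d) \<le> r * norm q}"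
    by (rule closure_minimal[rotated])
  then have "inner (z - d) (z - d) \<le> r * norm (z - d)" using Q by auto
  then have "norm (z - d) * norm (z - d) \<le> r * norm (z - d)"
    by (simp add: power2_norm_eq_inner[symmetric] power2_eq_square)
  then have "norm (z - d) \<le> r"
    using r by (cases "z = d") (auto simp: mult_le_cancel_right)
  then show "z \<in> cball d r" by (simp add: dist_norm norm_minus_commute)
qed

text \<open>An open set is the union of the countably many closed balls with centre in
  \<open>Q\<close> and rational radius that it contains, and balls are countable intersections of
  half-spaces.\<close>

lemma sets_borel_eq_inner:
  fixes Q :: "'a::real_inner set"
  assumes Q: "countable Q" "closure Q = UNIV"
  shows "sets (borel :: 'a measure)
    = sigma_sets UNIV {{z. inner h z \<in> A} | h A. A \<in> sets (borel :: real measure)}"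
    (is "_ = sigma_sets UNIV ?G")
proof
  interpret G: sigma_algebra UNIV "sigma_sets UNIV ?G"
    by (rule sigma_algebra_sigma_sets) simp
  have cb: "cball d r \<in> sigma_sets UNIV ?G" if "0 \<le> r" for d and r :: real
  proof (cases "Q = {}")
    case True
    then show ?thesis using Q by (metis UNIV_not_empty closure_empty)
  next
    case False
    have "{z. inner q z \<in> {..c}} \<in> sigma_sets UNIV ?G" for q c
      by (rule sigma_sets.Basic) (auto intro!: exI[of _ q] exI[of _ "{..c}"])
    then show ?thesis
      unfolding cball_eq_Inter_halfspaces[OF Q(2) that]
      using Q(1) False by (intro G.countable_INT'') auto
  qed
  have "U \<in> sigma_sets UNIV ?G" if U: "open U" for U :: "'a set"
  proof -
    define I where "I = {(d, r :: rat). d \<in> Q \<and> 0 \<le> r \<and> cball d (real_of_rat r) \<subseteq> U}"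
    have "countable I"
      by (rule countable_subset[of _ "Q \<times> UNIV"]) (use Q in \<open>auto simp: I_def\<close>)
    have "U = (\<Union>(d, r)\<in>I. cball d (real_of_rat r))"
    proof (intro equalityI subsetI)
      fix x assume "x \<in> U"
      then obtain \<epsilon> where \<epsilon>: "\<epsilon> > 0" "cball x \<epsilon> \<subseteq> U"
        using U open_contains_cball by blast
      obtain r where r: "0 < real_of_rat r" "real_of_rat r < \<epsilon> / 2"
        using of_rat_dense[of 0 "\<epsilon> / 2"] \<epsilon> by auto
      have "x \<in> closure Q" using Q by simp
      then obtain d where d: "d \<in> Q" "dist d x < real_of_rat r"
        using r(1) unfolding closure_approachable by blast
      have "cball d (real_of_rat r) \<subseteq> cball x \<epsilon>"
      proof
        fix y assume "y \<in> cball d (real_of_rat r)"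
        then show "y \<in> cball x \<epsilon>"
          using d(2) r(2) dist_triangle[of x y d] by (simp add: dist_commute)
      qed
      then have "(d, r) \<in> I" using d r \<epsilon> by (auto simp: I_def)
      moreover have "x \<in> cball d (real_of_rat r)" using d by simp
      ultimately show "x \<in> (\<Union>(d, r)\<in>I. cball d (real_of_rat r))" by blast
    qed (auto simp: I_def)
    also have "\<dots> \<in> sigma_sets UNIV ?G"
      using \<open>countable I\<close> cb by (intro G.countable_UN') (auto simp: I_def)
    finally show ?thesis .
  qed
  then show "sets (borel :: 'a measure) \<subseteq> sigma_sets UNIV ?G"
    unfolding borel_def by (simp, intro sigma_sets_mono) auto
  have "{z. inner h z \<in> A} \<in> sets borel" if "A \<in> sets borel" for h :: 'a and A :: "real set"
  proof -
    have "inner h \<in> borel_measurable borel"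
      by (intro borel_measurable_continuous_onI continuous_intros)
    from measurable_sets[OF this that] show ?thesis by (simp add: vimage_def)
  qed
  then show "sigma_sets UNIV ?G \<subseteq> sets borel"
    by (intro sets.sigma_sets_subset[of _ borel, simplified]) auto
qed

text \<open>Reduces measurability of a vector-valued map to scalar functions. It is meant for
  \<open>fibre\<close>, a sum of vectors depending on a point of a product space.\<close>

lemma borel_measurable_innerI:
  fixes \<Phi> :: "'b \<Rightarrow> 'a::real_inner" and Q :: "'a set"
  assumes Q: "countable Q" "closure Q = UNIV"
    and \<Phi>: "\<And>h. (\<lambda>x. inner h (\<Phi> x)) \<in> borel_measurable M"
  shows "\<Phi> \<in> borel_measurable M"
proof (rule measurable_sigma_sets[OF sets_borel_eq_inner[OF Q]])
  fix B assume "B \<in> {{z :: 'a. inner h z \<in> A} | h A. A \<in> sets (borel :: real measure)}"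
  then obtain h :: 'a and A :: "real set" where "B = {z. inner h z \<in> A}" "A \<in> sets borel" by auto
  then show "\<Phi> -` B \<inter> space M \<in> sets M"
    using measurable_sets[OF \<Phi>, of A h] by (simp add: vimage_def)
qed auto

lemma borel_measurable_inner_left [measurable]:
  "inner h \<in> borel_measurable (borel :: 'a::real_inner measure)"
  by (intro borel_measurable_continuous_onI continuous_intros)

lemma cis_measurable [measurable]: "cis \<in> borel_measurable borel"
  by (intro borel_measurable_continuous_onI continuous_intros)

lemma char_eq_cis: "char M t = (\<integral>x. cis (t * x) \<partial>M)"
  by (simp add: char_def cis_conv_exp)

text \<open>Normalising the weight turns it into the one-dimensional uniqueness theorem for
  characteristic functions, applied to the laws of \<open>u\<close> under two probability measures.\<close>

lemma weighted_integral_eqI: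
  fixes u w :: "'a \<Rightarrow> real"
  assumes M: "finite_measure M" and N: "finite_measure N" and MN: "sets M = sets N"
    and u [measurable]: "u \<in> borel_measurable M"
    and w [measurable]: "w \<in> borel_measurable M"
    and w0: "\<And>x. 0 \<le> w x" and wC: "\<And>x. w x \<le> C"
    and eq: "\<And>t. (\<integral>x. w x *\<^sub>R cis (t * u x) \<partial>M) = (\<integral>x. w x *\<^sub>R cis (t * u x) \<partial>N)"
    and A [measurable]: "A \<in> sets borel"
  shows "(\<integral>x. w x * indicator A (u x) \<partial>M) = (\<integral>x. w x * indicator A (u x) \<partial>N)"
proof -
  have meas [measurable]: "u \<in> borel_measurable N" "w \<in> borel_measurable N"
    using u w MN measurable_cong_sets[of N M borel borel] by blast+
  interpret M: finite_measure M by fact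
  interpret N: finite_measure N by fact
  have iM: "integrable M w" and iN: "integrable N w"
    using w0 wC by (intro M.integrable_const_bound[of _ C] N.integrable_const_bound[of _ C]; simp)+
  define c where "c = (\<integral>x. w x \<partial>M)"
  have cN: "c = (\<integral>x. w x \<partial>N)"
  proof -
    have "complex_of_real c = complex_of_real (\<integral>x. w x \<partial>N)"
      using eq[of 0] by (simp add: c_def scaleR_conv_of_real)
    then show ?thesis by (simp only: of_real_eq_iff)
  qed
  have c0: "0 \<le> c" unfolding c_def using w0 by simp
  show ?thesis
  \<comment> \<open>A weight of mass zero cannot be normalised, but then it vanishes almost
    everywhere for both measures.\<close>
  proof (cases "c = 0")
    case True
    have "AE x in M. w x = 0" "AE x in N. w x = 0"
      using True c_def cN integral_nonneg_eq_0_iff_AE[OF iM] integral_nonneg_eq_0_iff_AE[OF iN] w0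
      by auto
    then have "(\<integral>x. w x * indicator A (u x) \<partial>M) = 0" "(\<integral>x. w x * indicator A (u x) \<partial>N) = 0"
      by (auto intro!: integral_eq_zero_AE)
    then show ?thesis by simp
  next
    case False
    with c0 have c: "c > 0" by simp
    define law where "law K = distr (density K (\<lambda>x. ennreal (w x / c))) borel u" for K
    have rd: "real_distribution (law K)"
      if "u \<in> borel_measurable K" "w \<in> borel_measurable K" "integrable K w" "c = (\<integral>x. w x \<partial>K)" for K
    proof -
      note [measurable] = that(1,2)
      have "emeasure (density K (\<lambda>x. ennreal (w x / c))) (space K) = (\<integral>\<^sup>+x. ennreal (w x / c) \<partial>K)"
        by (subst emeasure_density) (auto intro!: nn_integral_cong)
      also have "\<dots> = ennreal ((\<integral>x. w x \<partial>K) / c)"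
        using that c w0 by (subst nn_integral_eq_integral) auto
      also have "\<dots> = 1" using that c by simp
      finally have "prob_space (density K (\<lambda>x. ennreal (w x / c)))"
        by (intro prob_spaceI) simp
      then show ?thesis
        unfolding law_def by (intro prob_space.real_distribution_distr) auto
    qed
    have ch: "char (law K) t = (1 / c) *\<^sub>R (\<integral>x. w x *\<^sub>R cis (t * u x) \<partial>K)"
      if [measurable]: "u \<in> borel_measurable K" "w \<in> borel_measurable K" for K t
      unfolding law_def char_eq_cis using c w0
      by (subst integral_distr, simp, simp, subst integral_density)
        (auto simp: scaleR_scaleR[symmetric] divide_inverse_commute simp del: scaleR_scaleR)
    have "law M = law N"
      using iM iN c_def cN eq by (intro Levy_uniqueness rd ext) (simp_all add: ch)
    moreover have "(\<integral>y. indicator A y \<partial>law K) = (\<integral>x. w x * indicator A (u x) \<partial>K) / c"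
      if [measurable]: "u \<in> borel_measurable K" "w \<in> borel_measurable K" for K
      unfolding law_def using c w0
      by (subst integral_distr, simp, simp, subst integral_density) auto
    ultimately show ?thesis using c u w meas by (metis divide_cancel_right less_irrefl)
  qed
qed

section \<open>Cylinder sets and uniqueness of characteristic functions\<close>

definition cylinder :: "('a::real_inner \<times> real set) list \<Rightarrow> 'a set" where
  "cylinder L = {z. \<forall>(h, A)\<in>set L. inner h z \<in> A}"

lemma cylinder_Nil [simp]: "cylinder [] = UNIV"
  by (simp add: cylinder_def)

lemma cylinder_Cons: "cylinder ((h, A) # L) = {z. inner h z \<in> A} \<inter> cylinder L"
  by (auto simp: cylinder_def)

lemma cylinder_append: "cylinder (L @ L') = cylinder L \<inter> cylinder L'"
  by (auto simp: cylinder_def)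

lemma cylinder_borel:
  "(\<And>h A. (h, A) \<in> set L \<Longrightarrow> A \<in> sets borel) \<Longrightarrow> cylinder L \<in> sets borel"
proof (induction L)
  case (Cons p L)
  obtain h A where p: "p = (h, A)" by (cases p)
  have "A \<in> sets borel" using Cons.prems p by auto
  then have "{z. inner h z \<in> A} \<in> sets borel"
    using measurable_sets[OF borel_measurable_inner_left, of A h] by (simp add: vimage_def)
  then show ?case
    using Cons.IH Cons.prems unfolding p cylinder_Cons by auto
qed simp

text \<open>The constraints are added one at a time, each through the one-dimensional law of
  \<open>inner h\<close>. The character \<open>cis (inner x z)\<close> with arbitrary
  \<open>x\<close> stays in the integrand so that the induction hypothesis still controls all
  frequencies when the next constraint arrives.\<close>

lemma cylinder_charfun_eq:
  fixes M N :: "'a::real_inner measure"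
  assumes M: "prob_space M" "sets M = sets borel" and N: "prob_space N" "sets N = sets borel"
    and eq: "\<And>x. (\<integral>z. cis (inner x z) \<partial>M) = (\<integral>z. cis (inner x z) \<partial>N)"
    and L: "\<And>h A. (h, A) \<in> set L \<Longrightarrow> A \<in> sets borel"
  shows "(\<integral>z. indicator (cylinder L) z *\<^sub>R cis (inner x z) \<partial>M)
       = (\<integral>z. indicator (cylinder L) z *\<^sub>R cis (inner x z) \<partial>N)"
  using L
proof (induction L arbitrary: x)
  case Nil
  then show ?case using eq by simp
next
  case (Cons p L)
  obtain h A where p: "p = (h, A)" by (cases p)
  have A [measurable]: "A \<in> sets borel" using Cons.prems p by auto
  define ind where "ind = (indicator (cylinder L) :: 'a \<Rightarrow> real)"
  have L_borel: "cylinder L \<in> sets borel" using Cons.prems by (intro cylinder_borel) auto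
  have ind_borel [measurable]: "ind \<in> borel_measurable borel"
    unfolding ind_def using L_borel by simp
  have ind01: "0 \<le> ind z" "ind z \<le> 1" for z by (simp_all add: ind_def indicator_def)
  have IH: "(\<integral>z. ind z *\<^sub>R cis (inner y z) \<partial>M) = (\<integral>z. ind z *\<^sub>R cis (inner y z) \<partial>N)" for y
    unfolding ind_def using Cons.prems by (intro Cons.IH) auto
  have int: "integrable K (\<lambda>z. ind z *\<^sub>R cis (inner y z))"
    if "K \<in> {M, N}" for K y
  proof -
    have [measurable_cong]: "sets K = sets borel" using that M N by auto
    interpret K: prob_space K using that M N by auto
    show ?thesis
      using ind01 by (intro K.integrable_const_bound[of _ 1]) (auto simp: abs_le_iff)
  qed
  \<comment> \<open>Multiplication by a cosine or sine of \<open>inner x z\<close> only shifts the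
    frequency \<open>t h\<close> by \<open>x\<close> and \<open>- x\<close>; both shifted characters
    are covered by the induction hypothesis.\<close>
  have cos_cis: "(ind z * cos (inner x z)) *\<^sub>R cis (t * inner h z)
      = (ind z *\<^sub>R cis (inner (t *\<^sub>R h + x) z) + ind z *\<^sub>R cis (inner (t *\<^sub>R h - x) z)) / 2" for t z
    by (simp add: complex_eq_iff inner_add_left inner_diff_left cos_add cos_diff sin_add sin_diff
        algebra_simps)
  have sin_cis: "(ind z * sin (inner x z)) *\<^sub>R cis (t * inner h z)
      = (ind z *\<^sub>R cis (inner (t *\<^sub>R h + x) z) - ind z *\<^sub>R cis (inner (t *\<^sub>R h - x) z)) * (- \<i> / 2)" for t z
    by (simp add: complex_eq_iff inner_add_left inner_diff_left cos_add cos_diff sin_add sin_diff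
        field_simps)
  have fin: "finite_measure M" "finite_measure N" and MN: "sets M = sets N"
    using M N by (auto simp: prob_space_def)
  have [measurable_cong]: "sets M = sets borel" "sets N = sets borel" by fact+
  have slice: "(\<integral>z. w z * indicator A (inner h z) \<partial>M) = (\<integral>z. w z * indicator A (inner h z) \<partial>N)"
    if [measurable]: "w \<in> borel_measurable borel" and "\<And>z. 0 \<le> w z" "\<And>z. w z \<le> 2"
      and "\<And>t. (\<integral>z. w z *\<^sub>R cis (t * inner h z) \<partial>M) = (\<integral>z. w z *\<^sub>R cis (t * inner h z) \<partial>N)" for w
    using that by (intro weighted_integral_eqI[OF fin MN, where C = 2]) auto
  have s0: "(\<integral>z. ind z * indicator A (inner h z) \<partial>M) = (\<integral>z. ind z * indicator A (inner h z) \<partial>N)"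
    using ind01 IH[of "_ *\<^sub>R h"] by (intro slice) (auto intro: order_trans[OF ind01(2)])
  \<comment> \<open>\<open>weighted_integral_eqI\<close> wants a nonnegative weight, which a cosine
    or sine is not. The weight \<open>1 + c\<close> lies between 0 and 2, the source of
    \<open>C = 2\<close> above, and the contribution of the 1 is removed with
    \<open>s0\<close>.\<close>
  have trig: "(\<integral>z. ind z * c (inner x z) * indicator A (inner h z) \<partial>M)
      = (\<integral>z. ind z * c (inner x z) * indicator A (inner h z) \<partial>N)"
    if [measurable]: "c \<in> borel_measurable borel" and c1: "\<And>s. \<bar>c s\<bar> \<le> 1"
      and eq: "\<And>t. (\<integral>z. (ind z * c (inner x z)) *\<^sub>R cis (t * inner h z) \<partial>M)
         = (\<integral>z. (ind z * c (inner x z)) *\<^sub>R cis (t * inner h z) \<partial>N)" for c :: "real \<Rightarrow> real"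
  proof -
    have ic: "\<bar>ind z * c s\<bar> \<le> 1" for z s
      using mult_mono[OF ind01(2) c1[of s]] ind01(1)[of z] by (simp add: abs_mult)
    have b: "0 \<le> 1 + c s" "1 + c s \<le> 2" for s using c1[of s] by (auto simp: abs_le_iff)
    have i1: "integrable K (\<lambda>z. (ind z * c (inner x z)) *\<^sub>R cis (t * inner h z))" if "K \<in> {M, N}" for K t
    proof -
      have [measurable_cong]: "sets K = sets borel" using that M N by auto
      interpret K: prob_space K using that M N by auto
      show ?thesis
        using ic by (intro K.integrable_const_bound[of _ 1]) auto
    qed
    have i2: "integrable K (\<lambda>z. ind z * indicator A (inner h z))"
         "integrable K (\<lambda>z. ind z * c (inner x z) * indicator A (inner h z))" if "K \<in> {M, N}" for K
    proof -
      have [measurable_cong]: "sets K = sets borel" using that M N by auto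
      interpret K: prob_space K using that M N by auto
      show "integrable K (\<lambda>z. ind z * indicator A (inner h z))"
         "integrable K (\<lambda>z. ind z * c (inner x z) * indicator A (inner h z))"
        using ind01 ic by (auto intro!: K.integrable_const_bound[of _ 1] simp: indicator_def)
    qed
    have "(\<integral>z. (ind z * (1 + c (inner x z))) *\<^sub>R cis (t * inner h z) \<partial>M)
        = (\<integral>z. (ind z * (1 + c (inner x z))) *\<^sub>R cis (t * inner h z) \<partial>N)" for t
      using int[of _ "t *\<^sub>R h"] IH[of "t *\<^sub>R h"] i1[of _ t] eq[of t]
      by (simp add: distrib_left scaleR_add_left)
    then have "(\<integral>z. ind z * (1 + c (inner x z)) * indicator A (inner h z) \<partial>M)
        = (\<integral>z. ind z * (1 + c (inner x z)) * indicator A (inner h z) \<partial>N)"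
      using ind01 b mult_mono[OF ind01(2) b(2)] by (intro slice) (auto intro!: mult_nonneg_nonneg)
    then show ?thesis
      using i2 s0 by (simp add: distrib_left distrib_right)
  qed
  have tcos: "(\<integral>z. ind z * cos (inner x z) * indicator A (inner h z) \<partial>M)
      = (\<integral>z. ind z * cos (inner x z) * indicator A (inner h z) \<partial>N)"
    by (rule trig) (use int IH in \<open>simp_all add: cos_cis\<close>)
  have tsin: "(\<integral>z. ind z * sin (inner x z) * indicator A (inner h z) \<partial>M)
      = (\<integral>z. ind z * sin (inner x z) * indicator A (inner h z) \<partial>N)"
    by (rule trig) (use int IH in \<open>simp_all add: sin_cis\<close>)
  have "(\<integral>z. indicator (cylinder (p # L)) z *\<^sub>R cis (inner x z) \<partial>K)
      = Complex (\<integral>z. ind z * cos (inner x z) * indicator A (inner h z) \<partial>K)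
          (\<integral>z. ind z * sin (inner x z) * indicator A (inner h z) \<partial>K)"
    if K: "K \<in> {M, N}" for K
  proof -
    have [measurable_cong]: "sets K = sets borel" using that M N by auto
    interpret K: prob_space K using that M N by auto
    have e: "indicator (cylinder (p # L)) z *\<^sub>R cis (inner x z)
        = (indicator A (inner h z) * ind z) *\<^sub>R cis (inner x z)" for z
      by (auto simp: p cylinder_Cons ind_def indicator_def)
    have i: "integrable K (\<lambda>z. (indicator A (inner h z) * ind z) *\<^sub>R cis (inner x z))"
      using ind01 by (intro K.integrable_const_bound[of _ 1]) (auto simp: indicator_def)
    show ?thesis
      unfolding e using integral_Re[OF i] integral_Im[OF i]
      by (simp add: complex_eq_iff mult_ac)
  qed
  then show ?case using tcos tsin by simp
qed

theorem measure_eqI_charfun: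
  fixes M N :: "'a::real_inner measure" and Q :: "'a set"
  assumes Q: "countable Q" "closure Q = UNIV"
    and M: "prob_space M" "sets M = sets borel" and N: "prob_space N" "sets N = sets borel"
    and eq: "\<And>x. (\<integral>z. cis (inner x z) \<partial>M) = (\<integral>z. cis (inner x z) \<partial>N)"
  shows "M = N"
proof -
  interpret M: prob_space M by fact
  interpret N: prob_space N by fact
  define \<C> where "\<C> = {cylinder L | L :: ('a \<times> real set) list. \<forall>(h, A)\<in>set L. A \<in> sets borel}"
  have \<C>_borel: "C \<in> sets borel" if "C \<in> \<C>" for C
    using that cylinder_borel unfolding \<C>_def by blast
  have "sets (borel :: 'a measure) = sigma_sets UNIV \<C>"
  proof
    have "{z. inner h z \<in> A} \<in> \<C>" if "A \<in> sets borel" for h A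
      unfolding \<C>_def using that
      by (intro CollectI exI[of _ "[(h, A)]"]) (auto simp: cylinder_def)
    then show "sets (borel :: 'a measure) \<subseteq> sigma_sets UNIV \<C>"
      unfolding sets_borel_eq_inner[OF Q] by (intro sigma_sets_mono') auto
    show "sigma_sets UNIV \<C> \<subseteq> sets borel"
      using \<C>_borel by (intro sets.sigma_sets_subset[of _ borel, simplified]) auto
  qed
  note gen = this
  show ?thesis
  proof (rule measure_eqI_generator_eq[where E = \<C> and \<Omega> = UNIV and A = "\<lambda>_. UNIV"])
    show "Int_stable \<C>"
    proof (rule Int_stableI)
      fix a b assume "a \<in> \<C>" "b \<in> \<C>"
      then obtain K L :: "('a \<times> real set) list" where "a = cylinder K" "b = cylinder L"
        "\<forall>(h, A)\<in>set K. A \<in> sets borel" "\<forall>(h, A)\<in>set L. A \<in> sets borel"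
        unfolding \<C>_def by blast
      then show "a \<inter> b \<in> \<C>"
        unfolding \<C>_def by (intro CollectI exI[of _ "K @ L"]) (auto simp: cylinder_append)
    qed
    show "emeasure M C = emeasure N C" if C: "C \<in> \<C>" for C
    proof -
      obtain L :: "('a \<times> real set) list" where L: "C = cylinder L" "\<forall>(h, A)\<in>set L. A \<in> sets borel"
        using C unfolding \<C>_def by auto
      \<comment> \<open>At frequency 0 the character is 1 and only the measure of the cylinder
        remains.\<close>
      have "(\<integral>z. indicator C z *\<^sub>R cis (inner 0 z) \<partial>M) = (\<integral>z. indicator C z *\<^sub>R cis (inner 0 z) \<partial>N)"
        unfolding L(1) using L(2) by (intro cylinder_charfun_eq M N eq) auto
      then have "measure M C = measure N C"
        using \<C>_borel[OF C] M N
        by (simp add: scaleR_conv_of_real complex_of_real_integrable_eq sets_eq_imp_space_eq)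
      then show ?thesis by (simp add: M.emeasure_eq_measure N.emeasure_eq_measure)
    qed
    show "range (\<lambda>_. UNIV) \<subseteq> \<C>"
      unfolding \<C>_def by (auto intro!: exI[of _ "[]"])
  qed (use M N gen in \<open>auto simp: M.emeasure_eq_measure\<close>)
qed

section \<open>Integration by parts for the standard normal law\<close>

text \<open>A nonzero limit would keep the modulus of \<open>G\<close> above half of its limit on a
  half-line, which has infinite measure.\<close>

lemma integrable_limit_at_top_zero:
  fixes G :: "real \<Rightarrow> real"
  assumes G: "integrable lborel G" and lim: "(G \<longlongrightarrow> L) at_top"
  shows "L = 0"
proof (rule ccontr)
  assume "L \<noteq> 0"
  have [measurable]: "G \<in> borel_measurable borel" using G by auto
  have "((\<lambda>x. \<bar>G x\<bar>) \<longlongrightarrow> \<bar>L\<bar>) at_top" using lim by (rule tendsto_rabs)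
  then have "eventually (\<lambda>x. \<bar>L\<bar> / 2 < \<bar>G x\<bar>) at_top"
    by (rule order_tendstoD) (use \<open>L \<noteq> 0\<close> in auto)
  then obtain B where B: "\<And>x. B \<le> x \<Longrightarrow> \<bar>L\<bar> / 2 < \<bar>G x\<bar>"
    by (auto simp: eventually_at_top_linorder)
  have "emeasure lborel {B..} = \<infinity>"
  proof (rule ccontr)
    assume "emeasure lborel {B..} \<noteq> \<infinity>"
    then have fin: "emeasure lborel {B..} < \<infinity>" by (simp add: less_top)
    have "ennreal c \<le> emeasure lborel {B..}" if "c \<ge> 0" for c
      using emeasure_mono[of "{B..B + c}" "{B..}" lborel] that by auto
    from this[of "enn2real (emeasure lborel {B..}) + 1"] fin
    have "enn2real (emeasure lborel {B..}) + 1 \<le> enn2real (emeasure lborel {B..})"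
      by (metis add_nonneg_nonneg enn2real_ennreal enn2real_mono enn2real_nonneg zero_le_one
          infinity_ennreal_def)
    then show False by simp
  qed
  then have "\<infinity> = (\<integral>\<^sup>+x. ennreal (\<bar>L\<bar> / 2) * indicator {B..} x \<partial>lborel)"
    using \<open>L \<noteq> 0\<close> by (subst nn_integral_cmult_indicator) (auto simp: ennreal_mult_top)
  also have "\<dots> \<le> (\<integral>\<^sup>+x. ennreal (norm (G x)) \<partial>lborel)"
    using B by (intro nn_integral_mono) (auto simp: indicator_def intro!: ennreal_leI less_imp_le)
  also have "\<dots> < \<infinity>" using G by (simp add: integrable_iff_bounded)
  finally show False by simp
qed

text \<open>No decay of \<open>F\<close> is known in advance. The integral of \<open>F'\<close> is
  the limit of \<open>F b - F (- b)\<close>, and this function of \<open>b\<close> is itself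
  integrable, so its limit can only be 0.\<close>

lemma integral_derivative_eq_0:
  fixes F :: "real \<Rightarrow> real"
  assumes F: "\<And>x. (F has_real_derivative F' x) (at x)" and cont: "continuous_on UNIV F'"
    and int: "integrable lborel F" "integrable lborel F'"
  shows "(\<integral>x. F' x \<partial>lborel) = 0"
proof (rule integrable_limit_at_top_zero)
  show "integrable lborel (\<lambda>b. F b - F (- b))"
    using int(1) lborel_integrable_real_affine_iff[of "-1" F 0] by auto
  have [measurable]: "F' \<in> borel_measurable borel" using int by auto
  have "((\<lambda>b. \<integral>x. indicator {- b..b} x * F' x \<partial>lborel) \<longlongrightarrow> (\<integral>x. F' x \<partial>lborel)) at_top"
  proof (rule integral_dominated_convergence_at_top)
    show "integrable lborel (\<lambda>x. \<bar>F' x\<bar>)" using int by auto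
    show "\<forall>\<^sub>F b in at_top. AE x in lborel. norm (indicator {- b..b} x * F' x) \<le> \<bar>F' x\<bar>"
      by (auto simp: indicator_def)
    show "AE x in lborel. ((\<lambda>b. indicator {- b..b} x * F' x) \<longlongrightarrow> F' x) at_top"
    proof (rule AE_I2, rule tendsto_eventually)
      show "\<forall>\<^sub>F b in at_top. indicator {- b..b} x * F' x = F' x" for x
        by (rule eventually_mono[OF eventually_ge_at_top[of "\<bar>x\<bar>"]]) (auto simp: indicator_def)
    qed
  qed auto
  moreover have "\<forall>\<^sub>F b in at_top. (\<integral>x. indicator {- b..b} x * F' x \<partial>lborel) = F b - F (- b)"
  proof (rule eventually_mono[OF eventually_ge_at_top[of 0]])
    fix b :: real assume "0 \<le> b"
    then show "(\<integral>x. indicator {- b..b} x * F' x \<partial>lborel) = F b - F (- b)"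
      using integral_FTC_Icc_real[of "-b" b F F'] F cont
      by (simp add: mult.commute continuous_on_eq_continuous_at)
  qed
  ultimately show "((\<lambda>b. F b - F (- b)) \<longlongrightarrow> (\<integral>x. F' x \<partial>lborel)) at_top"
    by (rule Lim_transform_eventually)
qed

lemma nn_integral_le_of_Icc:
  fixes f :: "real \<Rightarrow> ennreal"
  assumes [measurable]: "f \<in> borel_measurable borel"
    and le: "\<And>n::nat. (\<integral>\<^sup>+x. f x * indicator {- real n..real n} x \<partial>lborel) \<le> C"
  shows "(\<integral>\<^sup>+x. f x \<partial>lborel) \<le> C"
proof -
  have "f x = (SUP n::nat. f x * indicator {- real n..real n} x)" for x
  proof (rule antisym)
    obtain n :: nat where "\<bar>x\<bar> \<le> real n" using real_arch_simple by blast
    then have "f x = f x * indicator {- real n..real n} x" by (auto simp: indicator_def)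
    also have "\<dots> \<le> (SUP n::nat. f x * indicator {- real n..real n} x)"
      by (rule SUP_upper) simp
    finally show "f x \<le> (SUP n::nat. f x * indicator {- real n..real n} x)" .
  qed (auto intro!: SUP_least simp: indicator_def)
  then have "(\<integral>\<^sup>+x. f x \<partial>lborel) = (\<integral>\<^sup>+x. (SUP n::nat. f x * indicator {- real n..real n} x) \<partial>lborel)"
    by simp
  also have "\<dots> = (SUP n::nat. \<integral>\<^sup>+x. f x * indicator {- real n..real n} x \<partial>lborel)"
    by (rule nn_integral_monotone_convergence_SUP)
      (auto simp: incseq_def le_fun_def indicator_def)
  also have "\<dots> \<le> C" using le by (rule SUP_least)
  finally show ?thesis .
qed

lemma has_real_derivative_std_normal_density:
  "(std_normal_density has_real_derivative - x * std_normal_density x) (at x)"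
proof -
  have "((\<lambda>x. c * exp (- x\<^sup>2 / 2)) has_real_derivative - x * (c * exp (- x\<^sup>2 / 2))) (at x)"
    for c by (auto intro!: derivative_eq_intros)
  then show ?thesis unfolding std_normal_density_def .
qed

lemma has_real_derivative_imp_borel:
  fixes \<phi> :: "real \<Rightarrow> real"
  assumes "\<And>x. (\<phi> has_real_derivative \<phi>' x) (at x)"
  shows "\<phi> \<in> borel_measurable borel"
  using assms DERIV_isCont
  by (intro borel_measurable_continuous_onI) (auto simp: continuous_on_eq_continuous_at)

text \<open>Integrate the derivative of \<open>p S \<psi>\<close> over \<open>[-n, n]\<close>, where \<open>p\<close> is the normal density,
  \<open>S x = x / sqrt (1 + x\<^sup>2)\<close> is a smooth odd sign and \<open>\<psi> = sqrt (1 + \<phi>\<^sup>2)\<close> a smooth modulus: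
  the boundary terms have the favourable sign.\<close>

lemma std_normal_weighted_bound:
  fixes \<phi> :: "real \<Rightarrow> real"
  assumes \<phi>: "\<And>x. (\<phi> has_real_derivative \<phi>' x) (at x)" and cont: "continuous_on UNIV \<phi>'"
  shows "(\<integral>\<^sup>+x. ennreal \<bar>x * \<phi> x\<bar> \<partial>std_normal_distribution)
    \<le> (\<integral>\<^sup>+x. ennreal (2 + 2 * \<bar>\<phi> x\<bar> + \<bar>\<phi>' x\<bar>) \<partial>std_normal_distribution)"
proof -
  have \<phi>_borel [measurable]: "\<phi> \<in> borel_measurable borel"
    using \<phi> by (rule has_real_derivative_imp_borel)
  have \<phi>'_borel [measurable]: "\<phi>' \<in> borel_measurable borel"
    using cont by (rule borel_measurable_continuous_onI)
  have \<phi>_cont: "isCont \<phi> x" for x using \<phi> DERIV_isCont by blast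
  have \<phi>'_cont: "isCont \<phi>' x" for x using cont by (simp add: continuous_on_eq_continuous_at)
  let ?p = std_normal_density
  define r where "r x = sqrt (1 + x\<^sup>2)" for x :: real
  define S where "S x = x / r x" for x
  define S' where "S' x = 1 / (r x) ^ 3" for x
  define \<psi> where "\<psi> x = sqrt (1 + (\<phi> x)\<^sup>2)" for x
  define \<psi>' where "\<psi>' x = \<phi> x * \<phi>' x / \<psi> x" for x
  have pos: "0 < 1 + y\<^sup>2" for y :: real by (simp add: add_pos_nonneg)
  have r2: "(r x)\<^sup>2 = 1 + x\<^sup>2" and r1: "1 \<le> r x" and rx: "\<bar>x\<bar> \<le> r x" for x
    using pos[of x] by (auto simp: r_def intro!: real_le_rsqrt)
  have r0: "0 < r x" for x using r1[of x] by linarith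
  have \<psi>0: "0 < \<psi> x" and \<psi>\<phi>: "\<bar>\<phi> x\<bar> \<le> \<psi> x" and \<psi>1: "\<psi> x \<le> 1 + \<bar>\<phi> x\<bar>" for x
    using pos[of "\<phi> x"]
    by (auto simp: \<psi>_def intro!: real_le_rsqrt real_le_lsqrt) (simp add: power2_eq_square algebra_simps)
  have S1: "\<bar>S x\<bar> \<le> 1" for x using rx[of x] r0[of x] by (simp add: S_def)
  have S'1: "0 \<le> S' x" "S' x \<le> 1" for x
    using r1[of x] r0[of x] by (auto simp: S'_def one_le_power less_imp_le)
  have \<psi>'1: "\<bar>\<psi>' x\<bar> \<le> \<bar>\<phi>' x\<bar>" for x
  proof -
    have "\<bar>\<phi> x\<bar> * \<bar>\<phi>' x\<bar> \<le> \<psi> x * \<bar>\<phi>' x\<bar>" using \<psi>\<phi> by (rule mult_right_mono) simp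
    then show ?thesis
      using \<psi>0[of x] by (simp add: \<psi>'_def abs_mult divide_le_eq mult.commute)
  qed
  have xS0: "0 \<le> x * S x" for x using r0[of x] by (simp add: S_def)
  \<comment> \<open>The smooth sign loses at most 1: from \<open>\<bar>x\<bar> \<le> r x\<close> and
    \<open>r x \<ge> 1\<close> one gets
    \<open>\<bar>x\<bar> * r x \<le> x^2 + 1 \<le> x^2 + r x\<close>; then divide by
    \<open>r x\<close>.\<close>
  have xS: "\<bar>x\<bar> \<le> x * S x + 1" for x
  proof -
    have "\<bar>x\<bar> * r x \<le> r x * r x" using rx r0[of x] by (intro mult_right_mono) auto
    then have "\<bar>x\<bar> * r x \<le> x\<^sup>2 + r x" using r2[of x] r1[of x] unfolding power2_eq_square by linarith
    then show ?thesis using r0[of x] by (simp add: S_def field_simps power2_eq_square)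
  qed
  have dr: "(r has_real_derivative x / r x) (at x)" for x
  proof -
    have "(r has_real_derivative (2 * x) * (inverse (r x) / 2)) (at x)"
      unfolding r_def using pos[of x] by (auto intro!: derivative_eq_intros)
    then show ?thesis by (simp add: field_simps)
  qed
  have dS: "(S has_real_derivative S' x) (at x)" for x
  proof -
    have "(S has_real_derivative (1 * r x - x * (x / r x)) / (r x * r x)) (at x)"
      unfolding S_def using r0[of x] by (intro DERIV_divide DERIV_ident dr) auto
    moreover have "(1 * r x - x * (x / r x)) / (r x * r x) = S' x"
      using r0[of x] r2[of x] by (simp add: S'_def field_simps power2_eq_square power3_eq_cube)
    ultimately show ?thesis by simp
  qed
  have d\<psi>: "(\<psi> has_real_derivative \<psi>' x) (at x)" for x
  proof -
    have "(\<psi> has_real_derivative (2 * \<phi> x * \<phi>' x) * (inverse (\<psi> x) / 2)) (at x)"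
      unfolding \<psi>_def using pos[of "\<phi> x"] \<phi> by (auto intro!: derivative_eq_intros)
    then show ?thesis by (simp add: \<psi>'_def field_simps)
  qed
  define K where "K x = ?p x * (x * S x * \<psi> x)" for x
  define L where "L x = ?p x * (S' x * \<psi> x + S x * \<psi>' x)" for x
  have FTC: "((\<lambda>x. ?p x * (S x * \<psi> x)) has_real_derivative L x - K x) (at x)" for x
    using DERIV_mult[OF has_real_derivative_std_normal_density DERIV_mult[OF dS d\<psi>], of x]
    by (simp add: L_def K_def algebra_simps)
  have cS: "isCont S x" and c\<psi>: "isCont \<psi> x" and cr: "isCont r x" and cp: "isCont ?p x" for x
    using dS d\<psi> dr has_real_derivative_std_normal_density DERIV_isCont by blast+
  have cK: "isCont K x" for x unfolding K_def using cS c\<psi> cp by (intro continuous_intros)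
  have cL: "isCont L x" for x
    unfolding L_def S'_def \<psi>'_def using cS c\<psi> cp cr \<phi>_cont \<phi>'_cont r0[of x] \<psi>0[of x]
    by (intro continuous_intros) auto
  have [measurable]: "K \<in> borel_measurable borel" "L \<in> borel_measurable borel"
    using cK cL by (auto intro!: borel_measurable_continuous_onI simp: continuous_on_eq_continuous_at)
  have K0: "0 \<le> K x" for x
    unfolding K_def using xS0[of x] \<psi>0[of x] by (intro mult_nonneg_nonneg[of _ "_ * \<psi> x"]) auto
  \<comment> \<open>A majorant of \<open>L\<close> that is linear in \<open>\<psi>\<close> and the
    modulus of \<open>\<phi>'\<close>, from the bounds by 1 on \<open>S\<close> and
    \<open>S'\<close> and from \<open>\<psi>'1\<close>.\<close>
  define U where "U x = ?p x * (\<psi> x + \<bar>\<phi>' x\<bar>)" for x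
  have [measurable]: "U \<in> borel_measurable borel" unfolding U_def \<psi>_def by measurable
  have LU: "L x \<le> U x" for x
  proof -
    have "S' x * \<psi> x \<le> 1 * \<psi> x" using S'1 \<psi>0[of x] by (intro mult_right_mono) auto
    moreover have "\<bar>S x * \<psi>' x\<bar> \<le> 1 * \<bar>\<phi>' x\<bar>"
      unfolding abs_mult using S1 \<psi>'1 by (intro mult_mono) auto
    ultimately show ?thesis unfolding L_def U_def by (intro mult_left_mono) auto
  qed
  have U0: "0 \<le> U x" for x unfolding U_def using \<psi>0[of x] by (intro mult_nonneg_nonneg) auto
  \<comment> \<open>Finiteness of the integral of \<open>K\<close> is the goal, so the argument
    stays on compact intervals, where \<open>K\<close> and \<open>L\<close> are continuous. The
    bound by the integral of \<open>U\<close> does not depend on \<open>n\<close>.\<close>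
  have "(\<integral>\<^sup>+x. ennreal (K x) \<partial>lborel) \<le> (\<integral>\<^sup>+x. ennreal (U x) \<partial>lborel)"
  proof (rule nn_integral_le_of_Icc)
    fix n :: nat
    let ?I = "\<lambda>x. indicator {- real n..real n} x :: real"
    have iK: "integrable lborel (\<lambda>x. K x * ?I x)" and iL: "integrable lborel (\<lambda>x. L x * ?I x)"
      using borel_integrable_atLeastAtMost'[of "- real n" "real n" K]
        borel_integrable_atLeastAtMost'[of "- real n" "real n" L] cK cL
      by (auto simp: continuous_at_imp_continuous_on set_integrable_def mult.commute)
    have "(\<integral>x. (L x - K x) * ?I x \<partial>lborel)
        = ?p n * (S n * \<psi> n) - ?p (- real n) * (S (- real n) * \<psi> (- real n))"
      using FTC cK cL by (intro integral_FTC_Icc_real) auto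
    also have "\<dots> \<ge> 0"
      using \<psi>0[of "real n"] \<psi>0[of "- real n"] r0[of "real n"] r0[of "- real n"]
      by (simp add: S_def)
    finally have "(\<integral>x. K x * ?I x \<partial>lborel) \<le> (\<integral>x. L x * ?I x \<partial>lborel)"
      using iK iL by (simp add: left_diff_distrib)
    also have "ennreal \<dots> \<le> (\<integral>\<^sup>+x. ennreal (L x * ?I x) \<partial>lborel)"
    proof -
      have "(\<integral>x. L x * ?I x \<partial>lborel) \<le> (\<integral>x. max 0 (L x * ?I x) \<partial>lborel)"
        using iL by (intro integral_mono) auto
      also have "ennreal \<dots> = (\<integral>\<^sup>+x. ennreal (max 0 (L x * ?I x)) \<partial>lborel)"
        using iL by (subst nn_integral_eq_integral) auto
      finally show ?thesis by (simp add: ennreal_leI max.commute)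
    qed
    also have "\<dots> \<le> (\<integral>\<^sup>+x. ennreal (U x) \<partial>lborel)"
      using LU U0 by (intro nn_integral_mono ennreal_leI) (auto simp: indicator_def)
    also have "ennreal (\<integral>x. K x * ?I x \<partial>lborel) = (\<integral>\<^sup>+x. ennreal (K x * ?I x) \<partial>lborel)"
      using iK K0 by (subst nn_integral_eq_integral) auto
    also have "\<dots> = (\<integral>\<^sup>+x. ennreal (K x) * indicator {- real n..real n} x \<partial>lborel)"
      by (intro nn_integral_cong) (auto simp: indicator_def)
    finally show "(\<integral>\<^sup>+x. ennreal (K x) * indicator {- real n..real n} x \<partial>lborel)
        \<le> (\<integral>\<^sup>+x. ennreal (U x) \<partial>lborel)" by (simp add: ennreal_leI)
  qed simp
  note KU = this
  have "(\<integral>\<^sup>+x. ennreal \<bar>x * \<phi> x\<bar> \<partial>std_normal_distribution)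
      = (\<integral>\<^sup>+x. ennreal (?p x * \<bar>x * \<phi> x\<bar>) \<partial>lborel)"
    by (subst nn_integral_density) (auto simp: ennreal_mult)
  \<comment> \<open>The second summand pays for the \<open>+ 1\<close> in \<open>xS\<close>.
    Together with the \<open>\<psi>\<close> inside \<open>U\<close> this makes two copies of
    \<open>\<psi>\<close>, and \<open>\<psi>1\<close> turns them into
    \<open>2 + 2 * \<bar>\<phi> x\<bar>\<close>.\<close>
  also have "\<dots> \<le> (\<integral>\<^sup>+x. ennreal (K x) + ennreal (?p x * \<psi> x) \<partial>lborel)"
  proof (intro nn_integral_mono)
    fix x
    have "\<bar>x * \<phi> x\<bar> \<le> (x * S x + 1) * \<psi> x"
      unfolding abs_mult using xS \<psi>\<phi> xS0[of x] by (intro mult_mono) auto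
    then have "?p x * \<bar>x * \<phi> x\<bar> \<le> ?p x * ((x * S x + 1) * \<psi> x)" by (rule mult_left_mono) simp
    also have "\<dots> = K x + ?p x * \<psi> x" by (simp add: K_def algebra_simps)
    finally show "ennreal (?p x * \<bar>x * \<phi> x\<bar>) \<le> ennreal (K x) + ennreal (?p x * \<psi> x)"
      using K0 \<psi>0[of x] by (simp add: ennreal_plus[symmetric] ennreal_leI del: ennreal_plus)
  qed
  also have "\<dots> = (\<integral>\<^sup>+x. ennreal (K x) \<partial>lborel) + (\<integral>\<^sup>+x. ennreal (?p x * \<psi> x) \<partial>lborel)"
    by (rule nn_integral_add) (auto simp: \<psi>_def)
  also have "\<dots> \<le> (\<integral>\<^sup>+x. ennreal (U x) \<partial>lborel) + (\<integral>\<^sup>+x. ennreal (?p x * \<psi> x) \<partial>lborel)"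
    using KU by (rule add_right_mono)
  also have "\<dots> = (\<integral>\<^sup>+x. ennreal (U x) + ennreal (?p x * \<psi> x) \<partial>lborel)"
    by (rule nn_integral_add[symmetric]) (auto simp: \<psi>_def)
  also have "\<dots> \<le> (\<integral>\<^sup>+x. ennreal (?p x * (2 + 2 * \<bar>\<phi> x\<bar> + \<bar>\<phi>' x\<bar>)) \<partial>lborel)"
  proof (intro nn_integral_mono)
    fix x
    have "U x + ?p x * \<psi> x = ?p x * (2 * \<psi> x + \<bar>\<phi>' x\<bar>)" by (simp add: U_def algebra_simps)
    also have "\<dots> \<le> ?p x * (2 + 2 * \<bar>\<phi> x\<bar> + \<bar>\<phi>' x\<bar>)"
      using \<psi>1[of x] by (intro mult_left_mono) auto
    finally show "ennreal (U x) + ennreal (?p x * \<psi> x) \<le> ennreal (?p x * (2 + 2 * \<bar>\<phi> x\<bar> + \<bar>\<phi>' x\<bar>))"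
      using U0[of x] \<psi>0[of x] by (simp add: ennreal_plus[symmetric] ennreal_leI del: ennreal_plus)
  qed
  also have "\<dots> = (\<integral>\<^sup>+x. ennreal (2 + 2 * \<bar>\<phi> x\<bar> + \<bar>\<phi>' x\<bar>) \<partial>std_normal_distribution)"
    by (subst nn_integral_density) (auto simp: ennreal_mult)
  finally show ?thesis .
qed

lemma integrable_std_normal_distribution_iff:
  fixes f :: "real \<Rightarrow> real"
  assumes "f \<in> borel_measurable borel"
  shows "integrable std_normal_distribution f \<longleftrightarrow> integrable lborel (\<lambda>x. std_normal_density x * f x)"
  using assms by (subst integrable_density) auto

text \<open>\<open>integral_derivative_eq_0\<close> for the density times \<open>\<phi>\<close>:
  differentiating the density produces the factor \<open>- x\<close>.\<close>

lemma std_normal_integration_by_parts: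
  fixes \<phi> :: "real \<Rightarrow> real"
  assumes \<phi>: "\<And>x. (\<phi> has_real_derivative \<phi>' x) (at x)" and cont: "continuous_on UNIV \<phi>'"
    and int: "integrable std_normal_distribution \<phi>" "integrable std_normal_distribution \<phi>'"
      "integrable std_normal_distribution (\<lambda>x. x * \<phi> x)"
  shows "(\<integral>x. x * \<phi> x \<partial>std_normal_distribution) = (\<integral>x. \<phi>' x \<partial>std_normal_distribution)"
proof -
  have \<phi>_borel [measurable]: "\<phi> \<in> borel_measurable borel"
    using \<phi> by (rule has_real_derivative_imp_borel)
  have \<phi>'_borel [measurable]: "\<phi>' \<in> borel_measurable borel"
    using cont by (rule borel_measurable_continuous_onI)
  let ?p = std_normal_density
  have i: "integrable lborel (\<lambda>x. ?p x * \<phi> x)" "integrable lborel (\<lambda>x. ?p x * \<phi>' x)"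
    "integrable lborel (\<lambda>x. ?p x * (x * \<phi> x))"
    using int by (auto simp: integrable_std_normal_distribution_iff)
  have "(\<integral>x. ?p x * \<phi>' x - ?p x * (x * \<phi> x) \<partial>lborel) = 0"
  proof (rule integral_derivative_eq_0)
    show "((\<lambda>x. ?p x * \<phi> x) has_real_derivative ?p x * \<phi>' x - ?p x * (x * \<phi> x)) (at x)" for x
      using DERIV_mult[OF has_real_derivative_std_normal_density \<phi>, of x] by (simp add: algebra_simps)
    have "continuous_on UNIV \<phi>" "continuous_on UNIV ?p"
      using DERIV_isCont[OF \<phi>] DERIV_isCont[OF has_real_derivative_std_normal_density]
      by (simp_all add: continuous_on_eq_continuous_at)
    then show "continuous_on UNIV (\<lambda>x. ?p x * \<phi>' x - ?p x * (x * \<phi> x))"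
      using cont by (intro continuous_intros)
  qed (use i in auto)
  then have "(\<integral>x. ?p x * (x * \<phi> x) \<partial>lborel) = (\<integral>x. ?p x * \<phi>' x \<partial>lborel)"
    using i by simp
  then show ?thesis by (simp add: integral_density)
qed

section \<open>Gaussian integration by parts\<close>

text \<open>Gaussian measures in diagonal form: the variance \<open>q\<close> splits orthogonally along each of the
  unit vectors \<open>v \<in> B\<close>, the component in direction \<open>v\<close> having standard deviation \<open>s v\<close>.\<close>

locale diagonal_gaussian = prob_space m
  for m :: "'a::real_inner measure" +
  fixes q :: "'a \<Rightarrow> real" and B :: "'a set" and s :: "'a \<Rightarrow> real" and Q :: "'a set"
  assumes sets_m [measurable_cong, simp]: "sets m = sets borel"
    and charfun: "(\<integral>z. cis (inner x z) \<partial>m) = complex_of_real (exp (- q x / 2))"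
    and countable_Q: "countable Q" and dense_Q: "closure Q = UNIV"
    and variance_scale: "q (c *\<^sub>R x) = c\<^sup>2 * q x"
    and norm_B: "v \<in> B \<Longrightarrow> norm v = 1" and s_pos: "v \<in> B \<Longrightarrow> 0 < s v"
    and variance_split: "v \<in> B \<Longrightarrow> q x = q (x - inner x v *\<^sub>R v) + (s v)\<^sup>2 * (inner x v)\<^sup>2"
begin

text \<open>Resampling along \<open>v\<close>: the coordinate of \<open>z\<close> in direction
  \<open>v\<close> is discarded and replaced by \<open>s v\<close> times an independent standard
  normal variable.\<close>

definition fibre :: "'a \<Rightarrow> 'a \<times> real \<Rightarrow> 'a" where
  "fibre v = (\<lambda>(z, t). (z - inner v z *\<^sub>R v) + (s v * t) *\<^sub>R v)"

lemma fibre_measurable [measurable]: "fibre v \<in> m \<Otimes>\<^sub>M std_normal_distribution \<rightarrow>\<^sub>M borel"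
proof (rule borel_measurable_innerI[OF countable_Q dense_Q])
  show "(\<lambda>x. inner h (fibre v x)) \<in> borel_measurable (m \<Otimes>\<^sub>M std_normal_distribution)" for h
    unfolding fibre_def by (simp add: case_prod_beta inner_add_right inner_diff_right)
qed

lemma inner_fibre: "v \<in> B \<Longrightarrow> inner v (fibre v (z, t)) = s v * t"
  using norm_B[of v] by (simp add: fibre_def inner_add_right inner_diff_right norm_eq_1)

sublocale normal: prob_space std_normal_distribution
  by (rule prob_space_normal_density) simp

sublocale pair_normal: pair_prob_space m std_normal_distribution ..

text \<open>The character at \<open>x\<close> factorises into one of \<open>z\<close> at the
  component of \<open>x\<close> orthogonal to \<open>v\<close> and one of \<open>t\<close> at
  \<open>inner x v * s v\<close>. The two exponents add up to that of \<open>q x\<close> by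
  \<open>variance_split\<close>.\<close>

lemma distr_fibre:
  assumes v: "v \<in> B"
  shows "distr (m \<Otimes>\<^sub>M std_normal_distribution) borel (fibre v) = m"
proof (rule measure_eqI_charfun[OF countable_Q dense_Q])
  fix x
  let ?y = "x - inner x v *\<^sub>R v" and ?c = "inner x v * s v"
  have split: "inner x (fibre v (z, t)) = inner ?y z + ?c * t" for z t
    by (simp add: fibre_def inner_add_right inner_diff_right inner_diff_left inner_commute mult_ac)
  have "(\<integral>z. cis (inner x z) \<partial>distr (m \<Otimes>\<^sub>M std_normal_distribution) borel (fibre v))
      = (\<integral>p. cis (inner x (fibre v p)) \<partial>(m \<Otimes>\<^sub>M std_normal_distribution))"
    by (rule integral_distr) simp_all
  also have "\<dots> = (\<integral>z. (\<integral>t. cis (inner x (fibre v (z, t))) \<partial>std_normal_distribution) \<partial>m)"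
    by (rule pair_normal.integral_fst'[symmetric])
      (intro pair_normal.integrable_const_bound[of _ 1]; simp)
  also have "\<dots> = (\<integral>z. cis (inner ?y z) * (\<integral>t. cis (?c * t) \<partial>std_normal_distribution) \<partial>m)"
    unfolding split cis_mult[symmetric] by simp
  also have "\<dots> = complex_of_real (exp (- q ?y / 2)) * complex_of_real (exp (- ?c\<^sup>2 / 2))"
    using charfun[of ?y] char_std_normal_distribution
    by (simp add: char_eq_cis[symmetric])
  also have "\<dots> = complex_of_real (exp (- q x / 2))"
    unfolding variance_split[OF v, of x] of_real_mult[symmetric] exp_add[symmetric]
    by (simp add: power_mult_distrib mult_ac add_divide_distrib)
  finally show "(\<integral>z. cis (inner x z) \<partial>distr (m \<Otimes>\<^sub>M std_normal_distribution) borel (fibre v))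
      = (\<integral>z. cis (inner x z) \<partial>m)" by (simp add: charfun)
qed (auto intro!: pair_normal.prob_space_distr prob_space_axioms)

section \<open>Integration by parts along the fibres in one direction\<close>

context
  fixes v :: 'a and g g' :: "'a \<Rightarrow> real"
  assumes v: "v \<in> B"
    and g_borel [measurable]: "g \<in> borel_measurable borel"
    and g'_borel [measurable]: "g' \<in> borel_measurable borel"
    and deriv: "\<And>z t. ((\<lambda>t. g (z + t *\<^sub>R v)) has_real_derivative g' (z + t *\<^sub>R v)) (at t)"
    and cont: "\<And>z. continuous_on UNIV (\<lambda>t. g' (z + t *\<^sub>R v))"
    and int_g: "integrable m g" and int_g': "integrable m g'"
begin

lemma fibre_deriv:
  "((\<lambda>t. g (fibre v (z, t))) has_real_derivative s v * g' (fibre v (z, t))) (at t)"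
proof -
  have "((\<lambda>t. g (z - inner v z *\<^sub>R v + (s v * t) *\<^sub>R v)) has_real_derivative
      g' (z - inner v z *\<^sub>R v + (s v * t) *\<^sub>R v) * s v) (at t)"
    by (rule DERIV_chain2[OF deriv]) (auto intro!: derivative_eq_intros)
  then show ?thesis by (simp add: fibre_def mult.commute)
qed

lemma fibre_cont: "continuous_on UNIV (\<lambda>t. s v * g' (fibre v (z, t)))"
proof -
  have "continuous_on UNIV (\<lambda>t. g' (z - inner v z *\<^sub>R v + (s v * t) *\<^sub>R v))"
    by (rule continuous_on_compose2[OF cont]) (auto intro!: continuous_intros)
  then show ?thesis by (auto simp: fibre_def intro!: continuous_intros)
qed

lemma nn_integral_fibre:
  assumes [measurable]: "F \<in> borel_measurable borel"
  shows "(\<integral>\<^sup>+z. F z \<partial>m) = (\<integral>\<^sup>+z. (\<integral>\<^sup>+t. F (fibre v (z, t)) \<partial>std_normal_distribution) \<partial>m)"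
proof -
  have "(\<integral>\<^sup>+z. F z \<partial>m) = (\<integral>\<^sup>+z. F z \<partial>distr (m \<Otimes>\<^sub>M std_normal_distribution) borel (fibre v))"
    by (simp only: distr_fibre[OF v])
  also have "\<dots> = (\<integral>\<^sup>+p. F (fibre v p) \<partial>(m \<Otimes>\<^sub>M std_normal_distribution))"
    by (rule nn_integral_distr) simp_all
  also have "\<dots> = (\<integral>\<^sup>+z. (\<integral>\<^sup>+t. F (fibre v (z, t)) \<partial>std_normal_distribution) \<partial>m)"
    by (rule normal.nn_integral_fst[symmetric]) simp
  finally show ?thesis .
qed

text \<open>On a fibre the factor \<open>inner v\<close> is \<open>s v * t\<close>, so
  \<open>std_normal_weighted_bound\<close> applies to \<open>t\<close>; its right-hand side,
  integrated over all fibres, is again an integral against \<open>m\<close> because resampling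
  preserves \<open>m\<close>.\<close>

lemma integrable_inner_mult: "integrable m (\<lambda>z. inner v z * g z)"
proof (rule integrableI_bounded)
  have "(\<integral>\<^sup>+z. ennreal (norm (inner v z * g z)) \<partial>m)
      = (\<integral>\<^sup>+z. (\<integral>\<^sup>+t. ennreal (s v) * ennreal \<bar>t * g (fibre v (z, t))\<bar> \<partial>std_normal_distribution) \<partial>m)"
    using s_pos[OF v]
    by (subst nn_integral_fibre) (auto simp: inner_fibre[OF v] abs_mult ennreal_mult[symmetric] mult_ac)
  also have "\<dots> = (\<integral>\<^sup>+z. ennreal (s v) * (\<integral>\<^sup>+t. ennreal \<bar>t * g (fibre v (z, t))\<bar> \<partial>std_normal_distribution) \<partial>m)"
    by (intro nn_integral_cong nn_integral_cmult) simp
  also have "\<dots> \<le> (\<integral>\<^sup>+z. ennreal (s v) * (\<integral>\<^sup>+t. ennreal (2 + 2 * \<bar>g (fibre v (z, t))\<bar>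
      + \<bar>s v * g' (fibre v (z, t))\<bar>) \<partial>std_normal_distribution) \<partial>m)"
    by (intro nn_integral_mono mult_left_mono std_normal_weighted_bound fibre_deriv fibre_cont) simp
  also have "\<dots> = ennreal (s v) * (\<integral>\<^sup>+z. (\<integral>\<^sup>+t. ennreal (2 + 2 * \<bar>g (fibre v (z, t))\<bar>
      + \<bar>s v * g' (fibre v (z, t))\<bar>) \<partial>std_normal_distribution) \<partial>m)"
    by (rule nn_integral_cmult) simp
  also have "\<dots> = ennreal (s v) * (\<integral>\<^sup>+z. ennreal (2 + 2 * \<bar>g z\<bar> + \<bar>s v * g' z\<bar>) \<partial>m)"
    by (subst nn_integral_fibre[of "\<lambda>z. ennreal (2 + 2 * \<bar>g z\<bar> + \<bar>s v * g' z\<bar>)"]) simp_all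
  also have "(\<integral>\<^sup>+z. ennreal (2 + 2 * \<bar>g z\<bar> + \<bar>s v * g' z\<bar>) \<partial>m)
      = ennreal (\<integral>z. 2 + 2 * \<bar>g z\<bar> + \<bar>s v * g' z\<bar> \<partial>m)"
    using int_g int_g' by (intro nn_integral_eq_integral) auto
  finally show "(\<integral>\<^sup>+z. ennreal (norm (inner v z * g z)) \<partial>m) < \<infinity>"
    by (simp add: ennreal_mult[symmetric] ennreal_mult_less_top order_le_less_trans)
qed simp

lemma integral_fibre:
  fixes F :: "'a \<Rightarrow> real"
  assumes F: "integrable m F" and [measurable]: "F \<in> borel_measurable borel"
  shows "(\<integral>z. F z \<partial>m) = (\<integral>z. (\<integral>t. F (fibre v (z, t)) \<partial>std_normal_distribution) \<partial>m)" (is ?A)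
    and "AE z in m. integrable std_normal_distribution (\<lambda>t. F (fibre v (z, t)))" (is ?B)
proof -
  have "integrable (distr (m \<Otimes>\<^sub>M std_normal_distribution) borel (fibre v)) F"
    using F by (simp only: distr_fibre[OF v])
  then have i: "integrable (m \<Otimes>\<^sub>M std_normal_distribution) (\<lambda>p. F (fibre v p))"
    by (rule integrable_distr[OF fibre_measurable])
  have "(\<integral>z. F z \<partial>m) = (\<integral>z. F z \<partial>distr (m \<Otimes>\<^sub>M std_normal_distribution) borel (fibre v))"
    by (simp only: distr_fibre[OF v])
  also have "\<dots> = (\<integral>p. F (fibre v p) \<partial>(m \<Otimes>\<^sub>M std_normal_distribution))"
    by (rule integral_distr) simp_all
  also have "\<dots> = (\<integral>z. (\<integral>t. F (fibre v (z, t)) \<partial>std_normal_distribution) \<partial>m)"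
    by (rule pair_normal.integral_fst'[OF i, symmetric])
  finally show ?A .
  show ?B using pair_normal.AE_integrable_fst'[OF i] .
qed

text \<open>One factor \<open>s v\<close> comes from \<open>inner_fibre\<close>, the other from the
  chain rule in \<open>fibre_deriv\<close>.\<close>

lemma gaussian_integration_by_parts:
  "(\<integral>z. inner v z * g z \<partial>m) = (s v)\<^sup>2 * (\<integral>z. g' z \<partial>m)"
proof -
  have AE1: "AE z in m. integrable std_normal_distribution (\<lambda>t. s v * t * g (fibre v (z, t)))"
    using integral_fibre(2)[OF integrable_inner_mult] by (simp add: inner_fibre[OF v])
  have "(\<integral>z. inner v z * g z \<partial>m)
      = (\<integral>z. (\<integral>t. s v * t * g (fibre v (z, t)) \<partial>std_normal_distribution) \<partial>m)"
    using integral_fibre(1)[OF integrable_inner_mult] by (simp add: inner_fibre[OF v])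
  also have "\<dots> = (\<integral>z. (\<integral>t. (s v)\<^sup>2 * g' (fibre v (z, t)) \<partial>std_normal_distribution) \<partial>m)"
  proof (rule integral_cong_AE)
    show "AE z in m. (\<integral>t. s v * t * g (fibre v (z, t)) \<partial>std_normal_distribution)
        = (\<integral>t. (s v)\<^sup>2 * g' (fibre v (z, t)) \<partial>std_normal_distribution)"
      using integral_fibre(2)[OF int_g g_borel] integral_fibre(2)[OF int_g' g'_borel] AE1
    proof eventually_elim
      fix z
      assume i: "integrable std_normal_distribution (\<lambda>t. g (fibre v (z, t)))"
        "integrable std_normal_distribution (\<lambda>t. g' (fibre v (z, t)))"
        "integrable std_normal_distribution (\<lambda>t. s v * t * g (fibre v (z, t)))"
      from i(3) have "integrable std_normal_distribution (\<lambda>t. s v * (t * g (fibre v (z, t))))"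
        by (simp add: mult.assoc)
      then have i': "integrable std_normal_distribution (\<lambda>t. t * g (fibre v (z, t)))"
        using s_pos[OF v] by simp
      have "(\<integral>t. t * g (fibre v (z, t)) \<partial>std_normal_distribution)
          = (\<integral>t. s v * g' (fibre v (z, t)) \<partial>std_normal_distribution)"
        using i i' by (intro std_normal_integration_by_parts fibre_deriv fibre_cont) auto
      then show "(\<integral>t. s v * t * g (fibre v (z, t)) \<partial>std_normal_distribution)
        = (\<integral>t. (s v)\<^sup>2 * g' (fibre v (z, t)) \<partial>std_normal_distribution)"
        by (simp add: mult.assoc power2_eq_square)
    qed
  qed simp_all
  also have "\<dots> = (s v)\<^sup>2 * (\<integral>z. (\<integral>t. g' (fibre v (z, t)) \<partial>std_normal_distribution) \<partial>m)"
    by simp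
  also have "\<dots> = (s v)\<^sup>2 * (\<integral>z. g' z \<partial>m)"
    by (simp only: integral_fibre(1)[OF int_g' g'_borel])
  finally show ?thesis .
qed

end

end

section \<open>Polynomials and Wick powers\<close>

text \<open>The index is an upper bound for the degree, hence \<open>const\<close> at every
  \<open>d\<close>. It drives the induction for integrability and is compared with the number of
  derivatives for orthogonality.\<close>

inductive polynomial_le :: "'a::real_inner set \<Rightarrow> nat \<Rightarrow> ('a \<Rightarrow> real) \<Rightarrow> bool" for B where
  const: "polynomial_le B d (\<lambda>_. c)"
| add: "polynomial_le B d p \<Longrightarrow> polynomial_le B d p' \<Longrightarrow> polynomial_le B d (\<lambda>z. p z + p' z)"
| inner: "h \<in> B \<Longrightarrow> polynomial_le B d p \<Longrightarrow> polynomial_le B (Suc d) (\<lambda>z. inner h z * p z)"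

lemma polynomial_le_Suc: "polynomial_le B d p \<Longrightarrow> polynomial_le B (Suc d) p"
  by (induction rule: polynomial_le.induct) (auto intro: polynomial_le.intros)

lemma polynomial_le_mono: "polynomial_le B d p \<Longrightarrow> d \<le> d' \<Longrightarrow> polynomial_le B d' p"
  by (rule dec_induct) (auto intro: polynomial_le_Suc)

lemma polynomial_le_cmult: "polynomial_le B d p \<Longrightarrow> polynomial_le B d (\<lambda>z. c * p z)"
proof (induction rule: polynomial_le.induct)
  case (inner h d p)
  then show ?case using polynomial_le.inner[OF inner(1) inner.IH] by (simp add: mult.left_commute)
qed (auto simp: distrib_left intro: polynomial_le.intros)

lemma polynomial_le_diff:
  "polynomial_le B d p \<Longrightarrow> polynomial_le B d p' \<Longrightarrow> polynomial_le B d (\<lambda>z. p z - p' z)"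
  using polynomial_le.add[of B d p "\<lambda>z. (- 1) * p' z"] polynomial_le_cmult[of B d p' "- 1"] by simp

lemma polynomial_le_mult:
  "polynomial_le B d p \<Longrightarrow> polynomial_le B d' p' \<Longrightarrow> polynomial_le B (d + d') (\<lambda>z. p z * p' z)"
proof (induction rule: polynomial_le.induct)
  case (const d c)
  then show ?case using polynomial_le_mono[OF polynomial_le_cmult[OF const]] by simp
next
  case (inner h d p)
  then show ?case using polynomial_le.inner[OF inner(1) inner.IH] by (simp add: mult.assoc)
qed (auto simp: distrib_right intro: polynomial_le.intros)

lemma polynomial_le_borel:
  "polynomial_le B d p \<Longrightarrow> p \<in> borel_measurable (borel :: 'a::real_inner measure)"
  by (induction rule: polynomial_le.induct) auto

definition dir_deriv :: "'a::real_vector \<Rightarrow> ('a \<Rightarrow> real) \<Rightarrow> 'a \<Rightarrow> real" where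
  "dir_deriv v p z = deriv (\<lambda>t. p (z + t *\<^sub>R v)) 0"

lemma dir_deriv_eq:
  assumes "\<And>z t. ((\<lambda>t. p (z + t *\<^sub>R v)) has_real_derivative p' (z + t *\<^sub>R v)) (at t)"
  shows "dir_deriv v p = p'"
  using DERIV_imp_deriv[OF assms[of _ 0]] by (auto simp: dir_deriv_def)

text \<open>Since \<open>d - 1\<close> is truncated at 0, the clause for \<open>d = 0\<close>
  records separately that constants have derivative zero. Without it, differentiating more often
  than the degree would not be seen to give 0.\<close>

lemma polynomial_le_dir_deriv_ex:
  assumes "polynomial_le B d p"
  shows "\<exists>p'. polynomial_le B (d - 1) p' \<and> (d = 0 \<longrightarrow> p' = (\<lambda>_. 0)) \<and>
    (\<forall>z t. ((\<lambda>t. p (z + t *\<^sub>R v)) has_real_derivative p' (z + t *\<^sub>R v)) (at t))"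
  using assms
proof (induction rule: polynomial_le.induct)
  case (const d c)
  show ?case by (intro exI[of _ "\<lambda>_. 0"]) (auto intro: polynomial_le.const)
next
  case (add d p r)
  obtain p' where p': "polynomial_le B (d - 1) p'" "d = 0 \<longrightarrow> p' = (\<lambda>_. 0)"
    "\<And>z t. ((\<lambda>t. p (z + t *\<^sub>R v)) has_real_derivative p' (z + t *\<^sub>R v)) (at t)"
    using add.IH(1) by blast
  obtain r' where r': "polynomial_le B (d - 1) r'" "d = 0 \<longrightarrow> r' = (\<lambda>_. 0)"
    "\<And>z t. ((\<lambda>t. r (z + t *\<^sub>R v)) has_real_derivative r' (z + t *\<^sub>R v)) (at t)"
    using add.IH(2) by blast
  from p' r' show ?case
    by (intro exI[of _ "\<lambda>z. p' z + r' z"]) (auto intro!: polynomial_le.add derivative_eq_intros)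
next
  case (inner h d p)
  then obtain p' where p': "polynomial_le B (d - 1) p'" "d = 0 \<longrightarrow> p' = (\<lambda>_. 0)"
    and d: "\<And>z t. ((\<lambda>t. p (z + t *\<^sub>R v)) has_real_derivative p' (z + t *\<^sub>R v)) (at t)"
    by blast
  \<comment> \<open>For \<open>d = 0\<close> the degree bound on \<open>p'\<close> would only yield
    degree 1 for this product; here \<open>p' = 0\<close> is used.\<close>
  have "polynomial_le B d (\<lambda>z. inner h z * p' z)"
  proof (cases d)
    case 0
    then show ?thesis using p' polynomial_le.const[of B 0 0] by simp
  next
    case (Suc d')
    then show ?thesis using polynomial_le.inner[OF inner(1) p'(1)] by simp
  qed
  then have "polynomial_le B d (\<lambda>z. inner h v * p z + inner h z * p' z)"
    by (intro polynomial_le.add polynomial_le_cmult inner)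
  moreover have "((\<lambda>t. inner h (z + t *\<^sub>R v) * p (z + t *\<^sub>R v)) has_real_derivative
      inner h v * p (z + t *\<^sub>R v) + inner h (z + t *\<^sub>R v) * p' (z + t *\<^sub>R v)) (at t)" for z t
    by (rule derivative_eq_intros d refl | simp add: inner_add_right)+
  ultimately show ?case by (intro exI[of _ "\<lambda>z. inner h v * p z + inner h z * p' z"]) auto
qed

lemma
  assumes "polynomial_le B d p"
  shows polynomial_le_dir_deriv: "polynomial_le B (d - 1) (dir_deriv v p)"
    and dir_deriv_const: "d = 0 \<Longrightarrow> dir_deriv v p = (\<lambda>_. 0)"
    and has_dir_deriv:
      "((\<lambda>t. p (z + t *\<^sub>R v)) has_real_derivative dir_deriv v p (z + t *\<^sub>R v)) (at t)"
proof -
  obtain p' where p': "polynomial_le B (d - 1) p'" "d = 0 \<longrightarrow> p' = (\<lambda>_. 0)"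
    and d: "\<And>z t. ((\<lambda>t. p (z + t *\<^sub>R v)) has_real_derivative p' (z + t *\<^sub>R v)) (at t)"
    using polynomial_le_dir_deriv_ex[OF assms, of v] by blast
  note eq = dir_deriv_eq[of p v p', OF d]
  show "polynomial_le B (d - 1) (dir_deriv v p)" "d = 0 \<Longrightarrow> dir_deriv v p = (\<lambda>_. 0)"
    "((\<lambda>t. p (z + t *\<^sub>R v)) has_real_derivative dir_deriv v p (z + t *\<^sub>R v)) (at t)"
    using p' d by (simp_all add: eq)
qed

section \<open>Families of derivatives: integrability and duality\<close>

context diagonal_gaussian
begin

text \<open>A common interface, with the newest direction at the head of the list. The derivatives
  of \<open>f\<close> and those of a polynomial are both instances, so one duality formula yields
  both the value of \<open>alpha\<close> and orthogonality to lower degrees.\<close>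

definition deriv_family :: "('a list \<Rightarrow> 'a \<Rightarrow> real) \<Rightarrow> bool" where
  "deriv_family F \<longleftrightarrow> (\<forall>hs\<in>lists B. F hs \<in> borel_measurable borel \<and> integrable m (F hs) \<and>
     (\<forall>v\<in>B. \<forall>z t. ((\<lambda>t. F hs (z + t *\<^sub>R v)) has_real_derivative F (v # hs) (z + t *\<^sub>R v)) (at t)))"

lemma deriv_familyD:
  assumes "deriv_family F" "hs \<in> lists B"
  shows "F hs \<in> borel_measurable borel" "integrable m (F hs)"
    "v \<in> B \<Longrightarrow> ((\<lambda>t. F hs (z + t *\<^sub>R v)) has_real_derivative F (v # hs) (z + t *\<^sub>R v)) (at t)"
  using assms unfolding deriv_family_def by auto

lemma family_mult_polynomial:
  assumes F: "deriv_family F" and hs: "hs \<in> lists B" and v: "v \<in> B" and p: "polynomial_le B d p"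
    and int: "integrable m (\<lambda>z. F hs z * p z)" "integrable m (\<lambda>z. F (v # hs) z * p z)"
      "integrable m (\<lambda>z. F hs z * dir_deriv v p z)"
  shows "integrable m (\<lambda>z. inner v z * (F hs z * p z))" (is ?I)
    and "(\<integral>z. inner v z * (F hs z * p z) \<partial>m)
      = (s v)\<^sup>2 * ((\<integral>z. F (v # hs) z * p z \<partial>m) + (\<integral>z. F hs z * dir_deriv v p z \<partial>m))" (is ?E)
proof -
  let ?g = "\<lambda>z. F hs z * p z" and ?g' = "\<lambda>z. F (v # hs) z * p z + F hs z * dir_deriv v p z"
  have vhs: "v # hs \<in> lists B" using hs v by simp
  note p' = polynomial_le_dir_deriv[OF p, of v]
  have [measurable]: "F hs \<in> borel_measurable borel" "F (v # hs) \<in> borel_measurable borel"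
    "p \<in> borel_measurable borel" "dir_deriv v p \<in> borel_measurable borel"
    using deriv_familyD(1)[OF F] hs vhs polynomial_le_borel p p' by blast+
  have d: "((\<lambda>t. ?g (z + t *\<^sub>R v)) has_real_derivative ?g' (z + t *\<^sub>R v)) (at t)" for z t
    using DERIV_mult[OF deriv_familyD(3)[OF F hs v, where z = z and t = t]
        has_dir_deriv[OF p, where z = z and t = t and v = v]]
    by (simp add: add.commute mult.commute)
  \<comment> \<open>Each factor of \<open>?g'\<close> is continuous along the line because it is
    differentiable there, for \<open>F (v # hs)\<close> by the next member of the family.\<close>
  have c: "continuous_on UNIV (\<lambda>t. ?g' (z + t *\<^sub>R v))" for z
  proof -
    have "isCont (\<lambda>t. F hs (z + t *\<^sub>R v)) t" "isCont (\<lambda>t. F (v # hs) (z + t *\<^sub>R v)) t"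
      "isCont (\<lambda>t. p (z + t *\<^sub>R v)) t" "isCont (\<lambda>t. dir_deriv v p (z + t *\<^sub>R v)) t" for t
      using deriv_familyD(3)[OF F hs v] deriv_familyD(3)[OF F vhs v] has_dir_deriv[OF p]
        has_dir_deriv[OF p'] DERIV_isCont by blast+
    then show ?thesis
      by (auto simp: continuous_on_eq_continuous_at intro!: continuous_intros)
  qed
  have i: "integrable m ?g'" using int by auto
  show ?I by (rule integrable_inner_mult[OF v _ _ d c int(1) i]) simp_all
  have "(\<integral>z. inner v z * ?g z \<partial>m) = (s v)\<^sup>2 * (\<integral>z. ?g' z \<partial>m)"
    by (rule gaussian_integration_by_parts[OF v _ _ d c int(1) i]) simp_all
  then show ?E using int by simp
qed

text \<open>No integrability beyond that of the family itself is assumed: raising the degree of \<open>p\<close>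
  by one is paid for by one more derivative.\<close>

lemma integrable_family_polynomial:
  assumes F: "deriv_family F"
  shows "polynomial_le B d p \<Longrightarrow> hs \<in> lists B \<Longrightarrow> integrable m (\<lambda>z. F hs z * p z)"
proof (induction d arbitrary: p hs rule: less_induct)
  case (less d)
  \<comment> \<open>Structural induction inside strong induction on the degree. Sums keep the degree
    and use the structure; in the product case both \<open>p\<close> and
    \<open>dir_deriv h p\<close> have smaller degree bounds (or the latter is 0), and the outer
    hypothesis serves all lists, in particular \<open>h # hs\<close>.\<close>
  from less.prems(1) less.IH less.prems(2) show ?case
  proof (induction arbitrary: hs rule: polynomial_le.induct)
    case (const d c)
    then show ?case using deriv_familyD(2)[OF F] by simp
  next
    case (add d p p')
    from add.IH(1)[OF add.prems(1,2)] add.IH(2)[OF add.prems(1,2)] show ?case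
      by (simp add: distrib_left)
  next
    case (inner h d p)
    have IH: "integrable m (\<lambda>z. F hs z * p z)" if "hs \<in> lists B" for hs
      using inner.prems(1)[of d] inner.hyps(2) that by simp
    have "integrable m (\<lambda>z. F hs z * dir_deriv h p z)"
    proof (cases "d = 0")
      case True
      then show ?thesis using dir_deriv_const[OF inner.hyps(2)] by simp
    next
      case False
      then show ?thesis
        using inner.prems(1)[of "d - 1", OF _ polynomial_le_dir_deriv[OF inner.hyps(2)] inner.prems(2)]
        by simp
    qed
    then have "integrable m (\<lambda>z. inner h z * (F hs z * p z))"
      using inner.prems(2) inner.hyps(1)
      by (intro family_mult_polynomial(1)[OF F _ _ inner.hyps(2)] IH) auto
    then show ?case by (simp add: mult.left_commute)
  qed
qed

text \<open>The constant 1 with all derivatives 0 is a family, so moments come from the same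
  induction.\<close>

lemma integrable_polynomial: 
  assumes "polynomial_le B d p" shows "integrable m p"
proof -
  have "deriv_family (\<lambda>hs _. if hs = [] then 1 else 0)"
    unfolding deriv_family_def by auto
  from integrable_family_polynomial[OF this assms, of "[]"] show ?thesis by simp
qed

lemma polynomial_foldr_dir_deriv:
  assumes "polynomial_le B d p"
  shows "polynomial_le B (d - length hs) (foldr dir_deriv hs p)"
    and "d < length hs \<Longrightarrow> foldr dir_deriv hs p = (\<lambda>_. 0)"
proof -
  have *: "polynomial_le B (d - length hs) (foldr dir_deriv hs p) \<and>
    (d < length hs \<longrightarrow> foldr dir_deriv hs p = (\<lambda>_. 0))"
  proof (induction hs)
    case (Cons v hs)
    then show ?case
      using polynomial_le_dir_deriv[of B "d - length hs" "foldr dir_deriv hs p" v]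
        dir_deriv_const[of B "d - length hs" "foldr dir_deriv hs p" v] by auto
  qed (use assms in simp)
  then show "polynomial_le B (d - length hs) (foldr dir_deriv hs p)"
    "d < length hs \<Longrightarrow> foldr dir_deriv hs p = (\<lambda>_. 0)" by auto
qed

lemma deriv_family_polynomial:
  assumes "polynomial_le B d p" shows "deriv_family (\<lambda>hs. foldr dir_deriv hs p)"
  unfolding deriv_family_def
  using polynomial_foldr_dir_deriv(1)[OF assms] polynomial_le_borel integrable_polynomial
    has_dir_deriv[OF polynomial_foldr_dir_deriv(1)[OF assms]] by fastforce

text \<open>\<open>wick_poly (v # vs)\<close> applies the adjoint of the derivative in direction \<open>v\<close>
  (up to the factor \<open>(s v)\<^sup>2\<close>) to \<open>wick_poly vs\<close>.\<close>

primrec wick_poly :: "'a list \<Rightarrow> 'a \<Rightarrow> real" where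
  "wick_poly [] = (\<lambda>_. 1)"
| "wick_poly (v # vs) = (\<lambda>z. inner v z * wick_poly vs z - (s v)\<^sup>2 * dir_deriv v (wick_poly vs) z)"

lemma polynomial_wick_poly: "vs \<in> lists B \<Longrightarrow> polynomial_le B (length vs) (wick_poly vs)"
proof (induction vs)
  case (Cons v vs)
  then have "polynomial_le B (length vs) (wick_poly vs)" by simp
  from polynomial_le.inner[of v, OF _ this] polynomial_le_dir_deriv[OF this, of v] show ?case
    using Cons.prems by (auto intro!: polynomial_le_diff polynomial_le_cmult elim: polynomial_le_mono)
qed (auto intro: polynomial_le.const)

text \<open>The corrections by derivatives lower the degree, so the product of coordinates is the
  leading part of the Wick polynomial. This puts the difference into the space onto which the Wick
  transform projects.\<close>

lemma polynomial_wick_poly_diff: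
  "vs \<in> lists B \<Longrightarrow> polynomial_le B (length vs - 1) (\<lambda>z. (\<Prod>v\<leftarrow>vs. inner v z) - wick_poly vs z)"
proof (induction vs)
  case Nil
  then show ?case using polynomial_le.const[of B 0 0] by simp
next
  case (Cons v vs)
  let ?d = "\<lambda>z. (\<Prod>v\<leftarrow>vs. inner v z) - wick_poly vs z"
  have "polynomial_le B (length vs) (\<lambda>z. inner v z * ?d z)"
  \<comment> \<open>For empty \<open>vs\<close> the bound \<open>length vs - 1\<close> is truncated
    and would be one too large after multiplication; but then the difference is 0.\<close>
  proof (cases vs)
    case Nil
    then show ?thesis using polynomial_le.const[of B 0 0] by simp
  next
    case (Cons u us)
    then show ?thesis
      using polynomial_le.inner[of v B "length vs - 1" ?d] Cons.IH Cons.prems by simp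
  qed
  moreover have "polynomial_le B (length vs) (dir_deriv v (wick_poly vs))"
    using Cons.prems by (intro polynomial_le_mono[OF polynomial_le_dir_deriv[OF polynomial_wick_poly]]) auto
  ultimately have "polynomial_le B (length vs) (\<lambda>z. inner v z * ?d z + (s v)\<^sup>2 * dir_deriv v (wick_poly vs) z)"
    by (intro polynomial_le.add polynomial_le_cmult)
  then show ?case by (simp add: algebra_simps)
qed

text \<open>Integration by parts gives one term with the derivative on \<open>F\<close> and one with
  the derivative on \<open>wick_poly vs\<close>; the correction term in
  \<open>wick_poly (v # vs)\<close> cancels the second. Each step puts its direction in front of
  \<open>hs\<close>, whence \<open>rev vs\<close>.\<close>

lemma wick_poly_duality:
  assumes F: "deriv_family F"
  shows "vs \<in> lists B \<Longrightarrow> hs \<in> lists B \<Longrightarrow>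
    (\<integral>z. F hs z * wick_poly vs z \<partial>m) = (\<Prod>v\<leftarrow>vs. (s v)\<^sup>2) * (\<integral>z. F (rev vs @ hs) z \<partial>m)"
proof (induction vs arbitrary: hs)
  case (Cons v vs)
  then have v: "v \<in> B" and vs: "vs \<in> lists B" and vhs: "v # hs \<in> lists B" by auto
  note p = polynomial_wick_poly[OF vs]
  note i = integrable_family_polynomial[OF F]
  note p' = polynomial_le_dir_deriv[OF p, of v]
  note step = family_mult_polynomial[OF F Cons.prems(2) v p i[OF p Cons.prems(2)] i[OF p vhs]
      i[OF p' Cons.prems(2)]]
  have "(\<integral>z. F hs z * wick_poly (v # vs) z \<partial>m)
      = (\<integral>z. inner v z * (F hs z * wick_poly vs z) - (s v)\<^sup>2 * (F hs z * dir_deriv v (wick_poly vs) z) \<partial>m)"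
    by (simp add: algebra_simps)
  also have "\<dots> = (s v)\<^sup>2 * (\<integral>z. F (v # hs) z * wick_poly vs z \<partial>m)"
    using step i[OF p' Cons.prems(2)] by (simp add: distrib_left)
  also have "\<dots> = (s v)\<^sup>2 * ((\<Prod>v\<leftarrow>vs. (s v)\<^sup>2) * (\<integral>z. F (rev vs @ v # hs) z \<partial>m))"
    by (simp only: Cons.IH[OF vs vhs])
  finally show ?case by simp
qed simp

lemma wick_poly_orthogonal:
  assumes "vs \<in> lists B" "polynomial_le B d p" "d < length vs"
  shows "(\<integral>z. p z * wick_poly vs z \<partial>m) = 0"
  using wick_poly_duality[OF deriv_family_polynomial[OF assms(2)] assms(1), of "[]"]
    polynomial_foldr_dir_deriv(2)[OF assms(2), of "rev vs"] assms(3) by simp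

end

section \<open>Orthogonality to lower chaoses\<close>

lemma fin_span_superset: "s \<in> S \<Longrightarrow> s \<in> fin_span S"
  unfolding fin_span_def by (auto intro!: exI[of _ "{s}"] exI[of _ "\<lambda>_. 1"])

lemma fin_span_zero: "(\<lambda>_. 0) \<in> fin_span S"
  unfolding fin_span_def by (auto intro!: exI[of _ "{}"])

lemma fin_span_cmult: "p \<in> fin_span S \<Longrightarrow> (\<lambda>x. a * p x) \<in> fin_span S"
proof -
  assume "p \<in> fin_span S"
  then obtain F c where F: "finite F" "F \<subseteq> S" "p = (\<lambda>x. \<Sum>s\<in>F. c s * s x)"
    unfolding fin_span_def by auto
  show ?thesis
    unfolding fin_span_def using F
    by (intro CollectI exI[of _ F] exI[of _ "\<lambda>s. a * c s"]) (simp add: sum_distrib_left mult.assoc)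
qed

lemma fin_span_add: 
  assumes "p \<in> fin_span S" "p' \<in> fin_span S"
  shows "(\<lambda>x. p x + p' x) \<in> fin_span S"
proof -
  obtain F c where F: "finite F" "F \<subseteq> S" "p = (\<lambda>x. \<Sum>s\<in>F. c s * s x)"
    using assms(1) unfolding fin_span_def by auto
  obtain F' c' where F': "finite F'" "F' \<subseteq> S" "p' = (\<lambda>x. \<Sum>s\<in>F'. c' s * s x)"
    using assms(2) unfolding fin_span_def by auto
  define a where "a s = (if s \<in> F then c s else 0) + (if s \<in> F' then c' s else 0)" for s
  have "(\<Sum>s\<in>F \<union> F'. a s * s x) = p x + p' x" for x
  proof -
    have "p x = (\<Sum>s\<in>F \<union> F'. (if s \<in> F then c s else 0) * s x)"
      unfolding F(3) using F F' by (intro sum.mono_neutral_cong_left) auto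
    moreover have "p' x = (\<Sum>s\<in>F \<union> F'. (if s \<in> F' then c' s else 0) * s x)"
      unfolding F'(3) using F F' by (intro sum.mono_neutral_cong_left) auto
    ultimately show ?thesis by (simp add: a_def distrib_right sum.distrib)
  qed
  then show ?thesis
    unfolding fin_span_def using F F'
    by (intro CollectI exI[of _ "F \<union> F'"] exI[of _ a]) auto
qed

lemma fin_span_induct [consumes 1, case_names zero add]:
  assumes p: "p \<in> fin_span S" and zero: "P (\<lambda>_. 0)"
    and add: "\<And>c s p. s \<in> S \<Longrightarrow> P p \<Longrightarrow> P (\<lambda>x. c * s x + p x)"
  shows "P p"
proof -
  obtain F c where F: "finite F" "F \<subseteq> S" "p = (\<lambda>x. \<Sum>s\<in>F. c s * s x)"
    using p unfolding fin_span_def by auto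
  have "P (\<lambda>x. \<Sum>s\<in>F. c s * s x)"
    using F(1,2)
  proof (induction F rule: finite_induct)
    case (insert s F)
    then show ?case using add[of s "\<lambda>x. \<Sum>s\<in>F. c s * s x" "c s"] by simp
  qed (simp add: zero)
  then show ?thesis using F by simp
qed

section \<open>Geometry of square-integrable functions\<close>

lemma L2_mult_integrable:
  assumes "f \<in> L2 m" "g \<in> L2 m" shows "integrable m (\<lambda>x. f x * g x)"
proof (rule Bochner_Integration.integrable_bound)
  show "integrable m (\<lambda>x. (f x)\<^sup>2 + (g x)\<^sup>2)" using assms by (auto simp: L2_def)
  have [measurable]: "f \<in> borel_measurable m" "g \<in> borel_measurable m" using assms by (auto simp: L2_def)
  show "(\<lambda>x. f x * g x) \<in> borel_measurable m" by simp
  have "\<bar>a * b\<bar> \<le> a\<^sup>2 + b\<^sup>2" for a b :: real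
    using sum_squares_bound[of "\<bar>a\<bar>" "\<bar>b\<bar>"] mult_nonneg_nonneg[of "\<bar>a\<bar>" "\<bar>b\<bar>"]
    unfolding abs_mult power2_abs by linarith
  then show "AE x in m. norm (f x * g x) \<le> norm ((f x)\<^sup>2 + (g x)\<^sup>2)" by simp
qed

lemma L2_add: 
  assumes "f \<in> L2 m" "g \<in> L2 m" shows "(\<lambda>x. f x + g x) \<in> L2 m"
  using assms L2_mult_integrable[OF assms] by (auto simp: L2_def power2_sum mult.assoc)

lemma L2_cmult: "f \<in> L2 m \<Longrightarrow> (\<lambda>x. c * f x) \<in> L2 m"
  by (auto simp: L2_def power_mult_distrib)

lemma L2_diff: "f \<in> L2 m \<Longrightarrow> g \<in> L2 m \<Longrightarrow> (\<lambda>x. f x - g x) \<in> L2 m"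
  using L2_add[of f m "\<lambda>x. (- 1) * g x"] L2_cmult[of g m "- 1"] by simp

lemma L2_Cauchy_Schwarz:
  assumes f: "f \<in> L2 m" and g: "g \<in> L2 m"
  shows "\<bar>\<integral>x. f x * g x \<partial>m\<bar> \<le> sqrt (\<integral>x. (f x)\<^sup>2 \<partial>m) * sqrt (\<integral>x. (g x)\<^sup>2 \<partial>m)"
proof -
  define A where "A = (\<integral>x. (f x)\<^sup>2 \<partial>m)"
  define b where "b = (\<integral>x. f x * g x \<partial>m)"
  define C where "C = (\<integral>x. (g x)\<^sup>2 \<partial>m)"
  have i: "integrable m (\<lambda>x. (f x)\<^sup>2)" "integrable m (\<lambda>x. (g x)\<^sup>2)" "integrable m (\<lambda>x. f x * g x)"
    using f g L2_mult_integrable[OF f g] by (auto simp: L2_def)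
  have quad: "0 \<le> t\<^sup>2 * C - 2 * t * b + A" for t
  proof -
    have "0 \<le> (\<integral>x. (f x - t * g x)\<^sup>2 \<partial>m)" by simp
    also have "\<dots> = (\<integral>x. (f x)\<^sup>2 - 2 * t * (f x * g x) + t\<^sup>2 * (g x)\<^sup>2 \<partial>m)"
      by (intro arg_cong[where f = "integral\<^sup>L m"]) (auto simp: power2_eq_square algebra_simps)
    also have "\<dots> = t\<^sup>2 * C - 2 * t * b + A" using i by (simp add: A_def b_def C_def)
    finally show ?thesis .
  qed
  have C0: "0 \<le> C" by (simp add: C_def)
  have "b\<^sup>2 \<le> A * C"
  proof (cases "C = 0")
    case True
    have "b = 0"
    proof (rule ccontr)
      assume "b \<noteq> 0"
      \<comment> \<open>With \<open>C = 0\<close> the quadratic degenerates to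
        \<open>A - 2 * t * b\<close>, which equals -1 at this \<open>t\<close>.\<close>
      then show False using quad[of "(A + 1) / (2 * b)"] True by simp
    qed
    then show ?thesis using True by simp
  next
    case False
    have "0 \<le> C * ((b / C)\<^sup>2 * C - 2 * (b / C) * b + A)"
      using C0 quad by (rule mult_nonneg_nonneg)
    also have "\<dots> = A * C - b\<^sup>2" using False by (simp add: field_simps power2_eq_square)
    finally show ?thesis by simp
  qed
  then have "\<bar>b\<bar> \<le> sqrt (A * C)" by (simp add: real_le_rsqrt)
  then show ?thesis by (simp add: A_def b_def C_def real_sqrt_mult)
qed

lemma orthogonal_l2closure:
  assumes Y: "Y \<in> L2 m" and S: "S \<subseteq> L2 m" and orth: "\<And>s. s \<in> S \<Longrightarrow> (\<integral>x. Y x * s x \<partial>m) = 0"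
    and v: "v \<in> l2closure m S"
  shows "(\<integral>x. Y x * v x \<partial>m) = 0"
proof (rule ccontr)
  assume ne: "(\<integral>x. Y x * v x \<partial>m) \<noteq> 0"
  have vL2: "v \<in> L2 m" using v by (simp add: l2closure_def)
  let ?c = "sqrt (\<integral>x. (Y x)\<^sup>2 \<partial>m)" and ?I = "\<bar>\<integral>x. Y x * v x \<partial>m\<bar>"
  have c0: "0 \<le> ?c" by simp
  \<comment> \<open>The divisor is \<open>?c + 1\<close> instead of \<open>?c\<close> because
    \<open>Y\<close> may have norm 0.\<close>
  then have c1: "0 < ?c + 1" by linarith
  then have "0 < ?I / (?c + 1)" using ne by (intro divide_pos_pos) auto
  then obtain s where s: "s \<in> S" "l2dist m v s < ?I / (?c + 1)"
    using v unfolding l2closure_def by blast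
  have sL2: "s \<in> L2 m" using S s by auto
  have "?I = \<bar>\<integral>x. Y x * (v x - s x) \<partial>m\<bar>"
    using orth[OF s(1)] L2_mult_integrable[OF Y vL2] L2_mult_integrable[OF Y sL2]
    by (simp add: right_diff_distrib)
  also have "\<dots> \<le> ?c * l2dist m v s"
    unfolding l2dist_def by (rule L2_Cauchy_Schwarz[OF Y L2_diff[OF vL2 sL2]])
  also have "\<dots> \<le> ?c * (?I / (?c + 1))" using s(2) c0 by (intro mult_left_mono) auto
  also have "\<dots> < ?I"
    using ne c1 by (simp add: pos_divide_less_eq algebra_simps)
  finally show False by simp
qed

text \<open>\<open>l2proj\<close> is a choice; any function with the defining property represents it.\<close>

lemma l2proj_AE_eq:
  assumes V: "V \<subseteq> L2 m" and h: "h \<in> L2 m" and g: "g \<in> V"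
    and orth: "\<And>v. v \<in> V \<Longrightarrow> (\<integral>x. (h x - g x) * v x \<partial>m) = 0"
  shows "AE x in m. l2proj m V h x = g x" and "l2proj m V h \<in> V"
proof -
  define p where "p = l2proj m V h"
  have p: "p \<in> V \<and> (\<forall>v\<in>V. (\<integral>x. (h x - p x) * v x \<partial>m) = 0)"
    unfolding p_def l2proj_def
    by (rule someI[where x = g and P = "\<lambda>p. p \<in> V \<and> (\<forall>v\<in>V. (\<integral>x. (h x - p x) * v x \<partial>m) = 0)"])
      (use g orth in blast)
  then show "l2proj m V h \<in> V" by (simp add: p_def)
  have L: "p \<in> L2 m" "g \<in> L2 m" using p g V by auto
  note i = L2_mult_integrable[OF L2_diff[OF h L(1)]] L2_mult_integrable[OF L2_diff[OF h L(2)]]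
  \<comment> \<open>The squared distance is the pairing of \<open>p - g\<close> with
    \<open>h - g\<close> minus its pairing with \<open>h - p\<close>. Both vanish, since
    \<open>p\<close> and \<open>g\<close> lie in \<open>V\<close>.\<close>
  have "(\<integral>x. (p x - g x)\<^sup>2 \<partial>m) = (\<integral>x. (h x - g x) * p x - (h x - g x) * g x
      - ((h x - p x) * p x - (h x - p x) * g x) \<partial>m)"
    by (intro arg_cong[where f = "integral\<^sup>L m"]) (auto simp: power2_eq_square algebra_simps)
  also have "\<dots> = 0" using p g orth i L by simp
  finally have "(\<integral>x. (p x - g x)\<^sup>2 \<partial>m) = 0" .
  moreover have "integrable m (\<lambda>x. (p x - g x)\<^sup>2)" using L2_diff[OF L] by (simp add: L2_def)
  ultimately have "AE x in m. (p x - g x)\<^sup>2 = 0"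
    using integral_nonneg_eq_0_iff_AE[of m "\<lambda>x. (p x - g x)\<^sup>2"] by simp
  then show "AE x in m. l2proj m V h x = g x" by (simp add: p_def)
qed

section \<open>Moments of Gaussian variables and of their limits\<close>

context diagonal_gaussian
begin

text \<open>A negative \<open>q x\<close> would make a characteristic function exceed 1 in
  modulus.\<close>

lemma variance_nonneg: "0 \<le> q x"
proof -
  have "norm (\<integral>z. cis (inner x z) \<partial>m) \<le> (\<integral>z. norm (cis (inner x z)) \<partial>m)"
    by (rule integral_norm_bound)
  then show ?thesis by (simp add: charfun prob_space)
qed

lemma distr_inner:
  "distr m borel (inner v) = distr std_normal_distribution borel (\<lambda>t. sqrt (q v) * t)"
proof (rule Levy_uniqueness)
  show "char (distr m borel (inner v)) = char (distr std_normal_distribution borel (\<lambda>t. sqrt (q v) * t))"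
  proof
    fix t
    have "char (distr m borel (inner v)) t = (\<integral>z. cis (inner (t *\<^sub>R v) z) \<partial>m)"
      by (simp add: char_eq_cis integral_distr)
    also have "\<dots> = complex_of_real (exp (- q (t *\<^sub>R v) / 2))" by (rule charfun)
    also have "\<dots> = char std_normal_distribution (t * sqrt (q v))"
      using variance_nonneg[of v]
      by (simp add: variance_scale char_std_normal_distribution power_mult_distrib)
    also have "\<dots> = char (distr std_normal_distribution borel (\<lambda>t. sqrt (q v) * t)) t"
      by (simp add: char_eq_cis integral_distr mult.assoc)
    finally show "char (distr m borel (inner v)) t
      = char (distr std_normal_distribution borel (\<lambda>t. sqrt (q v) * t)) t" .
  qed
qed (auto intro!: real_distribution_distr normal.real_distribution_distr)

lemma inner_even_moment:
  shows "integrable m (\<lambda>z. (inner v z) ^ (2 * n))"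
    and "(\<integral>z. (inner v z) ^ (2 * n) \<partial>m) = q v ^ n * (fact (2 * n) / (2 ^ n * fact n))"
proof -
  have i: "integrable std_normal_distribution (\<lambda>t. (sqrt (q v) * t) ^ (2 * n))"
    using std_normal_distribution_even_moments(2)[of n] by (simp add: power_mult_distrib)
  have "integrable (distr std_normal_distribution borel (\<lambda>t. sqrt (q v) * t)) (\<lambda>x. x ^ (2 * n))"
    by (subst integrable_distr_eq) (use i in simp_all)
  then have "integrable (distr m borel (inner v)) (\<lambda>x. x ^ (2 * n))"
    by (simp only: distr_inner)
  then show "integrable m (\<lambda>z. (inner v z) ^ (2 * n))"
    by (rule integrable_distr[rotated]) simp
  have "(\<integral>z. (inner v z) ^ (2 * n) \<partial>m) = (\<integral>x. x ^ (2 * n) \<partial>distr m borel (inner v))"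
    by (simp add: integral_distr)
  also have "\<dots> = (\<integral>t. (sqrt (q v) * t) ^ (2 * n) \<partial>std_normal_distribution)"
    unfolding distr_inner by (simp add: integral_distr)
  also have "\<dots> = q v ^ n * (fact (2 * n) / (2 ^ n * fact n))"
    using variance_nonneg[of v] std_normal_distribution_even_moments(1)[of n]
    by (simp add: power_mult_distrib power_mult)
  finally show "(\<integral>z. (inner v z) ^ (2 * n) \<partial>m) = q v ^ n * (fact (2 * n) / (2 ^ n * fact n))" .
qed

text \<open>Even powers avoid absolute values. Unlike \<open>L2\<close>, this class is closed under
  products: by Cauchy-Schwarz the moment of order \<open>2 * n\<close> of a product is controlled by
  the moments of order \<open>4 * n\<close> of its factors.\<close>

definition moments :: "('a \<Rightarrow> real) set" where
  "moments = {F \<in> borel_measurable borel. \<forall>n. integrable m (\<lambda>z. (F z) ^ (2 * n))}"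

lemma moments_mult: "F \<in> moments \<Longrightarrow> G \<in> moments \<Longrightarrow> (\<lambda>z. F z * G z) \<in> moments"
proof -
  assume F: "F \<in> moments" and G: "G \<in> moments"
  have [measurable]: "F \<in> borel_measurable borel" "G \<in> borel_measurable borel"
    using F G by (auto simp: moments_def)
  have "integrable m (\<lambda>z. (F z * G z) ^ (2 * n))" for n
  proof -
    have "(\<lambda>z. (H z) ^ n * (H z) ^ n) \<in> L2 m" if "H \<in> moments" for H
    proof -
      have [measurable]: "H \<in> borel_measurable borel" and "integrable m (\<lambda>z. (H z) ^ (2 * (2 * n)))"
        using that unfolding moments_def by blast+
      then show ?thesis
        by (simp add: L2_def power_mult[symmetric] power_add[symmetric] mult_2[symmetric] mult.commute)
    qed
    from L2_mult_integrable[OF this[OF F] this[OF G]] show ?thesis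
      by (simp add: power_mult_distrib power_add[symmetric] mult_2[symmetric])
  qed
  then show ?thesis by (simp add: moments_def)
qed

lemma moments_L2: "F \<in> moments \<Longrightarrow> F \<in> L2 m"
  unfolding moments_def L2_def using measurable_cong_sets[OF sets_m refl] by (force dest: spec[of _ 1])

lemma polynomial_power: "polynomial_le B d p \<Longrightarrow> polynomial_le B (n * d) (\<lambda>z. (p z) ^ n)"
  by (induction n) (auto intro: polynomial_le.const dest: polynomial_le_mult)

lemma polynomial_moments: "polynomial_le B d p \<Longrightarrow> p \<in> moments"
  unfolding moments_def using polynomial_power integrable_polynomial polynomial_le_borel by blast

definition first_chaos :: "('a \<Rightarrow> real) set" where
  "first_chaos = l2cspan m (inner ` B)"

text \<open>Two views of a finite combination: as \<open>inner v\<close> it has a known normal law,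
  which gives moment bounds; as a polynomial of degree 1 it can be tested against Wick
  polynomials.\<close>

lemma fin_span_inner_linear:
  assumes "p \<in> fin_span (inner ` B)"
  shows "\<exists>v. p = inner v" "polynomial_le B 1 p"
proof -
  from assms have "(\<exists>v. p = inner v) \<and> polynomial_le B 1 p"
  proof (induction rule: fin_span_induct)
    case zero
    then show ?case using polynomial_le.const[of B 1 0] by (auto intro!: exI[of _ 0])
  next
    case (add c s p)
    then obtain h v where h: "h \<in> B" "s = inner h" and v: "p = inner v" and p: "polynomial_le B 1 p"
      by auto
    have "(\<lambda>x. c * s x + p x) = inner (c *\<^sub>R h + v)"
      by (auto simp: h v inner_add_left)
    moreover have "polynomial_le B 1 (\<lambda>x. c * s x + p x)"
      using polynomial_le.inner[OF h(1) polynomial_le.const[of B 0 1]] h p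
      by (auto intro!: polynomial_le.add polynomial_le_cmult)
    ultimately show ?case by blast
  qed
  then show "\<exists>v. p = inner v" "polynomial_le B 1 p" by auto
qed

lemma inner_in_first_chaos: "h \<in> B \<Longrightarrow> inner h \<in> first_chaos"
  unfolding first_chaos_def l2cspan_def l2closure_def
proof (intro CollectI conjI allI impI)
  assume h: "h \<in> B"
  show "inner h \<in> L2 m"
    using polynomial_le.inner[OF h polynomial_le.const[of B 0 1]] polynomial_moments moments_L2 by auto
  fix \<epsilon> :: real assume "0 < \<epsilon>"
  then show "\<exists>s\<in>fin_span (inner ` B). l2dist m (inner h) s < \<epsilon>"
    using h by (intro bexI[of _ "inner h"] fin_span_superset) (auto simp: l2dist_def)
qed

text \<open>Hypercontractivity for Gaussian variables, in the weak form needed here: the even moments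
  of an approximating sequence are controlled by its variances, and Fatou's lemma passes to the
  limit.\<close>

lemma first_chaos_moments: 
  assumes h: "h \<in> first_chaos" shows "h \<in> moments"
proof -
  have hL2: "h \<in> L2 m" using h by (simp add: first_chaos_def l2cspan_def l2closure_def)
  then have h_borel [measurable]: "h \<in> borel_measurable borel"
    using measurable_cong_sets[OF sets_m refl] by (auto simp: L2_def)
  have "\<exists>s\<in>fin_span (inner ` B). l2dist m h s < 1 / real (Suc n)" for n
    using h by (simp add: first_chaos_def l2cspan_def l2closure_def)
  then obtain s where s: "\<And>n. s n \<in> fin_span (inner ` B)" "\<And>n. l2dist m h (s n) < 1 / real (Suc n)"
    by metis
  obtain v where v: "\<And>n. s n = inner (v n)"
    using fin_span_inner_linear(1)[OF s(1)] by metis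
  have sL2: "s n \<in> L2 m" for n
    using fin_span_inner_linear(2)[OF s(1)] polynomial_moments moments_L2 by blast
  define u where "u n x = (h x - s n x)\<^sup>2" for n x
  have u_int: "integrable m (u n)" for n
    using L2_diff[OF hL2 sL2] unfolding u_def by (simp add: L2_def)
  have u_le: "(\<integral>x. u n x \<partial>m) \<le> 1 / real (Suc n)" for n
  proof -
    have "(\<integral>x. u n x \<partial>m) = (l2dist m h (s n))\<^sup>2"
      by (simp add: u_def l2dist_def)
    also have "\<dots> \<le> (1 / real (Suc n))\<^sup>2"
      using s(2)[of n] by (intro power_mono) (auto simp: l2dist_def)
    also have "\<dots> \<le> 1 / real (Suc n)" by (simp add: power2_eq_square divide_simps)
    finally show ?thesis .
  qed
  have "(\<lambda>n. \<integral>x. norm (u n x) \<partial>m) \<longlonglongrightarrow> 0"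
  proof (rule real_tendsto_sandwich[OF _ _ tendsto_const])
    show "(\<lambda>n. 1 / real (Suc n)) \<longlonglongrightarrow> 0" by (rule LIMSEQ_Suc) (rule lim_1_over_n)
  qed (use u_le in \<open>auto simp: u_def\<close>)
  \<comment> \<open>Convergence in \<open>L2\<close> yields pointwise convergence almost everywhere
    only along a subsequence, which is enough for Fatou's lemma.\<close>
  from tendsto_L1_AE_subseq[OF u_int this] obtain r :: "nat \<Rightarrow> nat"
    where r: "AE x in m. (\<lambda>n. u (r n) x) \<longlonglongrightarrow> 0" by blast
  have AE: "AE x in m. (\<lambda>n. s (r n) x) \<longlonglongrightarrow> h x"
    using r
  proof eventually_elim
    fix x assume "(\<lambda>n. u (r n) x) \<longlonglongrightarrow> 0"
    then have "(\<lambda>n. sqrt (u (r n) x)) \<longlonglongrightarrow> sqrt 0" by (rule tendsto_real_sqrt)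
    then have "(\<lambda>n. h x - s (r n) x) \<longlonglongrightarrow> 0"
      by (simp add: u_def tendsto_rabs_zero_iff)
    from tendsto_diff[OF tendsto_const[of "h x"] this] show "(\<lambda>n. s (r n) x) \<longlonglongrightarrow> h x" by simp
  qed
  \<comment> \<open>From \<open>(s n x)^2 \<le> 2 * (h x)^2 + 2 * u n x\<close>, whose defect is the
    square of \<open>2 * h x - s n x\<close>, and from the integral of \<open>u n\<close> being at
    most 1.\<close>
  define C where "C = 2 * (\<integral>x. (h x)\<^sup>2 \<partial>m) + 2"
  have var: "q (v n) \<le> C" for n
  proof -
    have "q (v n) = (\<integral>x. (s n x)\<^sup>2 \<partial>m)" using inner_even_moment(2)[of "v n" 1] by (simp add: v)
    also have "\<dots> \<le> (\<integral>x. 2 * (h x)\<^sup>2 + 2 * u n x \<partial>m)"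
    proof (rule integral_mono)
      show "(s n x)\<^sup>2 \<le> 2 * (h x)\<^sup>2 + 2 * u n x" for x
        using zero_le_power2[of "2 * h x - s n x"] by (simp add: u_def power2_eq_square algebra_simps)
    qed (use hL2 sL2 u_int in \<open>auto simp: L2_def\<close>)
    also have "\<dots> = 2 * (\<integral>x. (h x)\<^sup>2 \<partial>m) + 2 * (\<integral>x. u n x \<partial>m)"
      using hL2 u_int by (simp add: L2_def)
    also have "\<dots> \<le> C"
      using order_trans[OF u_le[of n], of 1] by (simp add: C_def)
    finally show ?thesis .
  qed
  have "integrable m (\<lambda>z. (h z) ^ (2 * p))" for p
  proof (rule integrableI_bounded)
    let ?c = "fact (2 * p) / (2 ^ p * fact p) :: real"
    have [measurable]: "s n \<in> borel_measurable borel" for n unfolding v by measurable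
    have "(\<integral>\<^sup>+z. ennreal (norm ((h z) ^ (2 * p))) \<partial>m)
        = (\<integral>\<^sup>+z. liminf (\<lambda>n. ennreal ((s (r n) z) ^ (2 * p))) \<partial>m)"
    proof (rule nn_integral_cong_AE)
      show "AE z in m. ennreal (norm ((h z) ^ (2 * p))) = liminf (\<lambda>n. ennreal ((s (r n) z) ^ (2 * p)))"
        using AE
      proof eventually_elim
        fix z assume "(\<lambda>n. s (r n) z) \<longlonglongrightarrow> h z"
        then have "(\<lambda>n. ennreal ((s (r n) z) ^ (2 * p))) \<longlonglongrightarrow> ennreal ((h z) ^ (2 * p))"
          by (intro tendsto_ennrealI tendsto_power)
        from lim_imp_Liminf[OF _ this]
        show "ennreal (norm ((h z) ^ (2 * p))) = liminf (\<lambda>n. ennreal ((s (r n) z) ^ (2 * p)))"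
          by simp
      qed
    qed
    also have "\<dots> \<le> liminf (\<lambda>n. \<integral>\<^sup>+z. ennreal ((s (r n) z) ^ (2 * p)) \<partial>m)"
      by (rule nn_integral_liminf) simp
    also have "\<dots> \<le> ennreal (C ^ p * ?c)"
    proof (rule Liminf_le)
      show "\<forall>\<^sub>F n in sequentially. (\<integral>\<^sup>+z. ennreal ((s (r n) z) ^ (2 * p)) \<partial>m) \<le> ennreal (C ^ p * ?c)"
      proof (intro always_eventually allI)
        fix n
        have "(\<integral>\<^sup>+z. ennreal ((s (r n) z) ^ (2 * p)) \<partial>m) = ennreal (\<integral>z. (s (r n) z) ^ (2 * p) \<partial>m)"
          unfolding v by (intro nn_integral_eq_integral inner_even_moment) simp
        also have "\<dots> = ennreal (q (v (r n)) ^ p * ?c)" unfolding v inner_even_moment(2) ..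
        also have "\<dots> \<le> ennreal (C ^ p * ?c)"
          using var variance_nonneg by (intro ennreal_leI mult_right_mono power_mono) auto
        finally show "(\<integral>\<^sup>+z. ennreal ((s (r n) z) ^ (2 * p)) \<partial>m) \<le> ennreal (C ^ p * ?c)" .
      qed
    qed simp
    finally show "(\<integral>\<^sup>+z. ennreal (norm ((h z) ^ (2 * p))) \<partial>m) < \<infinity>"
      by (simp add: order_le_less_trans)
  qed simp
  then show ?thesis by (simp add: moments_def)
qed

definition chaos_products :: "nat \<Rightarrow> ('a \<Rightarrow> real) set" where
  "chaos_products n = {(\<lambda>x. \<Prod>i<n. hs i x) | hs. \<forall>i<n. hs i \<in> first_chaos}"

lemma prod_first_chaos_moments:
  fixes n :: nat
  shows "\<forall>i<n. hs i \<in> first_chaos \<Longrightarrow> (\<lambda>x. \<Prod>i<n. hs i x) \<in> moments"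
proof (induction n)
  case 0
  then show ?case using polynomial_moments[OF polynomial_le.const[of B 0 1]] by simp
next
  case (Suc n)
  then show ?case using moments_mult[OF Suc.IH first_chaos_moments] by simp
qed

lemma fin_span_chaos_products_L2:
  assumes "p \<in> fin_span (chaos_products n)" shows "p \<in> L2 m"
  using assms
proof (induction rule: fin_span_induct)
  case zero
  then show ?case by (simp add: L2_def)
next
  case (add c s p)
  then have "s \<in> L2 m"
    unfolding chaos_products_def using prod_first_chaos_moments moments_L2 by auto
  then show ?case using add by (intro L2_add L2_cmult)
qed

definition lower_chaos :: "nat \<Rightarrow> ('a \<Rightarrow> real) set" where
  "lower_chaos k = l2cspan m (\<Union>j<k. fin_span (chaos_products j))"

lemma fin_span_lower_L2:
  assumes "p \<in> fin_span (\<Union>j<k. fin_span (chaos_products j))" shows "p \<in> L2 m"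
  using assms
proof (induction rule: fin_span_induct)
  case (add c s p)
  then show ?case using fin_span_chaos_products_L2 by (intro L2_add L2_cmult) auto
qed (simp add: L2_def)

lemma inner_mult_chaos_products:
  assumes h: "h \<in> B" and p: "p \<in> fin_span (chaos_products n)"
  shows "(\<lambda>z. inner h z * p z) \<in> fin_span (chaos_products (Suc n))"
  using p
proof (induction rule: fin_span_induct)
  case (add c s p)
  then obtain hs where hs: "s = (\<lambda>x. \<Prod>i<n. hs i x)" "\<forall>i<n. hs i \<in> first_chaos"
    by (auto simp: chaos_products_def)
  have "(\<lambda>z. inner h z * s z) = (\<lambda>x. \<Prod>i<Suc n. (hs(n := inner h)) i x)"
    by (auto simp: hs fun_eq_iff mult.commute intro!: prod.cong)
  then have "(\<lambda>z. inner h z * s z) \<in> chaos_products (Suc n)"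
    unfolding chaos_products_def using hs(2) inner_in_first_chaos[OF h]
    by (intro CollectI exI[of _ "hs(n := inner h)"]) auto
  then have "(\<lambda>z. c * (inner h z * s z) + inner h z * p z) \<in> fin_span (chaos_products (Suc n))"
    using add.IH by (intro fin_span_add fin_span_cmult) (auto intro: fin_span_superset)
  then show ?case by (simp add: algebra_simps)
qed (simp add: fin_span_zero)

text \<open>The union below \<open>Suc d\<close> is the one that generates
  \<open>lower_chaos (Suc d)\<close>, so polynomials of degree less than \<open>k\<close> belong to
  \<open>lower_chaos k\<close>.\<close>

lemma polynomial_in_fin_span:
  "polynomial_le B d p \<Longrightarrow> p \<in> fin_span (\<Union>j<Suc d. fin_span (chaos_products j))"
proof (induction rule: polynomial_le.induct)
  case (const d c)
  have "(\<lambda>_. 1) \<in> chaos_products 0" by (auto simp: chaos_products_def)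
  then have "(\<lambda>_. 1) \<in> fin_span (\<Union>j<Suc d. fin_span (chaos_products j))"
    by (intro fin_span_superset UN_I[of 0]) (auto intro: fin_span_superset)
  from fin_span_cmult[OF this, of c] show ?case by simp
next
  case (add d p p')
  then show ?case by (intro fin_span_add)
next
  case (inner h d p)
  from inner.IH show ?case
  proof (induction rule: fin_span_induct)
    case (add c s p)
    then obtain j where j: "j < Suc d" "s \<in> fin_span (chaos_products j)" by auto
    have "(\<lambda>z. inner h z * s z) \<in> fin_span (\<Union>j<Suc (Suc d). fin_span (chaos_products j))"
    proof (rule fin_span_superset, rule UN_I)
      show "Suc j \<in> {..<Suc (Suc d)}" using j(1) by simp
      show "(\<lambda>z. inner h z * s z) \<in> fin_span (chaos_products (Suc j))"
        by (rule inner_mult_chaos_products[OF inner(1) j(2)])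
    qed
    from fin_span_add[OF fin_span_cmult[OF this, of c] add.IH] show ?case by (simp add: algebra_simps)
  qed (simp add: fin_span_zero)
qed

text \<open>The factors from the closed first chaos are replaced one at a time by polynomials of degree one.\<close>

lemma wick_poly_orthogonal_products:
  assumes vs: "vs \<in> lists B"
  shows "\<forall>i<n. hs i \<in> first_chaos \<Longrightarrow> polynomial_le B d p \<Longrightarrow> d + n < length vs \<Longrightarrow>
    (\<integral>z. wick_poly vs z * (p z * (\<Prod>i<n. hs i z)) \<partial>m) = 0"
proof (induction n arbitrary: d p)
  case 0
  then show ?case using wick_poly_orthogonal[OF vs, of d p] by (simp add: mult.commute)
next
  case (Suc n)
  let ?Y = "\<lambda>z. wick_poly vs z * (p z * (\<Prod>i<n. hs i z))"
  have "(\<integral>z. ?Y z * hs n z \<partial>m) = 0"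
  proof (rule orthogonal_l2closure)
    show "?Y \<in> L2 m"
      using polynomial_moments[OF polynomial_wick_poly[OF vs]] polynomial_moments[OF Suc.prems(2)]
        prod_first_chaos_moments[of n hs] Suc.prems(1)
      by (intro moments_L2 moments_mult) auto
    show "fin_span (inner ` B) \<subseteq> L2 m"
      using fin_span_inner_linear(2) polynomial_moments moments_L2 by blast
    show "hs n \<in> l2closure m (fin_span (inner ` B))"
      using Suc.prems(1) unfolding first_chaos_def l2cspan_def by auto
    show "(\<integral>z. ?Y z * t z \<partial>m) = 0" if "t \<in> fin_span (inner ` B)" for t
    proof -
      \<comment> \<open>Absorbing \<open>t\<close> raises the degree by one while one factor fewer
        remains, so the bound on \<open>d + n\<close> is preserved.\<close>
      have "polynomial_le B (d + 1) (\<lambda>z. p z * t z)"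
        by (intro polynomial_le_mult Suc.prems fin_span_inner_linear that)
      from Suc.IH[OF _ this] Suc.prems show ?thesis by (simp add: mult_ac)
    qed
  qed
  then show ?case by (simp add: mult_ac)
qed

text \<open>Orthogonality passes from products to the two nested finite spans by linearity, and to
  the closure by Cauchy-Schwarz.\<close>

lemma wick_poly_orthogonal_lower:
  assumes vs: "vs \<in> lists B" and v: "v \<in> lower_chaos (length vs)"
  shows "(\<integral>z. wick_poly vs z * v z \<partial>m) = 0"
proof (rule orthogonal_l2closure)
  let ?S = "\<Union>j<length vs. fin_span (chaos_products j)"
  show W: "wick_poly vs \<in> L2 m"
    using polynomial_moments[OF polynomial_wick_poly[OF vs]] by (rule moments_L2)
  show "fin_span ?S \<subseteq> L2 m" using fin_span_lower_L2 by blast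
  show "v \<in> l2closure m (fin_span ?S)" using v by (simp add: lower_chaos_def l2cspan_def)
  fix p assume "p \<in> fin_span ?S"
  then have "p \<in> L2 m \<and> (\<integral>z. wick_poly vs z * p z \<partial>m) = 0"
  proof (induction rule: fin_span_induct)
    case (add c t p)
    then obtain j where j: "j < length vs" "t \<in> fin_span (chaos_products j)" by auto
    from j(2) have "t \<in> L2 m \<and> (\<integral>z. wick_poly vs z * t z \<partial>m) = 0"
    proof (induction rule: fin_span_induct)
      case (add c t p)
      then obtain hs where hs: "t = (\<lambda>x. \<Prod>i<j. hs i x)" "\<forall>i<j. hs i \<in> first_chaos"
        by (auto simp: chaos_products_def)
      have t: "t \<in> L2 m" unfolding hs(1) by (rule moments_L2[OF prod_first_chaos_moments[OF hs(2)]])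
      have "(\<integral>z. wick_poly vs z * t z \<partial>m) = 0"
        using wick_poly_orthogonal_products[OF vs hs(2) polynomial_le.const[of B 0 1]] j(1) hs(1) by simp
      then show ?case
        using add t L2_mult_integrable[OF W t] L2_mult_integrable[OF W, of p]
        by (auto simp: distrib_left mult.left_commute[of _ c] intro!: L2_add L2_cmult)
    qed (simp add: L2_def)
    then show ?case
      using add L2_mult_integrable[OF W, of t] L2_mult_integrable[OF W, of p]
      by (auto simp: distrib_left mult.left_commute[of _ c] intro!: L2_add L2_cmult)
  qed (simp add: L2_def)
  then show "(\<integral>z. wick_poly vs z * p z \<partial>m) = 0" by simp
qed

text \<open>In \<open>h = (h - W) + W\<close>, with \<open>W\<close> the Wick polynomial, the first
  part lies in the lower chaos and the second is orthogonal to it. This identifies the projection up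
  to a null set.\<close>

lemma wick_transform_eq:
  assumes vs: "vs \<in> lists B" "vs \<noteq> []"
  defines "h \<equiv> \<lambda>z. \<Prod>v\<leftarrow>vs. inner v z"
  shows "AE z in m. h z - l2proj m (lower_chaos (length vs)) h z = wick_poly vs z"
    and "l2proj m (lower_chaos (length vs)) h \<in> L2 m"
proof -
  let ?V = "lower_chaos (length vs)" and ?g = "\<lambda>z. h z - wick_poly vs z"
  have V: "?V \<subseteq> L2 m" by (auto simp: lower_chaos_def l2cspan_def l2closure_def)
  have pg: "polynomial_le B (length vs - 1) ?g"
    using polynomial_wick_poly_diff[OF vs(1)] by (simp add: h_def)
  have gL2: "?g \<in> L2 m" by (rule moments_L2[OF polynomial_moments[OF pg]])
  have WL2: "wick_poly vs \<in> L2 m"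
    by (rule moments_L2[OF polynomial_moments[OF polynomial_wick_poly[OF vs(1)]]])
  have hL2: "h \<in> L2 m" using L2_add[OF gL2 WL2] by simp
  have g: "?g \<in> ?V"
    unfolding lower_chaos_def l2cspan_def l2closure_def
  proof (intro CollectI conjI allI impI)
    show "?g \<in> L2 m" by (rule gL2)
    fix \<epsilon> :: real assume "0 < \<epsilon>"
    \<comment> \<open>\<open>vs \<noteq> []\<close> makes \<open>Suc (length vs - 1)\<close> equal
      to \<open>length vs\<close>, the bound of the union.\<close>
    then show "\<exists>t\<in>fin_span (\<Union>j<length vs. fin_span (chaos_products j)). l2dist m ?g t < \<epsilon>"
      using polynomial_in_fin_span[OF pg] vs(2)
      by (intro bexI[of _ ?g]) (auto simp: l2dist_def)
  qed
  have orth: "(\<integral>z. (h z - ?g z) * v z \<partial>m) = 0" if "v \<in> ?V" for v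
    using wick_poly_orthogonal_lower[OF vs(1) that] by simp
  have "AE z in m. l2proj m ?V h z = ?g z"
    by (rule l2proj_AE_eq(1)[OF V hL2 g]) (rule orth)
  then show "AE z in m. h z - l2proj m ?V h z = wick_poly vs z" by eventually_elim simp
  show "l2proj m ?V h \<in> L2 m" using l2proj_AE_eq(2)[OF V hL2 g orth] V by blast
qed

lemma integral_wick_transform:
  assumes F: "deriv_family F" and vs: "vs \<in> lists B" "vs \<noteq> []"
  defines "h \<equiv> \<lambda>z. \<Prod>v\<leftarrow>vs. inner v z"
  shows "(\<integral>z. F [] z * (h z - l2proj m (lower_chaos (length vs)) h z) \<partial>m)
    = (\<Prod>v\<leftarrow>vs. (s v)\<^sup>2) * (\<integral>z. F (rev vs) z \<partial>m)"
proof -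
  have [measurable]: "F [] \<in> borel_measurable borel" using deriv_familyD(1)[OF F, of "[]"] by simp
  have [measurable]: "wick_poly vs \<in> borel_measurable borel"
    by (rule polynomial_le_borel[OF polynomial_wick_poly[OF vs(1)]])
  have [measurable]: "h \<in> borel_measurable borel"
    using polynomial_le_borel[OF polynomial_le_mono[OF polynomial_wick_poly_diff[OF vs(1)] diff_le_self]]
      borel_measurable_add[of "\<lambda>z. h z - wick_poly vs z" borel "wick_poly vs"] by (simp add: h_def)
  \<comment> \<open>The chosen representative is measurable because it is a member of
    \<open>L2 m\<close>; the almost-everywhere comparison below relies on this.\<close>
  have [measurable]: "l2proj m (lower_chaos (length vs)) h \<in> borel_measurable m"
    using wick_transform_eq(2)[OF vs, folded h_def] by (simp add: L2_def)
  have "(\<integral>z. F [] z * (h z - l2proj m (lower_chaos (length vs)) h z) \<partial>m)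
      = (\<integral>z. F [] z * wick_poly vs z \<partial>m)"
  proof (rule integral_cong_AE)
    show "AE z in m. F [] z * (h z - l2proj m (lower_chaos (length vs)) h z) = F [] z * wick_poly vs z"
      using wick_transform_eq(1)[OF vs] unfolding h_def by eventually_elim simp
  qed simp_all
  then show ?thesis using wick_poly_duality[OF F vs(1), of "[]"] by simp
qed

end

section \<open>Multilinear forms and orthonormal expansions\<close>

locale orthonormal_basis =
  fixes b :: "'i \<Rightarrow> 'a::{real_inner, complete_space}" and I :: "'i set"
  assumes orthonormal: "i \<in> I \<Longrightarrow> j \<in> I \<Longrightarrow> inner (b i) (b j) = (if i = j then 1 else 0)"
    and dense: "closure (span (b ` I)) = UNIV"
begin

definition series :: "('i \<Rightarrow> real) \<Rightarrow> 'a" where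
  "series x = infsum (\<lambda>j. x j *\<^sub>R b j) I"

lemma inner_sum_basis:
  assumes "finite F" "F \<subseteq> I" "i \<in> I"
  shows "inner (b i) (\<Sum>j\<in>F. x j *\<^sub>R b j) = (if i \<in> F then x i else 0)"
proof -
  have "inner (b i) (\<Sum>j\<in>F. x j *\<^sub>R b j) = (\<Sum>j\<in>F. if i = j then x j else 0)"
    unfolding inner_sum_right using assms by (intro sum.cong) (auto simp: orthonormal subset_iff)
  then show ?thesis using assms by simp
qed

lemma norm_sum_basis:
  assumes "finite F" "F \<subseteq> I"
  shows "(norm (\<Sum>j\<in>F. x j *\<^sub>R b j))\<^sup>2 = (\<Sum>j\<in>F. (x j)\<^sup>2)"
proof -
  have "(norm (\<Sum>j\<in>F. x j *\<^sub>R b j))\<^sup>2 = (\<Sum>i\<in>F. x i * inner (b i) (\<Sum>j\<in>F. x j *\<^sub>R b j))"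
    by (simp add: power2_norm_eq_inner inner_sum_left)
  also have "\<dots> = (\<Sum>i\<in>F. x i * x i)"
    using assms by (intro sum.cong) (auto simp: inner_sum_basis subset_iff)
  finally show ?thesis by (simp add: power2_eq_square)
qed

text \<open>The partial sums over finite sets form a Cauchy net: beyond \<open>K\<close>, the
  squared distance of two of them is a tail of the summable squares.\<close>

lemma series_summable:
  assumes x: "(\<lambda>j. (x j)\<^sup>2) summable_on I"
  shows "(\<lambda>j. x j *\<^sub>R b j) summable_on I"
proof -
  let ?f = "\<lambda>j. x j *\<^sub>R b j" and ?q = "\<lambda>j. (x j)\<^sup>2"
  obtain L where lim: "(sum ?q \<longlongrightarrow> L) (finite_subsets_at_top I)"
    using x unfolding has_sum_def summable_on_def by blast
  have "\<exists>P. eventually P (finite_subsets_at_top I) \<and>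
              (\<forall>F F'. P F \<and> P F' \<longrightarrow> dist (sum ?f F) (sum ?f F') < \<epsilon>)" if \<epsilon>: "\<epsilon> > 0" for \<epsilon>
  proof -
    \<comment> \<open>Two errors of \<open>\<epsilon>^2 / 8\<close> add up to the square of
      \<open>\<epsilon> / 2\<close>, and two distances below \<open>\<epsilon> / 2\<close> give
      \<open>\<epsilon>\<close>.\<close>
    have "eventually (\<lambda>F. dist (sum ?q F) L < \<epsilon>\<^sup>2 / 8) (finite_subsets_at_top I)"
      by (rule tendstoD[OF lim]) (use \<epsilon> in simp)
    then obtain K where K12: "finite K" "K \<subseteq> I"
      and K3: "\<forall>F. finite F \<and> K \<subseteq> F \<and> F \<subseteq> I \<longrightarrow> dist (sum ?q F) L < \<epsilon>\<^sup>2 / 8"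
      unfolding eventually_finite_subsets_at_top by (elim exE conjE)
    note K = K12 K3[rule_format, OF conjI[OF _ conjI]]
    have near: "dist (sum ?f F) (sum ?f K) < \<epsilon> / 2" if F: "finite F" "K \<subseteq> F" "F \<subseteq> I" for F
    proof -
      have "(dist (sum ?f F) (sum ?f K))\<^sup>2 = (norm (sum ?f (F - K)))\<^sup>2"
        unfolding dist_norm using F by (subst sum_diff) auto
      also have "\<dots> = sum ?q (F - K)" using F by (intro norm_sum_basis) auto
      also have "\<dots> = sum ?q F - sum ?q K" using F by (subst sum_diff) auto
      also have "\<dots> < \<epsilon>\<^sup>2 / 8 + \<epsilon>\<^sup>2 / 8"
        using K(3)[OF F] K(3)[OF K(1) order_refl K(2)] unfolding dist_real_def by linarith
      also have "\<dots> = (\<epsilon> / 2)\<^sup>2" by (simp add: power2_eq_square)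
      finally show ?thesis by (rule power_less_imp_less_base) (use \<epsilon> in simp)
    qed
    show ?thesis
    proof (intro exI[of _ "\<lambda>F. finite F \<and> K \<subseteq> F \<and> F \<subseteq> I"] conjI allI impI)
      show "eventually (\<lambda>F. finite F \<and> K \<subseteq> F \<and> F \<subseteq> I) (finite_subsets_at_top I)"
        unfolding eventually_finite_subsets_at_top using K12 by blast
      fix F F' assume F: "(finite F \<and> K \<subseteq> F \<and> F \<subseteq> I) \<and> (finite F' \<and> K \<subseteq> F' \<and> F' \<subseteq> I)"
      show "dist (sum ?f F) (sum ?f F') < \<epsilon>"
      proof (rule dist_triangle_half_l)
        show "dist (sum ?f F) (sum ?f K) < \<epsilon> / 2" "dist (sum ?f F') (sum ?f K) < \<epsilon> / 2"
          using near F by blast+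
      qed
    qed
  qed
  then have "cauchy_filter (filtermap (sum ?f) (finite_subsets_at_top I))"
    by (simp add: cauchy_filter_metric_filtermap)
  then obtain l where "(sum ?f \<longlongrightarrow> l) (finite_subsets_at_top I)"
    using complete_uniform[where S = "UNIV :: 'a set"] complete_UNIV by (force simp add: filterlim_def)
  then show ?thesis using summable_on_def has_sum_def by blast
qed

lemma series_has_sum:
  "(\<lambda>j. (x j)\<^sup>2) summable_on I \<Longrightarrow> ((\<lambda>j. x j *\<^sub>R b j) has_sum series x) I"
  unfolding series_def by (intro has_sum_infsum series_summable)

lemma inner_series:
  assumes x: "(\<lambda>j. (x j)\<^sup>2) summable_on I" and i: "i \<in> I"
  shows "inner (b i) (series x) = x i"
proof -
  have "((\<lambda>j. inner (b i) (x j *\<^sub>R b j)) has_sum inner (b i) (series x)) I"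
    by (rule has_sum_bounded_linear[OF bounded_linear_inner_right series_has_sum[OF x]])
  moreover have "((\<lambda>j. inner (b i) (x j *\<^sub>R b j)) has_sum x i) I \<longleftrightarrow> (x has_sum x i) {i}"
    using i by (intro has_sum_cong_neutral) (auto simp: orthonormal)
  moreover have "(x has_sum x i) {i}" by (rule has_sum_finiteI) auto
  ultimately show ?thesis using has_sum_unique by blast
qed

lemma norm_series:
  assumes x: "(\<lambda>j. (x j)\<^sup>2) summable_on I"
  shows "norm (series x) = sqrt (infsum (\<lambda>j. (x j)\<^sup>2) I)"
proof -
  have "((\<lambda>j. inner (series x) (x j *\<^sub>R b j)) has_sum inner (series x) (series x)) I"
    by (rule has_sum_bounded_linear[OF bounded_linear_inner_right series_has_sum[OF x]])
  then have "((\<lambda>j. (x j)\<^sup>2) has_sum inner (series x) (series x)) I"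
    by (rule has_sum_cong[THEN iffD1, rotated])
      (simp add: inner_commute[of "series x"] inner_series[OF x] power2_eq_square)
  then show ?thesis by (simp add: norm_eq_sqrt_inner infsumI)
qed

text \<open>Bessel's inequality gives summability. The difference of the series and \<open>h\<close>
  is orthogonal to every basis vector, hence to the closure of their span, hence to itself.\<close>

lemma series_coefficients:
  defines "x \<equiv> \<lambda>h j. inner (b j) h"
  shows "(\<lambda>j. (x h j)\<^sup>2) summable_on I" "series (x h) = h"
proof -
  have le: "(\<Sum>j\<in>F. (x h j)\<^sup>2) \<le> (norm h)\<^sup>2" if F: "finite F" "F \<subseteq> I" for F
  proof -
    let ?s = "\<Sum>j\<in>F. x h j *\<^sub>R b j"
    have hs: "inner h ?s = (\<Sum>j\<in>F. (x h j)\<^sup>2)"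
      by (simp add: x_def inner_sum_right inner_commute power2_eq_square)
    have "0 \<le> (norm (h - ?s))\<^sup>2" by simp
    also have "\<dots> = (norm h)\<^sup>2 - 2 * inner h ?s + (norm ?s)\<^sup>2"
      by (simp add: power2_norm_eq_inner inner_diff_left inner_diff_right inner_commute)
    finally show ?thesis using hs norm_sum_basis[OF F, of "x h"] by simp
  qed
  show summable: "(\<lambda>j. (x h j)\<^sup>2) summable_on I"
    using le by (intro nonneg_bdd_above_summable_on bdd_aboveI[of _ "(norm h)\<^sup>2"]) auto
  have "inner v (series (x h) - h) = 0" if "v \<in> span (b ` I)" for v
    using that
  proof (induction rule: span_induct_alt)
    case (step c u y)
    then obtain i where "i \<in> I" "u = b i" by auto
    then have "inner u (series (x h) - h) = 0"
      using inner_series[OF summable, of i] by (simp add: inner_diff_right x_def)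
    with step show ?case by (simp add: inner_add_left)
  qed simp
  then have "span (b ` I) \<subseteq> {v. inner v (series (x h) - h) = 0}" by blast
  moreover have "closed {v. inner v (series (x h) - h) = 0}"
    by (intro closed_Collect_eq continuous_intros)
  ultimately have "closure (span (b ` I)) \<subseteq> {v. inner v (series (x h) - h) = 0}"
    by (rule closure_minimal)
  then have "series (x h) - h \<in> {v. inner v (series (x h) - h) = 0}" using dense by blast
  then show "series (x h) = h" by simp
qed

end

section \<open>Bounded multilinear forms and their norm\<close>

lemma multilinear_form_Cons:
  fixes \<phi> :: "'a::real_normed_vector list \<Rightarrow> real"
  assumes \<phi>: "multilinear_form (Suc k) \<phi>"
  shows "multilinear_form k (\<lambda>hs. \<phi> (u # hs))"
    and "length hs = k \<Longrightarrow> bounded_linear (\<lambda>u. \<phi> (u # hs))"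
proof -
  have lin: "\<phi> (hs[i := a *\<^sub>R h + c *\<^sub>R h']) = a * \<phi> (hs[i := h]) + c * \<phi> (hs[i := h'])"
    if "length hs = Suc k" "i < Suc k" for hs i a h c h'
    using \<phi> that unfolding multilinear_form_def by blast
  obtain C where C: "\<And>hs. length hs = Suc k \<Longrightarrow> \<bar>\<phi> hs\<bar> \<le> C * (\<Prod>h\<leftarrow>hs. norm h)"
    using \<phi> unfolding multilinear_form_def by blast
  show "multilinear_form k (\<lambda>hs. \<phi> (u # hs))"
    unfolding multilinear_form_def
  proof (intro conjI allI impI)
    fix hs :: "'a list" and i a c h h' assume "length hs = k" "i < k"
    then show "\<phi> (u # hs[i := a *\<^sub>R h + c *\<^sub>R h']) = a * \<phi> (u # hs[i := h]) + c * \<phi> (u # hs[i := h'])"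
      using lin[of "u # hs" "Suc i"] by simp
  next
    show "\<exists>C. \<forall>hs. length hs = k \<longrightarrow> \<bar>\<phi> (u # hs)\<bar> \<le> C * (\<Prod>h\<leftarrow>hs. norm h)"
      using C[of "u # _"] by (intro exI[of _ "C * norm u"]) (simp add: mult.assoc)
  qed
  assume hs: "length hs = k"
  have lin0: "\<phi> ((a *\<^sub>R h + c *\<^sub>R h') # hs) = a * \<phi> (h # hs) + c * \<phi> (h' # hs)" for a c h h'
    using lin[of "0 # hs" 0 a h c h'] hs by simp
  show "bounded_linear (\<lambda>u. \<phi> (u # hs))"
  proof (rule bounded_linear_intro[where K = "C * (\<Prod>h\<leftarrow>hs. norm h)"])
    show "\<phi> ((x + y) # hs) = \<phi> (x # hs) + \<phi> (y # hs)" for x y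
      using lin0[of 1 x 1 y] by simp
    show "\<phi> ((r *\<^sub>R x) # hs) = r *\<^sub>R \<phi> (x # hs)" for r x
      using lin0[of r x 0 0] by simp
    show "norm (\<phi> (x # hs)) \<le> norm x * (C * (\<Prod>h\<leftarrow>hs. norm h))" for x
      using C[of "x # hs"] hs by (simp add: mult_ac)
  qed
qed

lemma multilinear_form_cmult:
  fixes \<phi> :: "'a::real_normed_vector list \<Rightarrow> real"
  assumes \<phi>: "multilinear_form k \<phi>" shows "multilinear_form k (\<lambda>hs. c * \<phi> hs)"
  unfolding multilinear_form_def
proof (intro conjI allI impI)
  fix hs :: "'a list" and i a d h h' assume "length hs = k" "i < k"
  then have "\<phi> (hs[i := a *\<^sub>R h + d *\<^sub>R h']) = a * \<phi> (hs[i := h]) + d * \<phi> (hs[i := h'])"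
    using \<phi> unfolding multilinear_form_def by blast
  then show "c * \<phi> (hs[i := a *\<^sub>R h + d *\<^sub>R h']) = a * (c * \<phi> (hs[i := h])) + d * (c * \<phi> (hs[i := h']))"
    by (simp add: algebra_simps)
next
  obtain C where C: "\<And>hs. length hs = k \<Longrightarrow> \<bar>\<phi> hs\<bar> \<le> C * (\<Prod>h\<leftarrow>hs. norm h)"
    using \<phi> unfolding multilinear_form_def by blast
  have "\<bar>c * \<phi> hs\<bar> \<le> (\<bar>c\<bar> * C) * (\<Prod>h\<leftarrow>hs. norm h)" if "length hs = k" for hs
    using mult_left_mono[OF C[OF that], of "\<bar>c\<bar>"] by (simp add: abs_mult mult.assoc)
  then show "\<exists>C. \<forall>hs. length hs = k \<longrightarrow> \<bar>c * \<phi> hs\<bar> \<le> C * (\<Prod>h\<leftarrow>hs. norm h)" by blast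
qed

lemma prod_norm_nonneg: "0 \<le> (\<Prod>h\<leftarrow>hs. norm h)"
  by (induction hs) auto

lemma multilinear_form_scale:
  fixes \<phi> :: "'a::real_normed_vector list \<Rightarrow> real"
  shows "multilinear_form k \<phi> \<Longrightarrow> length hs = k \<Longrightarrow>
    \<phi> (map (\<lambda>h. c h *\<^sub>R h) hs) = (\<Prod>h\<leftarrow>hs. c h) * \<phi> hs"
proof (induction k arbitrary: \<phi> hs)
  case (Suc k)
  then obtain u us where hs: "hs = u # us" "length us = k" by (cases hs) auto
  have "\<phi> (map (\<lambda>h. c h *\<^sub>R h) hs) = (\<Prod>h\<leftarrow>us. c h) * \<phi> ((c u *\<^sub>R u) # us)"
    using Suc.IH[OF multilinear_form_Cons(1)[OF Suc.prems(1)] hs(2)] by (simp add: hs)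
  also have "\<phi> ((c u *\<^sub>R u) # us) = c u * \<phi> (u # us)"
    using linear_simps(5)[OF multilinear_form_Cons(2)[OF Suc.prems(1) hs(2)]] by simp
  finally show ?case by (simp add: hs mult_ac)
qed simp

text \<open>With the convention \<open>1 / 0 = 0\<close> the formula for \<open>sgn\<close> also
  holds at 0. If some argument is 0, the scaling cannot be inverted, but boundedness of the form
  makes both sides 0.\<close>

lemma multilinear_form_normalise:
  fixes \<phi> :: "'a::real_normed_vector list \<Rightarrow> real"
  assumes "multilinear_form k \<phi>" "length hs = k"
  shows "\<phi> hs = (\<Prod>h\<leftarrow>hs. norm h) * \<phi> (map sgn hs)"
proof -
  have sgn: "map sgn hs = map (\<lambda>h. (1 / norm h) *\<^sub>R h) hs"
    by (simp add: sgn_div_norm divide_inverse)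
  have "\<phi> (map sgn hs) = (\<Prod>h\<leftarrow>hs. 1 / norm h) * \<phi> hs"
    unfolding sgn by (rule multilinear_form_scale[OF assms])
  note scaled = this
  show ?thesis
  proof (cases "0 \<in> set hs")
    case True
    then have "(\<Prod>h\<leftarrow>hs. norm h) = 0" by (force simp: prod_list_zero_iff)
    moreover obtain C where "\<bar>\<phi> hs\<bar> \<le> C * (\<Prod>h\<leftarrow>hs. norm h)"
      using assms unfolding multilinear_form_def by blast
    ultimately show ?thesis by simp
  next
    case False
    then have "(\<Prod>h\<leftarrow>hs. norm h) * (\<Prod>h\<leftarrow>hs. 1 / norm h) = 1"
      by (induction hs) (auto simp: field_simps)
    with scaled show ?thesis by (simp add: mult.assoc[symmetric])
  qed
qed

lemma norm_sgn_le_1: "norm (sgn h) \<le> 1"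
  by (simp add: norm_sgn)

lemma unit_prod_le_1:
  "\<forall>h\<in>set hs. norm h \<le> 1 \<Longrightarrow> (\<Prod>h\<leftarrow>hs. norm h) \<le> 1"
proof (induction hs)
  case (Cons h hs)
  then show ?case by (auto intro!: mult_le_one prod_norm_nonneg)
qed simp

lemma bdd_above_unit_values:
  fixes \<phi> :: "'a::real_normed_vector list \<Rightarrow> real"
  assumes "multilinear_form k \<phi>"
  shows "bdd_above {\<bar>\<phi> hs\<bar> | hs. length hs = k \<and> (\<forall>h\<in>set hs. norm h \<le> 1)}"
proof -
  obtain C where C: "\<And>hs. length hs = k \<Longrightarrow> \<bar>\<phi> hs\<bar> \<le> C * (\<Prod>h\<leftarrow>hs. norm h)"
    using assms unfolding multilinear_form_def by blast
  have "\<bar>\<phi> hs\<bar> \<le> \<bar>C\<bar>" if "length hs = k" "\<forall>h\<in>set hs. norm h \<le> 1" for hs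
  proof -
    have "\<bar>\<phi> hs\<bar> \<le> C * (\<Prod>h\<leftarrow>hs. norm h)" using C that by blast
    also have "\<dots> \<le> \<bar>C\<bar> * 1"
      using unit_prod_le_1[OF that(2)] by (intro mult_mono prod_norm_nonneg) auto
    finally show ?thesis by simp
  qed
  then show ?thesis by (intro bdd_aboveI[of _ "\<bar>C\<bar>"]) auto
qed

lemma mlnorm_upper:
  assumes "multilinear_form k \<phi>" "length hs = k" "\<forall>h\<in>set hs. norm h \<le> 1"
  shows "\<bar>\<phi> hs\<bar> \<le> mlnorm k \<phi>"
  unfolding mlnorm_def using assms by (intro cSup_upper bdd_above_unit_values) auto

lemma mlnorm_cmult:
  fixes \<phi> :: "'a::real_normed_vector list \<Rightarrow> real"
  assumes \<phi>: "multilinear_form k \<phi>" and c: "0 < c"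
  shows "mlnorm k (\<lambda>hs. c * \<phi> hs) = c * mlnorm k \<phi>"
proof (rule antisym)
  let ?U = "\<lambda>hs::'a list. length hs = k \<and> (\<forall>h\<in>set hs. norm h \<le> 1)"
  have ne: "\<exists>hs. ?U hs" by (intro exI[of _ "replicate k 0"]) auto
  show "mlnorm k (\<lambda>hs. c * \<phi> hs) \<le> c * mlnorm k \<phi>"
    unfolding mlnorm_def[of k "\<lambda>hs. c * \<phi> hs"]
    using ne mlnorm_upper[OF \<phi>] c by (intro cSup_least) (auto simp: abs_mult)
  have "mlnorm k \<phi> \<le> mlnorm k (\<lambda>hs. c * \<phi> hs) / c"
    unfolding mlnorm_def[of k \<phi>]
    using ne mlnorm_upper[OF multilinear_form_cmult[OF \<phi>, of c]] c
    by (intro cSup_least) (auto simp: abs_mult pos_le_divide_eq mult.commute)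
  then show "c * mlnorm k \<phi> \<le> mlnorm k (\<lambda>hs. c * \<phi> hs)"
    using c by (simp add: pos_le_divide_eq mult.commute)
qed

section \<open>Iterated sums\<close>

lemma iter_has_sum_cong:
  "(\<And>is. length is = k \<Longrightarrow> set is \<subseteq> Zstar \<Longrightarrow> F is = G is) \<Longrightarrow> iter_has_sum k F s \<longleftrightarrow> iter_has_sum k G s"
proof (induction k arbitrary: F G s)
  case (Suc k)
  have "iter_has_sum k (\<lambda>is. F (i # is)) t \<longleftrightarrow> iter_has_sum k (\<lambda>is. G (i # is)) t" if "i \<in> Zstar" for i t
    using that Suc.prems by (intro Suc.IH) auto
  then show ?case by simp
qed simp

lemma iter_has_sum_unique: "iter_has_sum k F s \<Longrightarrow> iter_has_sum k F t \<Longrightarrow> s = t"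
proof (induction k arbitrary: F s t)
  case (Suc k)
  from Suc.prems(1) obtain g where g: "\<And>i. i \<in> Zstar \<Longrightarrow> iter_has_sum k (\<lambda>is. F (i # is)) (g i)"
    "(g has_sum s) Zstar" by auto
  from Suc.prems(2) obtain g' where g': "\<And>i. i \<in> Zstar \<Longrightarrow> iter_has_sum k (\<lambda>is. F (i # is)) (g' i)"
    "(g' has_sum t) Zstar" by auto
  have "(g has_sum t) Zstar"
    using g'(2) Suc.IH[OF g(1) g'(1)] by (subst has_sum_cong[of _ g g']) auto
  then show ?case using g(2) has_sum_unique by blast
qed simp

text \<open>With the first index fixed, the induction hypothesis sums over the remaining slots. The
  outer sum then converges because the form is bounded and linear in its first argument.\<close>

lemma iter_has_sum_multilinear:
  fixes b :: "int \<Rightarrow> 'a::{real_inner, complete_space}"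
  assumes b: "orthonormal_basis b Zstar"
  shows "multilinear_form k \<phi> \<Longrightarrow> length xs = k \<Longrightarrow> \<forall>x\<in>set xs. x \<in> ell2 \<Longrightarrow>
    iter_has_sum k (\<lambda>is. \<phi> (map b is) * (\<Prod>j<k. (xs ! j) (is ! j)))
      (\<phi> (map (orthonormal_basis.series b Zstar) xs))"
proof (induction k arbitrary: \<phi> xs)
  case (Suc k)
  interpret orthonormal_basis b Zstar by (rule b)
  obtain y ys where xs: "xs = y # ys" "length ys = k" using Suc.prems(2) by (cases xs) auto
  have y: "(\<lambda>j. (y j)\<^sup>2) summable_on Zstar" and ys: "\<forall>x\<in>set ys. x \<in> ell2"
    using Suc.prems(3) by (auto simp: xs ell2_def)
  define g where "g i = \<phi> ((y i *\<^sub>R b i) # map series ys)" for i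
  have lin: "\<phi> ((a *\<^sub>R h) # hs) = a * \<phi> (h # hs)" if "length hs = k" for a h hs
    using linear_simps(5)[OF multilinear_form_Cons(2)[OF Suc.prems(1) that]] by simp
  have "iter_has_sum k (\<lambda>is. \<phi> (map b (i # is)) * (\<Prod>j<Suc k. (xs ! j) ((i # is) ! j))) (g i)" for i
  proof -
    have "iter_has_sum k (\<lambda>is. \<phi> ((y i *\<^sub>R b i) # map b is) * (\<Prod>j<k. (ys ! j) (is ! j))) (g i)"
      unfolding g_def
      by (rule Suc.IH[OF multilinear_form_Cons(1)[OF Suc.prems(1)] xs(2) ys])
    then show ?thesis
      by (rule iter_has_sum_cong[THEN iffD1, rotated])
        (simp add: lin prod.lessThan_Suc_shift xs(1) mult_ac del: prod.lessThan_Suc)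
  qed
  moreover have "(g has_sum \<phi> (map series xs)) Zstar"
    unfolding g_def xs using xs(2)
      has_sum_bounded_linear[OF multilinear_form_Cons(2)[OF Suc.prems(1), of "map series ys"]
        series_has_sum[OF y]] by simp
  ultimately show ?case by auto
qed simp

text \<open>\<open>higher_derivs\<close> controls the remainder on unit vectors only; multilinearity extends this to
  all vectors through \<open>multilinear_form_normalise\<close>.\<close>

context
  fixes f :: "'a::real_normed_vector \<Rightarrow> real" and D
  assumes D: "higher_derivs f D"
begin

lemma multilinear_derivs: "multilinear_form k (D k x)"
  using D by (simp add: higher_derivs_def)

lemma derivs_has_derivative:
  assumes hs: "length hs = k"
  shows "((\<lambda>z. D k z hs) has_derivative (\<lambda>u. D (Suc k) x (u # hs))) (at x)"
proof -
  let ?us = "map sgn hs"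
  have us: "length ?us = k" "\<forall>h\<in>set ?us. norm h \<le> 1" using hs by (auto simp: norm_sgn_le_1)
  have "((\<lambda>z. D k z ?us) has_derivative (\<lambda>u. D (Suc k) x (u # ?us))) (at x)"
    unfolding has_derivative_at_alt
  proof (intro conjI allI impI)
    show "bounded_linear (\<lambda>u. D (Suc k) x (u # ?us))"
      by (rule multilinear_form_Cons(2)[OF multilinear_derivs us(1)])
    fix \<epsilon> :: real assume "\<epsilon> > 0"
    then obtain \<delta> where \<delta>: "\<delta> > 0" "\<And>u. norm u < \<delta> \<Longrightarrow>
        \<bar>D k (x + u) ?us - D k x ?us - D (Suc k) x (u # ?us)\<bar> \<le> \<epsilon> * norm u"
      using D us unfolding higher_derivs_def by blast
    show "\<exists>\<delta>>0. \<forall>y. norm (y - x) < \<delta> \<longrightarrow>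
        norm (D k y ?us - D k x ?us - D (Suc k) x ((y - x) # ?us)) \<le> \<epsilon> * norm (y - x)"
    proof (intro exI[of _ \<delta>] conjI allI impI \<delta>(1))
      fix y assume "norm (y - x) < \<delta>"
      from \<delta>(2)[OF this]
      show "norm (D k y ?us - D k x ?us - D (Suc k) x ((y - x) # ?us)) \<le> \<epsilon> * norm (y - x)" by simp
    qed
  qed
  from has_derivative_mult_right[OF this, of "\<Prod>h\<leftarrow>hs. norm h"]
  show ?thesis
    using multilinear_form_normalise[OF multilinear_derivs hs]
      multilinear_form_normalise[OF multilinear_form_Cons(1)[OF multilinear_derivs] hs] by simp
qed

lemma derivs_borel_measurable:
  assumes "length hs = k" shows "(\<lambda>z. D k z hs) \<in> borel_measurable borel"
  using has_derivative_continuous[OF derivs_has_derivative[OF assms]]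
  by (intro borel_measurable_continuous_onI) (auto simp: continuous_on_eq_continuous_at)

lemma derivs_along_line:
  assumes hs: "length hs = k"
  shows "((\<lambda>t. D k (z + t *\<^sub>R v) hs) has_real_derivative D (Suc k) (z + t *\<^sub>R v) (v # hs)) (at t)"
proof -
  have "((\<lambda>t. z + t *\<^sub>R v) has_derivative (\<lambda>t. t *\<^sub>R v)) (at t)"
    by (auto intro!: derivative_eq_intros)
  from has_derivative_compose[OF this derivs_has_derivative[OF hs]]
  have "((\<lambda>t. D k (z + t *\<^sub>R v) hs) has_derivative (\<lambda>r. D (Suc k) (z + t *\<^sub>R v) ((r *\<^sub>R v) # hs))) (at t)" .
  moreover have "D (Suc k) (z + t *\<^sub>R v) ((r *\<^sub>R v) # hs) = D (Suc k) (z + t *\<^sub>R v) (v # hs) * r" for r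
    using linear_simps(5)[OF multilinear_form_Cons(2)[OF multilinear_derivs hs]] by (simp add: mult.commute)
  ultimately show ?thesis by (simp add: has_field_derivative_def mult_commute_abs)
qed

section \<open>Integrals of the derivatives as bounded multilinear forms\<close>

context
  fixes m :: "'a measure"
  assumes sets_m: "sets m = sets borel"
    and int: "\<And>n. (\<integral>\<^sup>+x. ennreal (mlnorm n (D n x)) \<partial>m) < \<infinity>"
begin

lemma derivs_integrable_unit:
  assumes hs: "length hs = k" "\<forall>h\<in>set hs. norm h \<le> 1"
  shows "integrable m (\<lambda>z. D k z hs)"
    and "\<bar>\<integral>z. D k z hs \<partial>m\<bar> \<le> enn2real (\<integral>\<^sup>+x. ennreal (mlnorm k (D k x)) \<partial>m)"
proof -
  have meas: "(\<lambda>z. D k z hs) \<in> borel_measurable m"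
    using derivs_borel_measurable[OF hs(1)] measurable_cong_sets[OF sets_m refl] by blast
  \<comment> \<open>\<open>nn_integral\<close> is monotone on arbitrary functions, which allows a
    comparison with the supremum \<open>mlnorm k (D k x)\<close>, whose measurability in
    \<open>x\<close> has not been established.\<close>
  have le: "(\<integral>\<^sup>+z. ennreal (norm (D k z hs)) \<partial>m) \<le> (\<integral>\<^sup>+x. ennreal (mlnorm k (D k x)) \<partial>m)"
    using mlnorm_upper[OF multilinear_derivs hs] by (intro nn_integral_mono ennreal_leI) simp
  show i: "integrable m (\<lambda>z. D k z hs)"
    using le int[of k] by (intro integrableI_bounded meas) (rule order_le_less_trans)
  have "\<bar>\<integral>z. D k z hs \<partial>m\<bar> \<le> (\<integral>z. norm (D k z hs) \<partial>m)"
    using integral_norm_bound[of m "\<lambda>z. D k z hs"] by simp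
  also have "\<dots> = enn2real (\<integral>\<^sup>+z. ennreal (norm (D k z hs)) \<partial>m)"
    using i by (intro integral_eq_nn_integral) auto
  also have "\<dots> \<le> enn2real (\<integral>\<^sup>+x. ennreal (mlnorm k (D k x)) \<partial>m)"
    using le int[of k] by (intro enn2real_mono) auto
  finally show "\<bar>\<integral>z. D k z hs \<partial>m\<bar> \<le> enn2real (\<integral>\<^sup>+x. ennreal (mlnorm k (D k x)) \<partial>m)" .
qed

lemma derivs_integral_normalise:
  assumes hs: "length hs = k"
  shows "integrable m (\<lambda>z. D k z hs)"
    and "(\<integral>z. D k z hs \<partial>m) = (\<Prod>h\<leftarrow>hs. norm h) * (\<integral>z. D k z (map sgn hs) \<partial>m)"
proof -
  have eq: "(\<lambda>z. D k z hs) = (\<lambda>z. (\<Prod>h\<leftarrow>hs. norm h) * D k z (map sgn hs))"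
    using multilinear_form_normalise[OF multilinear_derivs hs] by auto
  show "integrable m (\<lambda>z. D k z hs)"
    unfolding eq using hs by (intro integrable_mult_right derivs_integrable_unit) (auto simp: norm_sgn_le_1)
  show "(\<integral>z. D k z hs \<partial>m) = (\<Prod>h\<leftarrow>hs. norm h) * (\<integral>z. D k z (map sgn hs) \<partial>m)"
    unfolding eq by simp
qed

lemma multilinear_integral_derivs: "multilinear_form k (\<lambda>hs. \<integral>z. D k z hs \<partial>m)"
  unfolding multilinear_form_def
proof (intro conjI allI impI)
  fix hs :: "'a list" and i a c h h' assume hs: "length hs = k" "i < k"
  have "D k z (hs[i := a *\<^sub>R h + c *\<^sub>R h']) = a * D k z (hs[i := h]) + c * D k z (hs[i := h'])" for z
    using multilinear_derivs[of k z] hs unfolding multilinear_form_def by blast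
  then show "(\<integral>z. D k z (hs[i := a *\<^sub>R h + c *\<^sub>R h']) \<partial>m)
      = a * (\<integral>z. D k z (hs[i := h]) \<partial>m) + c * (\<integral>z. D k z (hs[i := h']) \<partial>m)"
    using derivs_integral_normalise(1)[of "hs[i := h]" k] derivs_integral_normalise(1)[of "hs[i := h']" k] hs
    by simp
next
  show "\<exists>C. \<forall>hs. length hs = k \<longrightarrow> \<bar>\<integral>z. D k z hs \<partial>m\<bar> \<le> C * (\<Prod>h\<leftarrow>hs. norm h)"
  proof (intro exI[of _ "enn2real (\<integral>\<^sup>+x. ennreal (mlnorm k (D k x)) \<partial>m)"] allI impI)
    fix hs :: "'a list" assume hs: "length hs = k"
    have "\<bar>\<integral>z. D k z (map sgn hs) \<partial>m\<bar> \<le> enn2real (\<integral>\<^sup>+x. ennreal (mlnorm k (D k x)) \<partial>m)"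
      using hs by (intro derivs_integrable_unit(2)) (auto simp: norm_sgn_le_1)
    from mult_left_mono[OF this prod_norm_nonneg[of hs]]
    show "\<bar>\<integral>z. D k z hs \<partial>m\<bar>
        \<le> enn2real (\<integral>\<^sup>+x. ennreal (mlnorm k (D k x)) \<partial>m) * (\<Prod>h\<leftarrow>hs. norm h)"
      unfolding derivs_integral_normalise(2)[OF hs] abs_mult
      by (simp add: prod_norm_nonneg mult.commute)
  qed
qed

end

end

section \<open>The covariance of an eigenvector field\<close>

lemma Re_cinner [simp]: "Re (cinner J x y) = inner x y"
  and Im_cinner [simp]: "Im (cinner J x y) = - inner x (J y)"
  by (simp_all add: cinner_def)

lemma complex_structureD:
  assumes "complex_structure J"
  shows "bounded_linear J" "J (J x) = - x" "inner (J x) (J y) = inner x y"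
    "inner (J x) y = - inner x (J y)"
proof -
  show J: "bounded_linear J" "\<And>x. J (J x) = - x" "\<And>x y. inner (J x) (J y) = inner x y"
    using assms unfolding complex_structure_def by blast+
  have "inner (J x) y = - inner (J x) (J (J y))" by (simp add: J(2))
  then show "inner (J x) y = - inner x (J y)" by (simp only: J(3))
qed

lemma prob_space_muT: "prob_space muT"
proof -
  have "prob_space (restrict_space lborel {0..1::real})"
    by (rule prob_spaceI) (simp add: space_restrict_space emeasure_restrict_space)
  then show ?thesis
    unfolding muT_def by (rule prob_space.prob_space_distr)
      (auto intro!: measurable_restrict_space1)
qed

lemma sets_muT [measurable_cong, simp]: "sets muT = sets borel"
  by (simp add: muT_def)

lemma AE_muT_circle: "AE w in muT. w \<in> circle"
proof -
  have [measurable]: "circle \<in> sets borel" by (simp add: circle_def borel_closed)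
  show ?thesis
    unfolding muT_def
    by (subst AE_distr_iff) (auto simp: circle_def intro!: measurable_restrict_space1)
qed

locale eigenvector_field_covariance =
  fixes J R :: "'a::{real_inner, complete_space} \<Rightarrow> 'a" and E :: "complex \<Rightarrow> 'a"
  assumes J: "complex_structure J"
    and E_meas: "E \<in> borel_measurable borel"
    and E_bounded: "bounded (E ` circle)"
    and E_spanning: "mu_spanning J E"
    and R_def: "cinner J (R x) y = (\<integral>w. cinner J x (E w) * cnj (cinner J y (E w)) \<partial>muT)"
begin

lemma covariance_symmetric: "inner (R x) y = inner x (R y)"
proof -
  have "cinner J (R y) x = cnj (cinner J (R x) y)"
    unfolding R_def by (subst Bochner_Integration.integral_cnj[symmetric]) (simp add: mult.commute)
  then have "Re (cinner J (R y) x) = Re (cnj (cinner J (R x) y))" by (rule arg_cong)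
  then show ?thesis by (simp add: inner_commute)
qed

text \<open>Makes \<open>J (e j)\<close> an eigenvector of \<open>R\<close> with the eigenvalue of
  \<open>e j\<close>, in agreement with \<open>sigz\<close> being even.\<close>

lemma covariance_J: "R (J x) = J (R x)"
proof -
  \<comment> \<open>\<open>cinner\<close> is conjugate-linear in its first argument, so
    \<open>J\<close> there acts as multiplication by minus the imaginary unit.\<close>
  have J_left: "cinner J (J x) z = - \<i> * cinner J x z" for z
    by (simp add: complex_eq_iff complex_structureD[OF J])
  have "cinner J (R (J x)) y = - \<i> * cinner J (R x) y" for y
    unfolding R_def J_left by (simp add: mult.assoc)
  then have "Re (cinner J (R (J x)) y) = Re (- \<i> * cinner J (R x) y)" for y by simp
  then have "inner (R (J x)) y = inner (J (R x)) y" for y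
    by (simp add: complex_structureD(4)[OF J])
  then have "inner (R (J x) - J (R x)) (R (J x) - J (R x)) = 0"
    by (simp only: inner_diff_left diff_self)
  then show ?thesis by simp
qed

text \<open>If \<open>R x = 0\<close>, then \<open>x\<close> is orthogonal to \<open>E w\<close> for almost every \<open>w\<close>, hence to everything.\<close>

lemma covariance_eq_0D:
  assumes "R x = 0" shows "x = 0"
proof -
  interpret muT: prob_space muT by (rule prob_space_muT)
  have inner_E [measurable]: "(\<lambda>w. inner h (E w)) \<in> borel_measurable borel" for h
    using measurable_compose[OF E_meas borel_measurable_inner_left] .
  have cinner_E: "cinner J x (E w) = Complex (inner x (E w)) (inner (J x) (E w))" for w
    by (simp add: cinner_def complex_structureD(4)[OF J])
  define F where "F w = (inner x (E w))\<^sup>2 + (inner (J x) (E w))\<^sup>2" for w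
  have F_meas [measurable]: "F \<in> borel_measurable borel" unfolding F_def by measurable
  obtain C where C: "\<And>w. w \<in> circle \<Longrightarrow> norm (E w) \<le> C"
    using E_bounded unfolding bounded_iff by auto
  \<comment> \<open>A vanishing Bochner integral carries information only for an integrable
    function. \<open>E\<close> is bounded on the circle, which carries all the mass of
    \<open>muT\<close>.\<close>
  have int_inner: "integrable muT (\<lambda>w. (inner h (E w))\<^sup>2)" for h
  proof (rule muT.integrable_const_bound)
    show "AE w in muT. norm ((inner h (E w))\<^sup>2) \<le> (norm h * C)\<^sup>2"
      using AE_muT_circle
    proof eventually_elim
      fix w assume "w \<in> circle"
      have "\<bar>inner h (E w)\<bar> \<le> norm h * norm (E w)" by (rule Cauchy_Schwarz_ineq2)
      also have "\<dots> \<le> norm h * C" using C[OF \<open>w \<in> circle\<close>] by (rule mult_left_mono) simp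
      finally have "\<bar>inner h (E w)\<bar>\<^sup>2 \<le> (norm h * C)\<^sup>2" by (rule power_mono) simp
      then show "norm ((inner h (E w))\<^sup>2) \<le> (norm h * C)\<^sup>2" by simp
    qed
  qed simp
  have "cinner J x (E w) * cnj (cinner J x (E w)) = complex_of_real (F w)" for w
    by (simp add: cinner_E F_def complex_eq_iff power2_eq_square)
  then have "complex_of_real (\<integral>w. F w \<partial>muT) = cinner J (R x) x"
    unfolding R_def by simp
  also have "\<dots> = 0" by (simp add: assms cinner_def complex_eq_iff)
  finally have "(\<integral>w. F w \<partial>muT) = 0" by simp
  moreover have "integrable muT F" unfolding F_def using int_inner by simp
  moreover have "AE w in muT. 0 \<le> F w" by (simp add: F_def)
  ultimately have AE: "AE w in muT. F w = 0" using integral_nonneg_eq_0_iff_AE by blast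
  define A where "A = {w. F w = 0}"
  have A: "A \<in> sets muT" unfolding A_def by measurable
  have "measure muT A = 1"
    using AE A by (subst muT.prob_eq_1) (auto simp: A_def)
  then have cl: "closure (cspan J (E ` (A \<inter> circle))) = UNIV"
    using E_spanning A unfolding mu_spanning_def by blast
  have "inner x v = 0" if "v \<in> cspan J (E ` (A \<inter> circle))" for v
    using that unfolding cspan_def
  proof (induction rule: span_induct_alt)
    case (step c u y)
    then obtain w where w: "w \<in> A" "u = E w \<or> u = J (E w)" by auto
    \<comment> \<open>Both real parts of the complex pairing vanish, so \<open>x\<close> is
      orthogonal to \<open>E w\<close> and to \<open>J (E w)\<close>, as the complex span
      requires.\<close>
    have "inner x (E w) = 0 \<and> inner (J x) (E w) = 0"
      using w(1) by (simp add: A_def F_def sum_power2_eq_zero_iff)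
    then have "inner x u = 0" using w(2) complex_structureD(4)[OF J, of x "E w"] by auto
    with step show ?case by (simp add: inner_add_right)
  qed simp
  then have "cspan J (E ` (A \<inter> circle)) \<subseteq> {v. inner x v = 0}" by blast
  moreover have "closed {v. inner x v = 0}" by (intro closed_Collect_eq continuous_intros)
  ultimately have "closure (cspan J (E ` (A \<inter> circle))) \<subseteq> {v. inner x v = 0}"
    by (rule closure_minimal)
  then have "x \<in> {v. inner x v = 0}" using cl by blast
  then show "x = 0" by simp
qed

end

section \<open>The real orthonormal basis and the coefficients of the form\<close>

lemma frak_e_image: "frak_e J e ` Zstar = e ` {1..} \<union> J ` e ` {1..}"
proof (intro equalityI subsetI)
  fix v assume "v \<in> frak_e J e ` Zstar"
  then obtain l where l: "l \<noteq> 0" "v = frak_e J e l" by (auto simp: Zstar_def)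
  show "v \<in> e ` {1..} \<union> J ` e ` {1..}"
  proof (cases "l > 0")
    case True
    then have "v = e (nat l)" "nat l \<in> {1..}" using l by (auto simp: frak_e_def)
    then show ?thesis by blast
  next
    case False
    then have "v = J (e (nat (- l)))" "nat (- l) \<in> {1..}" using l by (auto simp: frak_e_def)
    then show ?thesis by blast
  qed
next
  fix v assume "v \<in> e ` {1..} \<union> J ` e ` {1..}"
  then obtain j :: nat where j: "j \<ge> 1" "v = e j \<or> v = J (e j)" by auto
  have "frak_e J e (int j) = e j" "frak_e J e (- int j) = J (e j)"
    using j(1) by (auto simp: frak_e_def)
  moreover have "int j \<in> Zstar" "- int j \<in> Zstar" using j(1) by (auto simp: Zstar_def)
  ultimately show "v \<in> frak_e J e ` Zstar" using j(2) by (metis imageI)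
qed

text \<open>The real part of complex orthonormality concerns the vectors \<open>e i\<close> among
  themselves, the imaginary part their products with \<open>J (e j)\<close>.\<close>

lemma frak_e_orthonormal_basis:
  fixes J :: "'a::{real_inner, complete_space} \<Rightarrow> 'a"
  assumes J: "complex_structure J"
    and e_orth: "\<forall>i\<ge>1. \<forall>j\<ge>1. cinner J (e i) (e j) = (if i = j then 1 else 0)"
    and e_basis: "closure (cspan J (e ` {1..})) = UNIV"
  shows "orthonormal_basis (frak_e J e) Zstar"
proof
  have ee: "inner (e i) (e j) = (if i = j then 1 else 0)" "inner (e i) (J (e j)) = 0"
    if "i \<ge> 1" "j \<ge> 1" for i j
  proof -
    have c: "cinner J (e i) (e j) = (if i = j then 1 else 0)" using e_orth that by blast
    show "inner (e i) (e j) = (if i = j then 1 else 0)"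
      using arg_cong[OF c, of Re] by simp
    show "inner (e i) (J (e j)) = 0"
      using arg_cong[OF c, of Im] by (simp split: if_splits)
  qed
  fix i j assume ij: "i \<in> Zstar" "j \<in> Zstar"
  have Jee: "inner (J (e i)) (J (e j)) = (if i = j then 1 else 0)" "inner (J (e i)) (e j) = 0"
    if "i \<ge> 1" "j \<ge> 1" for i j
    using ee[OF that] complex_structureD(3,4)[OF J] by simp_all
  consider "i > 0" "j > 0" | "i > 0" "j < 0" | "i < 0" "j > 0" | "i < 0" "j < 0"
    using ij unfolding Zstar_def by fastforce
  then show "inner (frak_e J e i) (frak_e J e j) = (if i = j then 1 else 0)"
    by cases (auto simp: frak_e_def ee Jee)
next
  show "closure (span (frak_e J e ` Zstar)) = UNIV"
    using e_basis by (simp add: frak_e_image cspan_def)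
qed

lemma prod_nth_eq_prod_list:
  fixes g :: "'b \<Rightarrow> 'c::comm_monoid_mult"
  shows "length xs = k \<Longrightarrow> (\<Prod>j<k. g (xs ! j)) = (\<Prod>x\<leftarrow>xs. g x)"
  by (simp add: prod.list_conv_set_nth atLeast0LessThan)

text \<open>The Gaussian measure is brought into diagonal form in the basis
  \<open>frak_e J e\<close>. The product of variances from the duality then cancels the one in
  \<open>alpha\<close>; it is nonzero because no basis vector lies in the kernel of
  \<open>R\<close>.\<close>

lemma alpha_eq_integral_derivs:
  fixes J :: "'a::{real_inner, complete_space} \<Rightarrow> 'a"
  assumes cov: "eigenvector_field_covariance J R E"
    and m_gauss: "gaussian_measure J R m"
    and e_orth: "\<forall>i\<ge>1. \<forall>j\<ge>1. cinner J (e i) (e j) = (if i = j then 1 else 0)"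
    and e_basis: "closure (cspan J (e ` {1..})) = UNIV"
    and e_eigen: "\<forall>j\<ge>1. R (e j) = (2 * (\<sigma> j)\<^sup>2) *\<^sub>R e j"
    and D: "higher_derivs f D"
    and int: "\<And>n. (\<integral>\<^sup>+x. ennreal (mlnorm n (D n x)) \<partial>m) < \<infinity>"
    and "is": "length is = k" "set is \<subseteq> Zstar" and k: "k \<ge> 1"
  shows "alpha m J e \<sigma> f k is = (1 / fact k) * (\<integral>z. D k z (map (frak_e J e) is) \<partial>m)"
proof -
  interpret cov: eigenvector_field_covariance J R E by (rule cov)
  let ?b = "frak_e J e"
  interpret basis: orthonormal_basis ?b Zstar
    by (rule frak_e_orthonormal_basis[OF cov.J e_orth e_basis])
  have m: "prob_space m" "sets m = sets borel"
    and char: "\<And>x. (\<integral>z. cis (inner x z) \<partial>m) = complex_of_real (exp (- inner (R x) x / 4))"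
    using m_gauss by (auto simp: gaussian_measure_def)
  \<comment> \<open>\<open>R\<close> is given only through its sesquilinear form; this weak
    linearity follows from symmetry by moving \<open>R\<close> to the other argument.\<close>
  have R_lin: "inner (R (x + c *\<^sub>R v)) y = inner (R x) y + c * inner (R v) y" for x v y c
    by (simp add: cov.covariance_symmetric inner_add_left)
  have eigen: "R (?b j) = (2 * (sigz \<sigma> j)\<^sup>2) *\<^sub>R ?b j" if "j \<in> Zstar" for j
  proof (cases "j > 0")
    case True
    then show ?thesis using e_eigen by (auto simp: frak_e_def sigz_def)
  next
    case False
    then have j: "j < 0" using that by (simp add: Zstar_def)
    then have "nat (- j) \<ge> 1" by simp
    then have "R (J (e (nat (- j)))) = J ((2 * (\<sigma> (nat (- j)))\<^sup>2) *\<^sub>R e (nat (- j)))"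
      using e_eigen by (simp add: cov.covariance_J)
    also have "\<dots> = (2 * (\<sigma> (nat (- j)))\<^sup>2) *\<^sub>R J (e (nat (- j)))"
      by (rule linear_simps(5)[OF complex_structureD(1)[OF cov.J]])
    finally show ?thesis using j by (simp add: frak_e_def sigz_def)
  qed
  have norm_b: "norm (?b j) = 1" if "j \<in> Zstar" for j
    using basis.orthonormal[OF that that] by (simp add: norm_eq_1)
  have sig: "sigz \<sigma> j \<noteq> 0" if "j \<in> Zstar" for j
  proof
    assume "sigz \<sigma> j = 0"
    then have "R (?b j) = 0" using eigen[OF that] by simp
    then have "?b j = 0" by (rule cov.covariance_eq_0D)
    then show False using norm_b[OF that] by simp
  qed
  \<comment> \<open>The exponent \<open>- inner (R x) x / 4\<close> equals \<open>- q x / 2\<close>,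
    so \<open>q x\<close> is the variance of \<open>inner x\<close>; at a basis vector it is the
    square of \<open>sigz\<close>.\<close>
  define q where "q x = inner (R x) x / 2" for x
  \<comment> \<open>The eigenvalues determine the \<open>\<sigma> j\<close> only up to sign, so the
    positive root is taken, as a function of the vector; only squares are compared with
    \<open>sigz\<close>.\<close>
  define s where "s v = sqrt (q v)" for v
  have s2: "(s (?b j))\<^sup>2 = (sigz \<sigma> j)\<^sup>2" if "j \<in> Zstar" for j
    using basis.orthonormal[OF that that] by (simp add: s_def q_def eigen[OF that])
  obtain Q :: "'a set" where Q: "countable Q" "closure Q = UNIV"
    by (rule countable_dense_of_span[OF _ basis.dense]) auto
  interpret prob_space m by (rule m(1))
  interpret diagonal_gaussian m q "?b ` Zstar" s Q
  proof
    show "sets m = sets borel" by (rule m(2))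
    show "(\<integral>z. cis (inner x z) \<partial>m) = complex_of_real (exp (- q x / 2))" for x
      by (simp add: char q_def)
    show "countable Q" "closure Q = UNIV" by (rule Q)+
    show "q (c *\<^sub>R x) = c\<^sup>2 * q x" for c x
      using R_lin[of 0 c x "c *\<^sub>R x"] R_lin[of 0 0 0 x]
      by (simp add: q_def power2_eq_square cov.covariance_symmetric)
    fix v assume "v \<in> ?b ` Zstar"
    then obtain j where j: "j \<in> Zstar" "v = ?b j" by blast
    show "norm v = 1" using norm_b j by simp
    show "0 < s v"
      using basis.orthonormal[OF j(1) j(1)] sig[OF j(1)] by (simp add: s_def q_def j eigen[OF j(1)])
    fix x
    define y where "y = x - inner x v *\<^sub>R v"
    let ?c = "inner x v"
    have yv: "inner y v = 0" using \<open>norm v = 1\<close> by (simp add: y_def inner_diff_left norm_eq_1)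
    have Rv: "R v = (2 * (s v)\<^sup>2) *\<^sub>R v" using eigen[OF j(1)] s2[OF j(1)] j by simp
    \<comment> \<open>The mixed terms vanish because \<open>v\<close> is an eigenvector of
      \<open>R\<close> and \<open>y\<close> is orthogonal to \<open>v\<close>.\<close>
    have "inner (R x) x = inner (R (y + ?c *\<^sub>R v)) (y + ?c *\<^sub>R v)" by (simp add: y_def)
    also have "\<dots> = inner (R y) y + ?c * inner (R y) v + ?c * (inner (R v) y + ?c * inner (R v) v)"
      by (simp only: R_lin inner_add_right inner_scaleR_right) (simp add: algebra_simps)
    also have "inner (R y) v = 0" using yv by (simp add: cov.covariance_symmetric Rv)
    also have "inner (R v) y = 0" using yv by (simp add: Rv inner_commute)
    also have "inner (R v) v = 2 * (s v)\<^sup>2" using \<open>norm v = 1\<close> by (simp add: Rv norm_eq_1)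
    finally show "q x = q (x - ?c *\<^sub>R v) + (s v)\<^sup>2 * ?c\<^sup>2"
      by (simp add: q_def y_def[symmetric] power2_eq_square field_simps)
  qed
  have gfun: "gfun J e = (\<lambda>j. inner (?b j))" by (auto simp: gfun_def fun_eq_iff)
  have "Gsp m J e = first_chaos"
    unfolding Gsp_def first_chaos_def gfun by (simp add: image_image)
  then have "Gk m J e j = fin_span (chaos_products j)" for j
    by (simp add: Gk_def chaos_products_def)
  then have Pk: "Pk m J e k h = l2proj m (lower_chaos k) h" for h
    by (simp add: Pk_def lower_chaos_def)
  \<comment> \<open>With the reversed list, the duality yields \<open>D k z\<close> in the order of \<open>is\<close>, so that
    symmetry of the higher derivatives is not needed.\<close>
  define vs where "vs = rev (map ?b is)"
  have vs: "vs \<in> lists (?b ` Zstar)" "vs \<noteq> []" "length vs = k" "rev vs = map ?b is"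
    using "is" k by (auto simp: vs_def subset_iff)
  have h: "(\<lambda>z. \<Prod>j<k. gfun J e (is ! j) z) = (\<lambda>z. \<Prod>v\<leftarrow>vs. inner v z)"
  proof
    fix z
    have "(\<Prod>j<k. gfun J e (is ! j) z) = (\<Prod>i\<leftarrow>is. inner (?b i) z)"
      using prod_nth_eq_prod_list[OF "is"(1), of "\<lambda>i. inner (?b i) z"] by (simp add: gfun)
    then show "(\<Prod>j<k. gfun J e (is ! j) z) = (\<Prod>v\<leftarrow>vs. inner v z)"
      by (simp add: vs_def rev_map[symmetric] prod_list.rev o_def)
  qed
  have F: "deriv_family (\<lambda>hs z. D (length hs) z hs)"
    unfolding deriv_family_def
    using derivs_borel_measurable[OF D refl] derivs_integral_normalise(1)[OF D m(2) int refl]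
      derivs_along_line[OF D refl] by auto
  have f: "D 0 z [] = f z" for z using D by (simp add: higher_derivs_def)
  have "(\<integral>x. f x * wick m J e k (\<lambda>z. \<Prod>j<k. gfun J e (is ! j) z) x \<partial>m)
      = (\<Prod>v\<leftarrow>vs. (s v)\<^sup>2) * (\<integral>z. D k z (map ?b is) \<partial>m)"
    using integral_wick_transform[OF F vs(1,2)] "is"(1)
    by (simp add: wick_def Pk h vs(3,4) f)
  also have "(\<Prod>v\<leftarrow>vs. (s v)\<^sup>2) = (\<Prod>i\<leftarrow>is. (s (?b i))\<^sup>2)"
    by (simp add: vs_def rev_map[symmetric] prod_list.rev o_def)
  also have "\<dots> = (\<Prod>i\<leftarrow>is. (sigz \<sigma> i)\<^sup>2)"
    using "is"(2) s2 by (intro arg_cong[where f = prod_list] map_cong) auto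
  also have "\<dots> = (\<Prod>j<k. (sigz \<sigma> (is ! j))\<^sup>2)"
    using prod_nth_eq_prod_list[OF "is"(1), of "\<lambda>i. (sigz \<sigma> i)\<^sup>2"] by simp
  finally have "(\<integral>x. f x * wick m J e k (\<lambda>z. \<Prod>j<k. gfun J e (is ! j) z) x \<partial>m)
      = (\<Prod>j<k. (sigz \<sigma> (is ! j))\<^sup>2) * (\<integral>z. D k z (map ?b is) \<partial>m)" .
  moreover have "(\<Prod>j<k. (sigz \<sigma> (is ! j))\<^sup>2) \<noteq> 0"
  proof -
    have "is ! j \<in> Zstar" if "j < k" for j using "is" that nth_mem by blast
    then show ?thesis using sig by simp
  qed
  ultimately show ?thesis by (simp add: alpha_def)
qed

theorem theorem5p8:
  fixes J :: "'a::{real_inner, complete_space} \<Rightarrow> 'a"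
    and T R :: "'a \<Rightarrow> 'a"
    and E :: "complex \<Rightarrow> 'a"
    and m :: "'a measure"
    and e :: "nat \<Rightarrow> 'a"
    and \<sigma> :: "nat \<Rightarrow> real"
    and f :: "'a \<Rightarrow> real"
    and D :: "nat \<Rightarrow> 'a \<Rightarrow> 'a list \<Rightarrow> real"
    and k :: nat
  assumes J: "complex_structure J"
    and T_bounded: "bounded_linear T"
    and T_clinear: "\<forall>x. T (J x) = J (T x)"
    and E_meas: "E \<in> borel_measurable borel"
    and E_bounded: "bounded (E ` circle)"
    and E_eigen: "\<forall>w\<in>circle. T (E w) = cscale J w (E w)"
    and E_spanning: "mu_spanning J E"
    and R_def: "\<forall>x y. cinner J (R x) y =
                   (\<integral>w. cinner J x (E w) * cnj (cinner J y (E w)) \<partial>muT)"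
    and m_gauss: "gaussian_measure J R m"
    and e_orth: "\<forall>i\<ge>1. \<forall>j\<ge>1. cinner J (e i) (e j) = (if i = j then 1 else 0)"
    and e_basis: "closure (cspan J (e ` {1..})) = UNIV"
    and e_eigen: "\<forall>j\<ge>1. R (e j) = (2 * (\<sigma> j)\<^sup>2) *\<^sub>R e j"
    and f_derivs: "higher_derivs f D"
    and f_meas: "f \<in> borel_measurable borel"
    and f_L2: "integrable m (\<lambda>x. (f x)\<^sup>2)"
    and f_int: "\<forall>n. (\<integral>\<^sup>+x. ennreal (mlnorm n (D n x)) \<partial>m) < \<infinity>"
    and k: "k \<ge> 1"
  shows "(\<forall>xs. length xs = k \<and> (\<forall>x\<in>set xs. x \<in> ell2) \<longrightarrow>
            iter_has_sum k (\<lambda>is. alpha m J e \<sigma> f k is * (\<Prod>j<k. (xs ! j) (is ! j)))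
              ((1 / fact k) * (\<integral>z. D k z (map (theta J e) xs) \<partial>m)))
      \<and> bdd_above {\<bar>Bform m J e \<sigma> f k xs\<bar> | xs. length xs = k \<and>
                     (\<forall>x\<in>set xs. x \<in> ell2 \<and> ell2norm x \<le> 1)}
      \<and> Sup {\<bar>Bform m J e \<sigma> f k xs\<bar> | xs. length xs = k \<and>
                     (\<forall>x\<in>set xs. x \<in> ell2 \<and> ell2norm x \<le> 1)}
        = (1 / fact k) * mlnorm k (\<lambda>hs. \<integral>z. D k z hs \<partial>m)"
proof -
  interpret basis: orthonormal_basis "frak_e J e" Zstar
    by (rule frak_e_orthonormal_basis[OF J e_orth e_basis])
  have cov: "eigenvector_field_covariance J R E"
    using J E_meas E_bounded E_spanning R_def by unfold_locales auto
  have sets_m: "sets m = sets borel" using m_gauss by (simp add: gaussian_measure_def)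
  have theta: "theta J e = basis.series"
    by (auto simp: theta_def basis.series_def fun_eq_iff)
  let ?\<Phi> = "\<lambda>hs. \<integral>z. D k z hs \<partial>m"
  define \<phi> where "\<phi> hs = (1 / fact k) * ?\<Phi> hs" for hs
  have \<Phi>: "multilinear_form k ?\<Phi>"
    by (rule multilinear_integral_derivs[OF f_derivs sets_m f_int[rule_format]])
  have \<phi>: "multilinear_form k \<phi>"
    unfolding \<phi>_def by (rule multilinear_form_cmult[OF \<Phi>])
  have sum: "iter_has_sum k (\<lambda>is. alpha m J e \<sigma> f k is * (\<Prod>j<k. (xs ! j) (is ! j)))
      (\<phi> (map (theta J e) xs))" if xs: "length xs = k" "\<forall>x\<in>set xs. x \<in> ell2" for xs
  proof (rule iter_has_sum_cong[THEN iffD2])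
    show "iter_has_sum k (\<lambda>is. \<phi> (map (frak_e J e) is) * (\<Prod>j<k. (xs ! j) (is ! j)))
        (\<phi> (map (theta J e) xs))"
      unfolding theta by (rule iter_has_sum_multilinear[OF basis.orthonormal_basis_axioms \<phi> xs])
    fix "is" assume "length is = k" "set is \<subseteq> Zstar"
    from alpha_eq_integral_derivs[OF cov m_gauss e_orth e_basis e_eigen f_derivs f_int[rule_format] this k]
    show "alpha m J e \<sigma> f k is * (\<Prod>j<k. (xs ! j) (is ! j))
        = \<phi> (map (frak_e J e) is) * (\<Prod>j<k. (xs ! j) (is ! j))" by (simp add: \<phi>_def)
  qed
  have Bform: "Bform m J e \<sigma> f k xs = \<phi> (map (theta J e) xs)"
    if "length xs = k" "\<forall>x\<in>set xs. x \<in> ell2" for xs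
    unfolding Bform_def using sum[OF that] iter_has_sum_unique by blast
  have norm_theta: "norm (theta J e x) = ell2norm x" if "x \<in> ell2" for x
    using basis.norm_series[of x] that by (simp add: theta ell2_def ell2norm_def)
  define x where "x h j = inner (frak_e J e j) h" for h j
  have x: "x h \<in> ell2" "theta J e (x h) = h" for h
    using basis.series_coefficients[of h] by (simp_all add: x_def[abs_def] theta ell2_def)
  \<comment> \<open>\<open>theta\<close> is an isometry of \<open>ell2\<close> onto the whole space,
    with the coordinates \<open>x h\<close> as its inverse. The unit balls correspond, so the two
    suprema are taken over the same set.\<close>
  have sets_eq: "{\<bar>Bform m J e \<sigma> f k xs\<bar> | xs. length xs = k \<and> (\<forall>x\<in>set xs. x \<in> ell2 \<and> ell2norm x \<le> 1)}
      = {\<bar>\<phi> hs\<bar> | hs. length hs = k \<and> (\<forall>h\<in>set hs. norm h \<le> 1)}" (is "?L = ?R")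
  proof (intro equalityI subsetI)
    fix r assume "r \<in> ?L"
    then obtain xs where xs: "r = \<bar>Bform m J e \<sigma> f k xs\<bar>" "length xs = k"
      "\<forall>x\<in>set xs. x \<in> ell2 \<and> ell2norm x \<le> 1" by blast
    then have "r = \<bar>\<phi> (map (theta J e) xs)\<bar>" by (simp add: Bform)
    then show "r \<in> ?R"
      using xs(2,3) norm_theta by (intro CollectI exI[of _ "map (theta J e) xs"]) auto
  next
    fix r assume "r \<in> ?R"
    then obtain hs where hs: "r = \<bar>\<phi> hs\<bar>" "length hs = k" "\<forall>h\<in>set hs. norm h \<le> 1" by blast
    have "map (theta J e) (map x hs) = hs" by (simp add: x(2) map_idI)
    moreover have "\<forall>y\<in>set (map x hs). y \<in> ell2 \<and> ell2norm y \<le> 1"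
    proof -
      have "ell2norm (x h) = norm h" for h using norm_theta[OF x(1)[of h]] by (simp add: x(2))
      then show ?thesis using hs(3) x(1) by simp
    qed
    ultimately show "r \<in> ?L"
      using hs(1,2) Bform[of "map x hs"] by (intro CollectI exI[of _ "map x hs"]) auto
  qed
  have "Sup ?R = (1 / fact k) * mlnorm k ?\<Phi>"
    using mlnorm_cmult[OF \<Phi>, of "1 / fact k"] by (simp add: mlnorm_def \<phi>_def)
  then show ?thesis
    unfolding sets_eq using sum bdd_above_unit_values[OF \<phi>] by (auto simp: \<phi>_def)
qed

end
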